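(* Let $\mathbb{Z}_{(1)}=\mathbb{Z}$ and $\mathbb{Z}_{(k+1)}=\mathbb{Z}_{(k)}\wr \mathbb{Z}$ for $k\ge 1$. Then for every $k\ge 2$, $$\alpha^*(\mathbb{Z}_{(k)})=\frac{1}{2-2^{1-k}}\qquad\text{and}\qquad \mathrm{a}^*(\mathbb{Z}_{(k)})\le \frac{1}{k-1}.$$
   Context: The wreath product $G\wr H$ is the group of all pairs $(f,x)$ with $f:H\to G$ finitely supported and $x\in H$, with product $(f,x)(g,y)=(z\mapsto f(z)g(x^{-1}z),\,xy)$. For a finitely generated group $G$ with left-invariant word metric $d_G$ induced by a finite symmetric generating set $S$, the Hilbert compression exponent $\alpha^*(G)$ is the supremum of all $\alpha\ge 0$ for which there exist a Lipschitz map $f:G\to L_2$ and $c>0$ with $\|f(x)-f(y)\|_2\ge c\,d_G(x,y)^\alpha$ for all distinct $x,y\in G$. For $r\in\mathbb{N}$ let $J(r)$ be the smallest constant $J>0$ such that for every $f:G\to\mathbb{R}$ vanishing outside the ball $B(e,r)=\{x\in G: d_G(x,e)\le r\}$, $$\Big(\sum_{x\in G}f(x)^2\Big)^{1/2}\le J\Big(\sum_{x\in G}\sum_{s\in S}|f(sx)-f(x)|^2\Big)^{1/2}.$$ $\mathrm{a}^*(G)$ is the supremum of all $a\ge 0$ for which there exists $c>0$ with $J(r)\ge c\,r^a$ for all $r\in\mathbb{N}$. *)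

theory Defs
  imports
    "HOL-Algebra.Weak_Morphisms"
    "HOL-Algebra.Elementary_Groups"
    "HOL-Analysis.Analysis"
begin

section \<open>Wreath products\<close>

text \<open>As usual in HOL-Algebra, functions on \<open>carrier H\<close> are extensional.\<close>

definition wreath_product ::
    "('a, 'm) monoid_scheme \<Rightarrow> ('b, 'n) monoid_scheme \<Rightarrow> (('b \<Rightarrow> 'a) \<times> 'b) monoid"
  where "wreath_product G H =
    \<lparr> carrier = {f \<in> carrier H \<rightarrow>\<^sub>E carrier G. finite {z \<in> carrier H. f z \<noteq> \<one>\<^bsub>G\<^esub>}} \<times> carrier H,
      monoid.mult = (\<lambda>(f, x) (g, y).
        (\<lambda>z \<in> carrier H. f z \<otimes>\<^bsub>G\<^esub> g (inv\<^bsub>H\<^esub> x \<otimes>\<^bsub>H\<^esub> z), x \<otimes>\<^bsub>H\<^esub> y)),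
      one = (\<lambda>z \<in> carrier H. \<one>\<^bsub>G\<^esub>, \<one>\<^bsub>H\<^esub>) \<rparr>"

text \<open>
  The element type of \<open>wreath_product G H\<close> differs from that of \<open>G\<close>, so the iteration cannot be
  performed inside one fixed type without recoding. The datatype below contains injective copies
  both of the integers and of pairs of an int-indexed family of its own elements and an integer;
  \<open>image_group\<close> transports the group structure along these two injections.
\<close>

datatype iter_elem = Base int | Wr "int \<Rightarrow> iter_elem" int

text \<open>\<open>iter_wreath k\<close> is \<open>\<int>\<^sub>(\<^sub>k\<^sub>)\<close> for \<open>k \<ge> 1\<close>; the value at 0 is irrelevant.\<close>

primrec iter_wreath :: "nat \<Rightarrow> iter_elem monoid"
  where
    "iter_wreath 0 = singleton_group (Base 0)"
  | "iter_wreath (Suc k) =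
      (if k = 0 then image_group Base integer_group
       else image_group (\<lambda>(f, x). Wr f x) (wreath_product (iter_wreath k) integer_group))"


section \<open>Word metrics\<close>

definition symmetric_generating_set :: "('a, 'm) monoid_scheme \<Rightarrow> 'a set \<Rightarrow> bool"
  where "symmetric_generating_set G S \<longleftrightarrow>
    S \<subseteq> carrier G \<and> (\<forall>s\<in>S. inv\<^bsub>G\<^esub> s \<in> S) \<and> generate G S = carrier G"

definition word_length :: "('a, 'm) monoid_scheme \<Rightarrow> 'a set \<Rightarrow> 'a \<Rightarrow> nat"
  where "word_length G S g =
    (LEAST n. \<exists>w. length w = n \<and> set w \<subseteq> S \<and> foldr (\<lambda>s h. s \<otimes>\<^bsub>G\<^esub> h) w \<one>\<^bsub>G\<^esub> = g)"

definition word_dist :: "('a, 'm) monoid_scheme \<Rightarrow> 'a set \<Rightarrow> 'a \<Rightarrow> 'a \<Rightarrow> nat"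
  where "word_dist G S x y = word_length G S (inv\<^bsub>G\<^esub> x \<otimes>\<^bsub>G\<^esub> y)"

definition word_ball :: "('a, 'm) monoid_scheme \<Rightarrow> 'a set \<Rightarrow> nat \<Rightarrow> 'a set"
  where "word_ball G S r = {x \<in> carrier G. word_dist G S x \<one>\<^bsub>G\<^esub> \<le> r}"


section \<open>Hilbert compression exponent\<close>

text \<open>
  \<open>L\<^sub>2\<close> is \<open>L\<^sub>2([0,1])\<close>, with elements given by representatives, so that two distinct functions
  may have distance 0.
\<close>

definition L2_functions :: "(real \<Rightarrow> real) set"
  where "L2_functions = {g \<in> borel_measurable (lebesgue_on {0..1}).
    integrable (lebesgue_on {0..1}) (\<lambda>t. (g t)\<^sup>2)}"

definition L2_norm :: "(real \<Rightarrow> real) \<Rightarrow> real"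
  where "L2_norm g = sqrt (\<integral>t. (g t)\<^sup>2 \<partial>lebesgue_on {0..1})"

definition lipschitz_into_L2 ::
    "('a, 'm) monoid_scheme \<Rightarrow> 'a set \<Rightarrow> ('a \<Rightarrow> real \<Rightarrow> real) \<Rightarrow> bool"
  where "lipschitz_into_L2 G S f \<longleftrightarrow>
    f \<in> carrier G \<rightarrow> L2_functions \<and>
    (\<exists>L. \<forall>x\<in>carrier G. \<forall>y\<in>carrier G.
      L2_norm (\<lambda>t. f x t - f y t) \<le> L * real (word_dist G S x y))"

definition hilbert_compression_exponent :: "('a, 'm) monoid_scheme \<Rightarrow> 'a set \<Rightarrow> ereal"
  where "hilbert_compression_exponent G S =
    Sup {ereal \<alpha> | \<alpha>. 0 \<le> \<alpha> \<and>
      (\<exists>f c. lipschitz_into_L2 G S f \<and> c > 0 \<and>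
        (\<forall>x\<in>carrier G. \<forall>y\<in>carrier G. x \<noteq> y \<longrightarrow>
          L2_norm (\<lambda>t. f x t - f y t) \<ge> c * real (word_dist G S x y) powr \<alpha>))}"


section \<open>The exponent \<open>a\<^sup>*\<close>\<close>

text \<open>
  All sums over the group below have finite support, since \<open>f\<close> is supported in a ball and \<open>S\<close> is
  finite. The infimum is attained whenever the group is infinite; for a finite group and large
  \<open>r\<close> no admissible constant exists and the value is \<open>\<infinity>\<close>.
\<close>

definition ball_poincare_const :: "('a, 'm) monoid_scheme \<Rightarrow> 'a set \<Rightarrow> nat \<Rightarrow> ereal"
  where "ball_poincare_const G S r =
    Inf {ereal J | J. J > 0 \<and>
      (\<forall>f :: 'a \<Rightarrow> real. (\<forall>x \<in> carrier G - word_ball G S r. f x = 0) \<longrightarrow>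
        sqrt (\<Sum>\<^sub>\<infinity>x\<in>carrier G. (f x)\<^sup>2)
        \<le> J * sqrt (\<Sum>\<^sub>\<infinity>x\<in>carrier G. \<Sum>s\<in>S. \<bar>f (s \<otimes>\<^bsub>G\<^esub> x) - f x\<bar>\<^sup>2))}"

definition poincare_growth_exponent :: "('a, 'm) monoid_scheme \<Rightarrow> 'a set \<Rightarrow> ereal"
  where "poincare_growth_exponent G S =
    Sup {ereal a | a. 0 \<le> a \<and>
      (\<exists>c>0. \<forall>r. ball_poincare_const G S r \<ge> ereal (c * real r powr a))}"

end

theory Submission
  imports Defs
begin

text \<open>
  Both exponents are read off from random walks. Let a lamplighter in \<open>G \<wr> \<int>\<close> switch the lamp at the
  current position by a step of a symmetric walk on \<open>G\<close>, move by \<open>\<plusminus> 1\<close>, and switch again.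
  Conditionally on the path of the position, the lamps perform independent walks on \<open>G\<close> that are
  timed by the local times of the path (\<open>walk_lamps_product\<close>). So a property of walks passes from \<open>G\<close>
  to \<open>G \<wr> \<int>\<close> once the local times of the simple random walk on \<open>\<int>\<close> are under control: in time \<open>t\<close>,
  about \<open>sqrt t\<close> sites are visited about \<open>sqrt t\<close> times, and a local time exceeds \<open>M\<close> only with
  probability about \<open>exp (- M\<^sup>2 / t)\<close>. Applied to the speed and to the return probabilities of the
  walk, this gives:

  \<^item> If the walk on \<open>G\<close> has moved by \<open>n powr \<beta>\<close> at time \<open>n\<close>, the walk on \<open>G \<wr> \<int>\<close> has moved by
    \<open>n powr ((1 + \<beta>) / 2)\<close> (\<open>has_speed_walk\<close>). Starting with \<open>1 / 2\<close> for \<open>\<int>\<close>, the exponent of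
    \<open>\<int>\<^sub>(\<^sub>k\<^sub>)\<close> is \<open>\<beta> = 1 - (1 / 2) ^ k\<close>.

  \<^item> If transition probabilities on \<open>G\<close> are at most \<open>exp (- c * n powr \<gamma>)\<close>, the exponent on
    \<open>G \<wr> \<int>\<close> is \<open>(1 + \<gamma>) / (3 - \<gamma>)\<close> (\<open>has_return_exponent_walk\<close>), which gives
    \<open>\<gamma> = (k - 1) / (k + 1)\<close> for \<open>\<int>\<^sub>(\<^sub>k\<^sub>)\<close>.

  Upper bound for the compression: a Hilbert space has Markov type 2, so that a Lipschitz image of the
  walk moves by \<open>O(sqrt n)\<close> in time \<open>n\<close>, while the walk itself moves by \<open>n powr \<beta>\<close>; hence the
  compression exponent is at most \<open>1 / (2 * \<beta>)\<close> (\<open>compression_le\<close>). Markov type is a statement on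
  stationary chains. A uniformly distributed starting point does not exist in an infinite group, and
  is replaced by one in a Folner set (\<open>folner_wr\<close>).

  Lower bound for the compression: an embedding of \<open>G\<close> with exponent \<open>\<alpha>\<close> yields embeddings of
  \<open>G \<wr> \<int>\<close> with all exponents below \<open>2 * \<alpha> / (2 * \<alpha> + 1)\<close> (\<open>embeds_wr\<close>). They consist of a
  part that sees the width of the region in which the lamps differ almost isometrically, and of the
  orthogonal sum of the embeddings of all lamps. The recursion \<open>\<alpha> \<mapsto> 2 * \<alpha> / (2 * \<alpha> + 1)\<close> is the
  recursion \<open>\<beta> \<mapsto> (1 + \<beta>) / 2\<close> in terms of \<open>\<alpha> = 1 / (2 * \<beta>)\<close>, so that both bounds agree.

  Upper bound for the Poincare exponent: for functions on a ball of radius \<open>r\<close>, a small spectral gap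
  would force return probabilities at time \<open>n\<close> to be large compared to the inverse of the volume
  \<open>exp (O(r))\<close> of the ball (\<open>killed_rayleigh\<close>). With \<open>n\<close> of the order of \<open>r powr (1 / \<gamma>)\<close>, the
  gap is at least of the order of \<open>r / n\<close>, and the Poincare constant, the inverse of the square root
  of the gap, is at most of the order of \<open>r powr ((1 / \<gamma> - 1) / 2) = r powr (1 / (k - 1))\<close>
  (\<open>poincare_le\<close>).
\<close>

section \<open>The iterated wreath products\<close>

definition wr :: "iter_elem monoid \<Rightarrow> iter_elem monoid"
  where "wr G = image_group (\<lambda>(f, x). Wr f x) (wreath_product G integer_group)"

definition lamp :: "iter_elem monoid \<Rightarrow> iter_elem \<Rightarrow> iter_elem"
  where "lamp G a = Wr (\<lambda>z. if z = 0 then a else \<one>\<^bsub>G\<^esub>) 0"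

definition shift :: "iter_elem monoid \<Rightarrow> int \<Rightarrow> iter_elem"
  where "shift G e = Wr (\<lambda>z. \<one>\<^bsub>G\<^esub>) e"

lemma finite_int_translate:
  fixes c :: int
  assumes "finite {z. P z}"
  shows "finite {z. P (z + c)}" "finite {z. P (z - c)}"
  using finite_vimageI[OF assms, of "\<lambda>z. z + c"] finite_vimageI[OF assms, of "\<lambda>z. z - c"]
  by (auto simp: inj_def)

lemma inj_on_Wr: "inj_on (\<lambda>(f, x). Wr f x) A"
  by (auto simp: inj_on_def)

lemma carrier_wr:
  "carrier (wr G) = {Wr f x | f x. (\<forall>z. f z \<in> carrier G) \<and> finite {z. f z \<noteq> \<one>\<^bsub>G\<^esub>}}"
  by (auto simp: wr_def image_group_def wreath_product_def PiE_def Pi_def)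

lemma Wr_in_wr [simp]:
  "Wr f x \<in> carrier (wr G) \<longleftrightarrow> (\<forall>z. f z \<in> carrier G) \<and> finite {z. f z \<noteq> \<one>\<^bsub>G\<^esub>}"
  by (simp add: carrier_wr)

lemma wr_cases:
  assumes "g \<in> carrier (wr G)"
  obtains f x where "g = Wr f x" "\<And>z. f z \<in> carrier G" "finite {z. f z \<noteq> \<one>\<^bsub>G\<^esub>}"
  using assms by (auto simp: carrier_wr)

lemma wr_one: "\<one>\<^bsub>wr G\<^esub> = Wr (\<lambda>_. \<one>\<^bsub>G\<^esub>) 0"
  by (simp add: wr_def image_group_def wreath_product_def fun_eq_iff)

lemma wr_mult:
  assumes "Wr f x \<in> carrier (wr G)" "Wr g y \<in> carrier (wr G)"
  shows "Wr f x \<otimes>\<^bsub>wr G\<^esub> Wr g y = Wr (\<lambda>z. f z \<otimes>\<^bsub>G\<^esub> g (z - x)) (x + y)"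
proof -
  let ?C = "carrier (wreath_product G integer_group)"
  have inv: "inv_into ?C (\<lambda>(f, x). Wr f x) (Wr h u) = (h, u)" if "Wr h u \<in> carrier (wr G)" for h u
  proof -
    have "(h, u) \<in> ?C"
      using that by (auto simp: wreath_product_def)
    from inv_into_f_f[OF inj_on_Wr this] show ?thesis by simp
  qed
  show ?thesis
    using inv[OF assms(1)] inv[OF assms(2)]
    by (simp add: wr_def image_group_def wreath_product_def add.commute[of "- x"] fun_eq_iff)
qed

text \<open>All groups below live in the type of the iterated wreath products, so that one locale serves
  every level of the iteration.\<close>

locale iter_group = group G for G :: "iter_elem monoid" (structure)
begin

lemma group_wr: "group (wr G)"
proof (rule groupI)
  fix a b assume "a \<in> carrier (wr G)" "b \<in> carrier (wr G)"
  then obtain f x g y where ab: "a = Wr f x" "b = Wr g y"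
    and f: "\<And>z. f z \<in> carrier G" "finite {z. f z \<noteq> \<one>}"
    and g: "\<And>z. g z \<in> carrier G" "finite {z. g z \<noteq> \<one>}"
    by (elim wr_cases) blast
  have "finite ({z. f z \<noteq> \<one>} \<union> {z. g (z - x) \<noteq> \<one>})"
    using f finite_int_translate(2)[OF g(2), of x] by simp
  then have "finite {z. f z \<otimes> g (z - x) \<noteq> \<one>}"
    by (rule rev_finite_subset) auto
  then show "a \<otimes>\<^bsub>wr G\<^esub> b \<in> carrier (wr G)"
    using f g by (simp add: ab wr_mult)
next
  show "\<one>\<^bsub>wr G\<^esub> \<in> carrier (wr G)" by (simp add: wr_one)
next
  fix a b c assume "a \<in> carrier (wr G)" "b \<in> carrier (wr G)" "c \<in> carrier (wr G)"
  then obtain f x g y h u where abc: "a = Wr f x" "b = Wr g y" "c = Wr h u"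
    and f: "\<And>z. f z \<in> carrier G" "finite {z. f z \<noteq> \<one>}"
    and g: "\<And>z. g z \<in> carrier G" "finite {z. g z \<noteq> \<one>}"
    and h: "\<And>z. h z \<in> carrier G" "finite {z. h z \<noteq> \<one>}"
    by (elim wr_cases) blast
  have fin: "finite {z. f1 z \<otimes> f2 (z - x) \<noteq> \<one>}"
    if "finite {z. f1 z \<noteq> \<one>}" "finite {z. f2 z \<noteq> \<one>}" for f1 f2 :: "int \<Rightarrow> iter_elem" and x
  proof -
    have "finite ({z. f1 z \<noteq> \<one>} \<union> {z. f2 (z - x) \<noteq> \<one>})"
      using that(1) finite_int_translate(2)[OF that(2), of x] by simp
    then show ?thesis
      by (rule rev_finite_subset) auto
  qed
  show "a \<otimes>\<^bsub>wr G\<^esub> b \<otimes>\<^bsub>wr G\<^esub> c = a \<otimes>\<^bsub>wr G\<^esub> (b \<otimes>\<^bsub>wr G\<^esub> c)"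
    using f g h by (simp add: abc wr_mult fin m_assoc algebra_simps)
next
  fix a assume "a \<in> carrier (wr G)"
  then obtain f x where a: "a = Wr f x" "\<And>z. f z \<in> carrier G" "finite {z. f z \<noteq> \<one>}"
    by (elim wr_cases) blast
  then show "\<one>\<^bsub>wr G\<^esub> \<otimes>\<^bsub>wr G\<^esub> a = a" by (simp add: wr_one wr_mult)
  let ?b = "Wr (\<lambda>z. inv (f (z + x))) (- x)"
  have "finite {z. inv (f (z + x)) \<noteq> \<one>}"
    using finite_int_translate(1)[OF a(3), of x] by (rule rev_finite_subset) auto
  with a have "?b \<in> carrier (wr G)" "?b \<otimes>\<^bsub>wr G\<^esub> a = \<one>\<^bsub>wr G\<^esub>"
    by (simp_all add: wr_mult wr_one)
  then show "\<exists>y\<in>carrier (wr G). y \<otimes>\<^bsub>wr G\<^esub> a = \<one>\<^bsub>wr G\<^esub>" by blast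
qed

sublocale W: group "wr G" by (rule group_wr)

lemma iter_group_wr: "iter_group (wr G)" by unfold_locales

lemma lamp_closed [simp]: "a \<in> carrier G \<Longrightarrow> lamp G a \<in> carrier (wr G)"
proof -
  assume "a \<in> carrier G"
  moreover have "finite {z::int. (if z = 0 then a else \<one>) \<noteq> \<one>}"
    by (rule finite_subset[of _ "{0}"]) auto
  ultimately show ?thesis by (simp add: lamp_def)
qed

lemma shift_closed [simp]: "shift G e \<in> carrier (wr G)"
  by (simp add: shift_def)

lemma mult_lamp:
  assumes "Wr f x \<in> carrier (wr G)" "a \<in> carrier G"
  shows "Wr f x \<otimes>\<^bsub>wr G\<^esub> lamp G a = Wr (f(x := f x \<otimes> a)) x"
  using assms(1) lamp_closed[OF assms(2)] assms(2) unfolding lamp_def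
  by (subst wr_mult) (auto simp: fun_eq_iff)

lemma mult_shift:
  assumes "Wr f x \<in> carrier (wr G)"
  shows "Wr f x \<otimes>\<^bsub>wr G\<^esub> shift G e = Wr f (x + e)"
  using assms shift_closed[of e] unfolding shift_def
  by (subst wr_mult) (auto simp: fun_eq_iff)

lemma wr_inv:
  assumes "Wr f x \<in> carrier (wr G)"
  shows "inv\<^bsub>wr G\<^esub> Wr f x = Wr (\<lambda>z. inv (f (z + x))) (- x)"
proof (rule W.inv_equality)
  have "finite {z. f z \<noteq> \<one>}" using assms by simp
  then have "finite {z. inv (f (z + x)) \<noteq> \<one>}"
    by (rule rev_finite_subset[OF finite_int_translate(1)[where c = x]]) auto
  then show "Wr (\<lambda>z. inv (f (z + x))) (- x) \<in> carrier (wr G)"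
    "Wr (\<lambda>z. inv (f (z + x))) (- x) \<otimes>\<^bsub>wr G\<^esub> Wr f x = \<one>\<^bsub>wr G\<^esub>"
    using assms by (simp_all add: wr_mult wr_one)
qed (use assms in auto)

lemma inv_lamp: "a \<in> carrier G \<Longrightarrow> inv\<^bsub>wr G\<^esub> lamp G a = lamp G (inv a)"
  using wr_inv[of "\<lambda>z. if z = 0 then a else \<one>" 0] lamp_closed[of a]
  by (auto simp: lamp_def fun_eq_iff)

lemma inv_shift: "inv\<^bsub>wr G\<^esub> shift G e = shift G (- e)"
  using wr_inv[of "\<lambda>z. \<one>" e] by (simp add: shift_def)

lemma Wr_inv_mult:
  assumes "Wr f x \<in> carrier (wr G)" "Wr g y \<in> carrier (wr G)"
  shows "inv\<^bsub>wr G\<^esub> Wr f x \<otimes>\<^bsub>wr G\<^esub> Wr g y = Wr (\<lambda>z. inv (f (z + x)) \<otimes> g (z + x)) (y - x)"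
  using W.inv_closed[OF assms(1)] assms by (simp add: wr_inv wr_mult del: Wr_in_wr)

end

definition int_copy :: "iter_elem monoid"
  where "int_copy = image_group Base integer_group"

lemma carrier_int_copy: "carrier int_copy = range Base"
  by (simp add: int_copy_def image_group_def)

lemma int_copy_one: "\<one>\<^bsub>int_copy\<^esub> = Base 0"
  by (simp add: int_copy_def image_group_def)

lemma int_copy_mult: "Base x \<otimes>\<^bsub>int_copy\<^esub> Base y = Base (x + y)"
  by (simp add: int_copy_def image_group_def inj_def inv_into_f_f)

lemma group_int_copy: "group int_copy"
proof (rule groupI)
  fix a assume "a \<in> carrier int_copy"
  then obtain x where "a = Base x" by (auto simp: carrier_int_copy)
  then show "\<exists>y\<in>carrier int_copy. y \<otimes>\<^bsub>int_copy\<^esub> a = \<one>\<^bsub>int_copy\<^esub>"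
    by (intro bexI[of _ "Base (- x)"]) (auto simp: carrier_int_copy int_copy_one int_copy_mult)
qed (auto simp: carrier_int_copy int_copy_one int_copy_mult)

lemma int_copy_inv: "inv\<^bsub>int_copy\<^esub> Base x = Base (- x)"
  by (rule group.inv_equality[OF group_int_copy])
    (auto simp: carrier_int_copy int_copy_one int_copy_mult)

lemma iter_wreath_1: "iter_wreath (Suc 0) = int_copy"
  by (simp add: int_copy_def)

lemma iter_wreath_Suc: "k \<ge> 1 \<Longrightarrow> iter_wreath (Suc k) = wr (iter_wreath k)"
  by (simp add: wr_def)

declare iter_wreath.simps(2) [simp del]

lemma iter_group_iter_wreath: "k \<ge> 1 \<Longrightarrow> iter_group (iter_wreath k)"
proof (induction k rule: dec_induct)
  case base
  then show ?case
    by (simp add: iter_wreath_1 iter_group_def group_int_copy)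
next
  case (step n)
  then show ?case
    using iter_group.iter_group_wr[of "iter_wreath n"] by (simp add: iter_wreath_Suc)
qed

section \<open>Averages over lists and random walks\<close>

text \<open>A list stands for the uniform probability measure on its entries, counted with multiplicity.\<close>

definition avg :: "'a list \<Rightarrow> ('a \<Rightarrow> real) \<Rightarrow> real"
  where "avg T \<phi> = (\<Sum>a\<leftarrow>T. \<phi> a) / real (length T)"

lemma avg_const [simp]: "T \<noteq> [] \<Longrightarrow> avg T (\<lambda>_. c) = c"
  by (simp add: avg_def sum_list_triv)

lemma avg_cong: "(\<And>a. a \<in> set T \<Longrightarrow> \<phi> a = \<psi> a) \<Longrightarrow> avg T \<phi> = avg T \<psi>"
  by (simp add: avg_def cong: map_cong)

lemma avg_mono: "(\<And>a. a \<in> set T \<Longrightarrow> \<phi> a \<le> \<psi> a) \<Longrightarrow> avg T \<phi> \<le> avg T \<psi>"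
  unfolding avg_def by (intro divide_right_mono sum_list_mono) auto

lemma avg_le: "T \<noteq> [] \<Longrightarrow> (\<And>a. a \<in> set T \<Longrightarrow> \<phi> a \<le> c) \<Longrightarrow> avg T \<phi> \<le> c"
  using avg_mono[of T \<phi> "\<lambda>_. c"] by simp

lemma avg_add: "avg T (\<lambda>a. \<phi> a + \<psi> a) = avg T \<phi> + avg T \<psi>"
  by (simp add: avg_def sum_list_addf add_divide_distrib)

lemma avg_diff: "avg T (\<lambda>a. \<phi> a - \<psi> a) = avg T \<phi> - avg T \<psi>"
  by (simp add: avg_def sum_list_subtractf diff_divide_distrib)

lemma avg_cmult: "avg T (\<lambda>a. c * \<phi> a) = c * avg T \<phi>"
  by (simp add: avg_def sum_list_const_mult)

lemma avg_multc: "avg T (\<lambda>a. \<phi> a * c) = avg T \<phi> * c"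
  using avg_cmult[of T c \<phi>] by (simp add: mult.commute)

lemma avg_sum: "avg T (\<lambda>a. \<Sum>z\<in>A. \<phi> z a) = (\<Sum>z\<in>A. avg T (\<phi> z))"
  by (induction A rule: infinite_finite_induct) (simp_all add: avg_add, simp_all add: avg_def)

lemma avg_swap: "avg T (\<lambda>a. avg U (\<lambda>b. \<phi> a b)) = avg U (\<lambda>b. avg T (\<lambda>a. \<phi> a b))"
proof -
  have "(\<Sum>a\<leftarrow>T. \<Sum>b\<leftarrow>U. \<phi> a b) = (\<Sum>b\<leftarrow>U. \<Sum>a\<leftarrow>T. \<phi> a b)"
    by (induction T) (simp_all add: sum_list_addf)
  then show ?thesis
    unfolding avg_def divide_inverse by (simp add: sum_list_mult_const sum_list_const_mult mult_ac)
qed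

lemma avg_map: "avg (map h T) \<phi> = avg T (\<lambda>a. \<phi> (h a))"
  by (simp add: avg_def comp_def)

lemma avg_concat_map:
  assumes "\<And>a. a \<in> set T \<Longrightarrow> length (h a) = n"
  shows "avg (concat (map h T)) \<phi> = avg T (\<lambda>a. avg (h a) \<phi>)"
proof -
  have "(\<Sum>x\<leftarrow>concat (map h T). \<phi> x) = (\<Sum>a\<leftarrow>T. \<Sum>x\<leftarrow>h a. \<phi> x)"
    by (induction T) simp_all
  moreover have "length (concat (map h T)) = length T * n"
    using assms by (induction T) simp_all
  moreover have "avg T (\<lambda>a. avg (h a) \<phi>) = avg T (\<lambda>a. (\<Sum>x\<leftarrow>h a. \<phi> x) * (1 / n))"
    using assms by (intro avg_cong) (simp add: avg_def)
  ultimately show ?thesis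
    by (simp only: avg_multc) (simp add: avg_def)
qed

lemma avg_pm: "avg [1, - 1 :: int] \<phi> = (\<phi> 1 + \<phi> (- 1)) / 2"
  by (simp add: avg_def)

definition step :: "('a, 'm) monoid_scheme \<Rightarrow> 'a list \<Rightarrow> ('a \<Rightarrow> real) \<Rightarrow> 'a \<Rightarrow> real"
  where "step G T \<phi> x = avg T (\<lambda>a. \<phi> (x \<otimes>\<^bsub>G\<^esub> a))"

lemma step_pow_add:
  "(step G T ^^ n) (\<lambda>y. \<phi> y + \<psi> y) = (\<lambda>x. (step G T ^^ n) \<phi> x + (step G T ^^ n) \<psi> x)"
  by (induction n) (simp_all add: step_def avg_add)

lemma step_pow_cmult: "(step G T ^^ n) (\<lambda>y. c * \<phi> y) = (\<lambda>x. c * (step G T ^^ n) \<phi> x)"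
  by (induction n) (simp_all add: step_def avg_cmult)

lemma step_pow_const: "T \<noteq> [] \<Longrightarrow> (step G T ^^ n) (\<lambda>y. c) = (\<lambda>x. c)"
  by (induction n) (simp_all add: step_def fun_eq_iff)

lemma step_pow_sum:
  "(step G T ^^ n) (\<lambda>y. \<Sum>z\<in>A. \<phi> z y) = (\<lambda>x. \<Sum>z\<in>A. (step G T ^^ n) (\<phi> z) x)"
  by (induction n) (simp_all add: step_def avg_sum)

definition symmetric_steps :: "('a, 'm) monoid_scheme \<Rightarrow> 'a list \<Rightarrow> bool"
  where "symmetric_steps G T \<longleftrightarrow> T \<noteq> [] \<and> set T \<subseteq> carrier G \<and>
    (\<forall>\<phi> :: 'a \<Rightarrow> real. avg T (\<lambda>a. \<phi> (inv\<^bsub>G\<^esub> a)) = avg T \<phi>)"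

lemma step_pow_mono:
  assumes "monoid G" "set T \<subseteq> carrier G"
    and "\<And>y. y \<in> carrier G \<Longrightarrow> \<phi> y \<le> \<psi> y" "x \<in> carrier G"
  shows "(step G T ^^ n) \<phi> x \<le> (step G T ^^ n) \<psi> x"
  using assms(4)
proof (induction n arbitrary: x)
  case 0
  then show ?case using assms(3) by simp
next
  case (Suc n)
  then show ?case
    using assms(2) monoid.m_closed[OF assms(1)]
    by (auto simp: step_def intro!: avg_mono)
qed

lemma step_pow_cong:
  assumes "monoid G" "set T \<subseteq> carrier G"
    and "\<And>y. y \<in> carrier G \<Longrightarrow> \<phi> y = \<psi> y" "x \<in> carrier G"
  shows "(step G T ^^ n) \<phi> x = (step G T ^^ n) \<psi> x"
  by (intro antisym step_pow_mono) (use assms in auto)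

lemma step_pow_translate:
  assumes "monoid G" "set T \<subseteq> carrier G" "g \<in> carrier G" "x \<in> carrier G"
  shows "(step G T ^^ n) (\<lambda>y. \<phi> (g \<otimes>\<^bsub>G\<^esub> y)) x = (step G T ^^ n) \<phi> (g \<otimes>\<^bsub>G\<^esub> x)"
  using assms(4)
proof (induction n arbitrary: x)
  case (Suc n)
  then show ?case
    using assms monoid.m_closed[OF assms(1)]
    by (auto simp: step_def monoid.m_assoc intro!: avg_cong)
qed simp


section \<open>The switch-walk-switch walk\<close>

text \<open>A step switches the lamp at the current position, moves by \<open>\<plusminus> 1\<close> and switches the lamp at the new
  position, where switching means a step of the given walk on \<open>G\<close>. Read backwards, a step has the
  same form, so that symmetry is inherited.\<close>

definition walk_steps :: "iter_elem monoid \<Rightarrow> iter_elem list \<Rightarrow> iter_elem list"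
  where "walk_steps G T =
    concat (map (\<lambda>e. concat (map (\<lambda>a. map (\<lambda>b.
      (lamp G a \<otimes>\<^bsub>wr G\<^esub> shift G e) \<otimes>\<^bsub>wr G\<^esub> lamp G b) T) T)) [1, - 1])"

primrec paths :: "nat \<Rightarrow> int list list"
  where
    "paths 0 = [[]]"
  | "paths (Suc t) = concat (map (\<lambda>e. map ((#) e) (paths t)) [1, - 1])"

text \<open>A lamp is switched at both ends of a move. Hence \<open>switches s x z\<close>, for a path that starts at \<open>x\<close> and
  has the increments \<open>s\<close>, is twice the local time at \<open>z\<close>, up to the contribution of the end points.\<close>

primrec switches :: "int list \<Rightarrow> int \<Rightarrow> int \<Rightarrow> nat"
  where
    "switches [] x z = 0"
  | "switches (e # s) x z = of_bool (z = x) + of_bool (z = x + e) + switches s (x + e) z"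

primrec lamps :: "iter_elem \<Rightarrow> int \<Rightarrow> iter_elem"
  where
    "lamps (Base n) = (\<lambda>_. Base 0)"
  | "lamps (Wr f x) = f"

lemma avg_walk_steps:
  "avg (walk_steps G T) \<phi> = avg [1, - 1] (\<lambda>e. avg T (\<lambda>a. avg T (\<lambda>b.
     \<phi> ((lamp G a \<otimes>\<^bsub>wr G\<^esub> shift G e) \<otimes>\<^bsub>wr G\<^esub> lamp G b))))"
proof -
  have l: "length (concat (map (\<lambda>a. map (\<lambda>b. h a b) T) T)) = length T * length T" for h :: "_ \<Rightarrow> _ \<Rightarrow> iter_elem"
    by (simp add: length_concat comp_def sum_list_triv)
  show ?thesis
    unfolding walk_steps_def
    by (subst avg_concat_map[OF l], subst avg_concat_map[where n = "length T"]) (simp_all add: avg_map)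
qed

lemma avg_paths_Suc:
  "avg (paths (Suc t)) \<phi> = (avg (paths t) (\<lambda>s. \<phi> (1 # s)) + avg (paths t) (\<lambda>s. \<phi> (- 1 # s))) / 2"
  unfolding paths.simps by (subst avg_concat_map[where n = "length (paths t)"]) (simp_all add: avg_map avg_pm)

lemma paths_nonempty [simp]: "paths t \<noteq> []"
  by (induction t) auto

lemma in_paths: "s \<in> set (paths t) \<Longrightarrow> length s = t \<and> set s \<subseteq> {1, - 1}"
  by (induction t arbitrary: s) fastforce+

declare paths.simps(2) [simp del]

context iter_group
begin

lemma symmetric_walk_steps:
  assumes "symmetric_steps G T"
  shows "symmetric_steps (wr G) (walk_steps G T)"
proof -
  have T: "T \<noteq> []" "\<And>a. a \<in> set T \<Longrightarrow> a \<in> carrier G"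
    and sym: "avg T (\<lambda>a. \<phi> (inv a)) = avg T \<phi>" for \<phi> :: "iter_elem \<Rightarrow> real"
    using assms by (auto simp: symmetric_steps_def)
  have "avg (walk_steps G T) (\<lambda>a. \<phi> (inv\<^bsub>wr G\<^esub> a)) = avg (walk_steps G T) \<phi>" for \<phi> :: "iter_elem \<Rightarrow> real"
  proof -
    let ?h = "\<lambda>e a b. \<phi> ((lamp G a \<otimes>\<^bsub>wr G\<^esub> shift G e) \<otimes>\<^bsub>wr G\<^esub> lamp G b)"
    have "avg (walk_steps G T) (\<lambda>a. \<phi> (inv\<^bsub>wr G\<^esub> a))
      = avg [1, - 1] (\<lambda>e. avg T (\<lambda>a. avg T (\<lambda>b. ?h (- e) (inv b) (inv a))))"
      unfolding avg_walk_steps using T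
      by (intro avg_cong)
        (auto simp: W.inv_mult_group inv_lamp inv_shift W.m_assoc)
    also have "\<dots> = avg [1, - 1] (\<lambda>e. avg T (\<lambda>a. avg T (\<lambda>b. ?h (- e) b (inv a))))"
      by (intro avg_cong sym)
    also have "\<dots> = avg [1, - 1] (\<lambda>e. avg T (\<lambda>a. avg T (\<lambda>b. ?h (- e) b a)))"
      by (intro avg_cong sym)
    also have "\<dots> = avg [1, - 1] (\<lambda>e. avg T (\<lambda>b. avg T (\<lambda>a. ?h (- e) b a)))"
      by (intro avg_cong avg_swap)
    also have "\<dots> = avg (walk_steps G T) \<phi>"
      unfolding avg_walk_steps avg_pm by simp
    finally show ?thesis .
  qed
  then show ?thesis
    using T by (auto simp: symmetric_steps_def walk_steps_def)
qed

lemma step_walk_steps: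
  assumes "set T \<subseteq> carrier G" "Wr f x \<in> carrier (wr G)"
  shows "step (wr G) (walk_steps G T) \<Phi> (Wr f x) =
    avg [1, - 1] (\<lambda>e. avg T (\<lambda>a. avg T (\<lambda>b.
      \<Phi> (Wr ((f(x := f x \<otimes> a))(x + e := (f(x := f x \<otimes> a)) (x + e) \<otimes> b)) (x + e)))))"
proof -
  have "\<Phi> (Wr f x \<otimes>\<^bsub>wr G\<^esub> ((lamp G a \<otimes>\<^bsub>wr G\<^esub> shift G e) \<otimes>\<^bsub>wr G\<^esub> lamp G b)) =
    \<Phi> (Wr ((f(x := f x \<otimes> a))(x + e := (f(x := f x \<otimes> a)) (x + e) \<otimes> b)) (x + e))"
    if "a \<in> set T" "b \<in> set T" for a b e
  proof -
    have ab: "a \<in> carrier G" "b \<in> carrier G" using that assms by auto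
    have 1: "Wr (f(x := f x \<otimes> a)) y \<in> carrier (wr G)" for y
      using W.m_closed[OF assms(2) lamp_closed[OF ab(1)]] by (simp add: mult_lamp[OF assms(2) ab(1)])
    have "Wr f x \<otimes>\<^bsub>wr G\<^esub> ((lamp G a \<otimes>\<^bsub>wr G\<^esub> shift G e) \<otimes>\<^bsub>wr G\<^esub> lamp G b) =
      ((Wr f x \<otimes>\<^bsub>wr G\<^esub> lamp G a) \<otimes>\<^bsub>wr G\<^esub> shift G e) \<otimes>\<^bsub>wr G\<^esub> lamp G b"
      using ab assms(2) by (simp add: W.m_assoc del: Wr_in_wr)
    also have "\<dots> = Wr ((f(x := f x \<otimes> a))(x + e := (f(x := f x \<otimes> a)) (x + e) \<otimes> b)) (x + e)"
      using 1 ab by (simp add: mult_lamp[OF assms(2)] mult_shift mult_lamp del: Wr_in_wr)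
    finally show ?thesis by simp
  qed
  then show ?thesis
    unfolding step_def avg_walk_steps by (intro avg_cong) simp
qed

lemma avg_one_lamp:
  assumes "finite A" "T \<noteq> []"
  shows "avg T (\<lambda>a. \<Prod>z\<in>A. \<psi> z ((f(y := f y \<otimes> a)) z)) =
    (\<Prod>z\<in>A. (step G T ^^ of_bool (z = y)) (\<psi> z) (f z))"
proof (cases "y \<in> A")
  case True
  have "avg T (\<lambda>a. \<Prod>z\<in>A. \<psi> z ((f(y := f y \<otimes> a)) z)) =
    avg T (\<lambda>a. \<psi> y (f y \<otimes> a) * (\<Prod>z\<in>A - {y}. \<psi> z (f z)))"
    by (intro avg_cong) (simp add: prod.remove[OF assms(1) True])
  also have "\<dots> = step G T (\<psi> y) (f y) * (\<Prod>z\<in>A - {y}. \<psi> z (f z))"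
    by (simp add: avg_multc step_def)
  also have "\<dots> = (\<Prod>z\<in>A. (step G T ^^ of_bool (z = y)) (\<psi> z) (f z))"
    by (simp add: prod.remove[OF assms(1) True])
  finally show ?thesis .
next
  case False
  have "avg T (\<lambda>a. \<Prod>z\<in>A. \<psi> z ((f(y := f y \<otimes> a)) z)) = avg T (\<lambda>a. \<Prod>z\<in>A. \<psi> z (f z))"
    using False by (intro avg_cong prod.cong) auto
  also have "\<dots> = (\<Prod>z\<in>A. (step G T ^^ of_bool (z = y)) (\<psi> z) (f z))"
    using False assms(2) by (auto intro!: prod.cong)
  finally show ?thesis .
qed

text \<open>Conditionally on the base path, the lamps are independent, and the lamp at \<open>z\<close> performs
  a walk in \<open>G\<close> that has taken \<open>switches s x z\<close> steps.\<close>

lemma walk_lamps_product: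
  assumes "set T \<subseteq> carrier G" "T \<noteq> []" "finite A" "Wr f x \<in> carrier (wr G)"
  shows "(step (wr G) (walk_steps G T) ^^ t) (\<lambda>w. \<Prod>z\<in>A. \<phi> z (lamps w z)) (Wr f x) =
    avg (paths t) (\<lambda>s. \<Prod>z\<in>A. (step G T ^^ switches s x z) (\<phi> z) (f z))"
  using assms(4)
proof (induction t arbitrary: f x)
  case 0
  then show ?case by (simp add: avg_def)
next
  case (Suc t)
  let ?F = "(step (wr G) (walk_steps G T) ^^ t) (\<lambda>w. \<Prod>z\<in>A. \<phi> z (lamps w z))"
  let ?f1 = "\<lambda>a. f(x := f x \<otimes> a)"
  let ?f2 = "\<lambda>e a b. (?f1 a)(x + e := (?f1 a) (x + e) \<otimes> b)"
  let ?q = "\<lambda>n. step G T ^^ n"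
  have cl: "Wr (g(u := g u \<otimes> c)) y \<in> carrier (wr G)"
    if "Wr g v \<in> carrier (wr G)" "c \<in> set T" for g u v c y
  proof -
    have g: "Wr g u \<in> carrier (wr G)" and c: "c \<in> carrier G"
      using that assms(1) by auto
    have "Wr (g(u := g u \<otimes> c)) u \<in> carrier (wr G)"
      using W.m_closed[OF g lamp_closed[OF c]] by (simp only: mult_lamp[OF g c])
    then show ?thesis by simp
  qed
  have "(step (wr G) (walk_steps G T) ^^ Suc t) (\<lambda>w. \<Prod>z\<in>A. \<phi> z (lamps w z)) (Wr f x)
    = avg [1, - 1] (\<lambda>e. avg T (\<lambda>a. avg T (\<lambda>b. ?F (Wr (?f2 e a b) (x + e)))))"
    using step_walk_steps[OF assms(1) Suc.prems] by simp
  also have "\<dots> = avg [1, - 1] (\<lambda>e. avg T (\<lambda>a. avg T (\<lambda>b.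
      avg (paths t) (\<lambda>s. \<Prod>z\<in>A. ?q (switches s (x + e) z) (\<phi> z) (?f2 e a b z)))))"
    by (intro avg_cong Suc.IH cl[OF cl[OF Suc.prems]])
  also have "\<dots> = avg [1, - 1] (\<lambda>e. avg (paths t) (\<lambda>s. avg T (\<lambda>a. avg T (\<lambda>b.
      \<Prod>z\<in>A. ?q (switches s (x + e) z) (\<phi> z) (?f2 e a b z)))))"
    by (simp only: avg_swap[where U = "paths t"])
  also have "\<dots> = avg [1, - 1] (\<lambda>e. avg (paths t) (\<lambda>s. \<Prod>z\<in>A. ?q (switches (e # s) x z) (\<phi> z) (f z)))"
  proof (intro avg_cong)
    fix e s assume "e \<in> set [1, - 1 :: int]"
    have "avg T (\<lambda>a. avg T (\<lambda>b. \<Prod>z\<in>A. ?q (switches s (x + e) z) (\<phi> z) (?f2 e a b z)))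
      = avg T (\<lambda>a. \<Prod>z\<in>A. ?q (of_bool (z = x + e)) (?q (switches s (x + e) z) (\<phi> z)) (?f1 a z))"
      by (intro avg_cong avg_one_lamp assms)
    also have "\<dots> = (\<Prod>z\<in>A. ?q (of_bool (z = x)) (?q (of_bool (z = x + e))
        (?q (switches s (x + e) z) (\<phi> z))) (f z))"
      by (intro avg_one_lamp assms)
    also have "\<dots> = (\<Prod>z\<in>A. ?q (switches (e # s) x z) (\<phi> z) (f z))"
      by (simp add: funpow_add)
    finally show "avg T (\<lambda>a. avg T (\<lambda>b. \<Prod>z\<in>A. ?q (switches s (x + e) z) (\<phi> z) (?f2 e a b z)))
      = (\<Prod>z\<in>A. ?q (switches (e # s) x z) (\<phi> z) (f z))" .
  qed
  also have "\<dots> = avg (paths (Suc t)) (\<lambda>s. \<Prod>z\<in>A. ?q (switches s x z) (\<phi> z) (f z))"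
    by (simp only: avg_paths_Suc avg_pm)
  finally show ?case .
qed

lemma walk_one_lamp:
  assumes "set T \<subseteq> carrier G" "T \<noteq> []" "Wr f x \<in> carrier (wr G)"
  shows "(step (wr G) (walk_steps G T) ^^ t) (\<lambda>w. \<phi> (lamps w z)) (Wr f x) =
    avg (paths t) (\<lambda>s. (step G T ^^ switches s x z) \<phi> (f z))"
  using walk_lamps_product[of T "{z}" f x t "\<lambda>_. \<phi>"] assms by simp

end

section \<open>Local times of the simple random walk on the integers\<close>

primrec visits :: "int list \<Rightarrow> int \<Rightarrow> int \<Rightarrow> nat"
  where
    "visits [] x z = of_bool (z = x)"
  | "visits (e # s) x z = of_bool (z = x) + visits s (x + e) z"

lemma switches_le_visits: "switches s x z \<le> 2 * visits s x z"
proof -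
  have "switches s x z + of_bool (z = x) \<le> 2 * visits s x z"
  proof (induction s arbitrary: x)
    case (Cons e s)
    show ?case using Cons[of "x + e"] by (auto split: if_splits)
  qed auto
  then show ?thesis by simp
qed

lemma sum_switches:
  assumes "finite A" "{x - int (length s)..x + int (length s)} \<subseteq> A" "set s \<subseteq> {1, - 1}"
  shows "(\<Sum>z\<in>A. switches s x z) = 2 * length s"
  using assms(2,3)
proof (induction s arbitrary: x)
  case (Cons e s)
  have e: "e = 1 \<or> e = - 1" using Cons.prems by auto
  then have "{x + e - int (length s)..x + e + int (length s)} \<subseteq> {x - int (length (e # s))..x + int (length (e # s))}"
    by auto
  then have IH: "(\<Sum>z\<in>A. switches s (x + e) z) = 2 * length s"
    using Cons by (intro Cons.IH) auto
  have "x \<in> A" "x + e \<in> A" using Cons.prems e by (auto simp: subset_iff)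
  then show ?case
    using IH assms(1) by (simp add: sum.distrib of_bool_def sum.delta)
qed simp

lemma cosh_le_exp_square: "cosh x \<le> exp (x\<^sup>2)" for x :: real
proof (rule sums_le)
  have "strict_mono (\<lambda>n::nat. 2 * n)" by (simp add: strict_mono_def)
  then have "(\<lambda>n. if even (2 * n) then x ^ (2 * n) /\<^sub>R fact (2 * n) else 0) sums cosh x \<longleftrightarrow>
    (\<lambda>n. if even n then x ^ n /\<^sub>R fact n else 0) sums cosh x"
    by (rule sums_mono_reindex) (auto elim!: evenE)
  then show "(\<lambda>n. x ^ (2 * n) /\<^sub>R fact (2 * n)) sums cosh x"
    using cosh_converges[of x] by simp
  show "(\<lambda>n. (x\<^sup>2) ^ n /\<^sub>R fact n) sums exp (x\<^sup>2)" by (rule exp_converges)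
  fix n :: nat
  have "(fact n :: real) \<le> fact (2 * n)" by (intro fact_mono) simp
  then show "x ^ (2 * n) /\<^sub>R fact (2 * n) \<le> (x\<^sup>2) ^ n /\<^sub>R fact n"
    by (simp add: power_mult[symmetric] mult_right_mono le_imp_inverse_le)
qed

text \<open>The function \<open>y \<mapsto> 1 + exp (- 2 b \<bar>y\<bar>)\<close> is an approximate eigenfunction of the simple random
  walk, with a cusp at 0 that just absorbs a factor \<open>exp b\<close> at each visit to 0: there,
  \<open>exp b * (1 + exp (- 2 b)) = 2 * cosh b\<close> is of the form \<open>2 + O(b\<^sup>2)\<close>.\<close>

lemma exp_visits:
  fixes b :: real
  assumes "b \<ge> 0"
  shows "avg (paths t) (\<lambda>s. exp (b * visits s x z)) \<le>
    exp b * exp (4 * b\<^sup>2 * t) * (1 + exp (- 2 * b * \<bar>x - z\<bar>))"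
proof (induction t arbitrary: x)
  case 0
  have "exp (b * of_bool (z = x)) \<le> exp b * 1" using assms by (auto simp: of_bool_def)
  also have "\<dots> \<le> exp b * (1 + exp (- 2 * b * \<bar>x - z\<bar>))" by (intro mult_left_mono) auto
  finally show ?case by (simp add: avg_def)
next
  case (Suc t)
  define h where "h = (\<lambda>y. 1 + exp (- 2 * b * real_of_int \<bar>y\<bar>))"
  have h: "exp (b * of_bool (y = 0)) * ((h (y + 1) + h (y - 1)) / 2) \<le> exp (4 * b\<^sup>2) * h y" for y
  proof (cases "y = 0")
    case True
    have "exp b * h 1 = 2 * cosh b"
      by (simp add: h_def cosh_field_def distrib_left flip: exp_add)
    also have "\<dots> \<le> 2 * exp (b\<^sup>2)" using cosh_le_exp_square[of b] by simp
    also have "\<dots> \<le> 2 * exp (4 * b\<^sup>2)" by simp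
    finally show ?thesis using True by (simp add: h_def distrib_left)
  next
    case False
    have *: "exp (- 2 * b * real_of_int \<bar>y + 1\<bar>) + exp (- 2 * b * real_of_int \<bar>y - 1\<bar>)
      = 2 * cosh (2 * b) * exp (- 2 * b * real_of_int \<bar>y\<bar>)"
    proof (cases "y > 0")
      case True
      then have "\<bar>y + 1\<bar> = y + 1" "\<bar>y - 1\<bar> = y - 1" "\<bar>y\<bar> = y" by auto
      then show ?thesis by (simp add: cosh_field_def field_simps flip: exp_add)
    next
      case neg: False
      with False have "\<bar>y + 1\<bar> = - y - 1" "\<bar>y - 1\<bar> = - y + 1" "\<bar>y\<bar> = - y" by auto
      then show ?thesis by (simp add: cosh_field_def field_simps flip: exp_add)
    qed
    have 1: "1 \<le> cosh (2 * b)" by (rule cosh_real_ge_1)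
    have "(h (y + 1) + h (y - 1)) / 2 = 1 + cosh (2 * b) * exp (- 2 * b * real_of_int \<bar>y\<bar>)"
      using * by (simp add: h_def)
    also have "\<dots> \<le> cosh (2 * b) * h y" using 1 by (simp add: h_def distrib_left)
    also have "\<dots> \<le> exp ((2 * b)\<^sup>2) * h y"
      by (intro mult_right_mono cosh_le_exp_square) (simp add: h_def add_nonneg_nonneg)
    finally show ?thesis using False by (simp add: power2_eq_square)
  qed
  define E where "E = exp b * exp (4 * b\<^sup>2 * t)"
  have IH: "avg (paths t) (\<lambda>s. exp (b * visits s y z)) \<le> E * h (y - z)" for y
    using Suc[of y] by (simp add: h_def E_def)
  have "avg (paths (Suc t)) (\<lambda>s. exp (b * visits s x z)) = exp (b * of_bool (z = x)) *
     ((avg (paths t) (\<lambda>s. exp (b * visits s (x + 1) z)) + avg (paths t) (\<lambda>s. exp (b * visits s (x - 1) z))) / 2)"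
    by (simp add: avg_paths_Suc distrib_left exp_add avg_cmult)
  also have "\<dots> \<le> exp (b * of_bool (z = x)) * ((E * h (x + 1 - z) + E * h (x - 1 - z)) / 2)"
    using IH[of "x + 1"] IH[of "x - 1"] by (intro mult_left_mono divide_right_mono add_mono) auto
  also have "\<dots> = E * (exp (b * of_bool (x - z = 0)) * ((h (x - z + 1) + h (x - z - 1)) / 2))"
    by (simp add: algebra_simps eq_commute[of z x] add_divide_distrib)
  also have "\<dots> \<le> E * (exp (4 * b\<^sup>2) * h (x - z))"
    by (intro mult_left_mono h) (simp add: E_def)
  also have "\<dots> = exp b * exp (4 * b\<^sup>2 * Suc t) * (1 + exp (- 2 * b * \<bar>x - z\<bar>))"
    by (simp add: E_def h_def distrib_left exp_add)
  finally show ?case .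
qed

lemma exp_visits_le:
  fixes b :: real
  assumes "b \<ge> 0"
  shows "avg (paths t) (\<lambda>s. exp (b * visits s x z)) \<le> 2 * exp b * exp (4 * b\<^sup>2 * t)"
proof -
  have "exp (- 2 * b * \<bar>x - z\<bar>) \<le> 1" using assms by simp
  then have "exp b * exp (4 * b\<^sup>2 * t) * (1 + exp (- 2 * b * \<bar>x - z\<bar>)) \<le> exp b * exp (4 * b\<^sup>2 * t) * 2"
    by (intro mult_left_mono) auto
  with exp_visits[OF assms, of t x z] show ?thesis by linarith
qed

lemma exp_switches_le:
  fixes b :: real
  assumes "b \<ge> 0"
  shows "avg (paths t) (\<lambda>s. exp (b * switches s x z)) \<le> 2 * exp (2 * b) * exp (16 * b\<^sup>2 * t)"
proof -
  have "avg (paths t) (\<lambda>s. exp (b * switches s x z)) \<le> avg (paths t) (\<lambda>s. exp ((2 * b) * visits s x z))"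
  proof (intro avg_mono)
    fix s
    have "real (switches s x z) \<le> 2 * real (visits s x z)"
      using switches_le_visits[of s x z] by linarith
    then show "exp (b * switches s x z) \<le> exp ((2 * b) * visits s x z)"
      using mult_left_mono[OF _ assms, of "real (switches s x z)" "2 * real (visits s x z)"] by simp
  qed
  also have "\<dots> \<le> 2 * exp (2 * b) * exp (4 * (2 * b)\<^sup>2 * t)"
    using assms by (intro exp_visits_le) simp
  finally show ?thesis by (simp add: power2_eq_square mult_ac)
qed

lemma mean_visits: "avg (paths t) (\<lambda>s. visits s x z) \<le> 2 * exp 5 * sqrt (t + 1)"
proof -
  define b where "b = 1 / sqrt (t + 1)"
  have b: "0 < b" "b \<le> 1" "b\<^sup>2 * t \<le> 1" by (auto simp: b_def power_divide)
  have "b * avg (paths t) (\<lambda>s. visits s x z) = avg (paths t) (\<lambda>s. b * visits s x z)"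
    by (simp add: avg_cmult)
  also have "\<dots> \<le> avg (paths t) (\<lambda>s. exp (b * visits s x z))"
    using exp_ge_add_one_self by (intro avg_mono) (smt (verit))
  also have "\<dots> \<le> 2 * exp b * exp (4 * b\<^sup>2 * t)" using b by (intro exp_visits_le) simp
  also have "\<dots> = 2 * exp (b + 4 * (b\<^sup>2 * t))" by (simp add: exp_add mult_ac)
  also have "\<dots> \<le> 2 * exp 5" using b by simp
  finally show ?thesis using b by (simp add: b_def field_simps)
qed

text \<open>The sum counts the pairs of times at which the walk is at the same site. From each of the \<open>t + 1\<close>
  times on, the expected number of returns is \<open>O(sqrt t)\<close>.\<close>

lemma mean_sum_visits_square:
  assumes "finite A"
  shows "avg (paths t) (\<lambda>s. \<Sum>z\<in>A. (real (visits s x z))\<^sup>2) \<le> (t + 1) * (1 + 4 * exp 5 * sqrt (t + 1))"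
proof (induction t arbitrary: x)
  case 0
  have "(\<Sum>z\<in>A. (real (of_bool (z = x)))\<^sup>2) \<le> 1"
  proof -
    have "(\<Sum>z\<in>A. (real (of_bool (z = x)))\<^sup>2) = (\<Sum>z\<in>A. if z = x then 1 else 0)"
      by (intro sum.cong) auto
    then show ?thesis using assms by (simp add: sum.delta)
  qed
  moreover have "(0::real) \<le> 4 * exp 5" by simp
  ultimately have "(\<Sum>z\<in>A. (real (of_bool (z = x)))\<^sup>2) \<le> 1 + 4 * exp 5" by linarith
  then show ?case by (simp add: avg_def)
next
  case (Suc t)
  define B where "B = (t + 1) * (1 + 4 * exp 5 * sqrt (t + 1))"
  have e: "avg (paths t) (\<lambda>s. \<Sum>z\<in>A. (real (visits (e # s) x z))\<^sup>2) \<le> B + (1 + 4 * exp 5 * sqrt (t + 1))" for e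
  proof -
    have "(\<Sum>z\<in>A. (real (visits (e # s) x z))\<^sup>2) \<le>
      (\<Sum>z\<in>A. (real (visits s (x + e) z))\<^sup>2) + (1 + 2 * visits s (x + e) x)" for s
    proof -
      have "(\<Sum>z\<in>A. (real (visits (e # s) x z))\<^sup>2) =
        (\<Sum>z\<in>A. (real (visits s (x + e) z))\<^sup>2) + (\<Sum>z\<in>A. if z = x then 1 + 2 * visits s (x + e) x else 0)"
        unfolding of_nat_sum sum.distrib[symmetric] by (intro sum.cong) (auto simp: power2_eq_square algebra_simps)
      also have "(\<Sum>z\<in>A. if z = x then 1 + 2 * visits s (x + e) x else 0) \<le> 1 + 2 * visits s (x + e) x"
        using assms by (simp add: sum.delta)
      finally show ?thesis by simp
    qed
    then have "avg (paths t) (\<lambda>s. \<Sum>z\<in>A. (real (visits (e # s) x z))\<^sup>2) \<le>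
      avg (paths t) (\<lambda>s. (\<Sum>z\<in>A. (real (visits s (x + e) z))\<^sup>2) + (1 + 2 * visits s (x + e) x))"
      by (intro avg_mono) simp
    also have "\<dots> = avg (paths t) (\<lambda>s. \<Sum>z\<in>A. (real (visits s (x + e) z))\<^sup>2) +
      (1 + 2 * avg (paths t) (\<lambda>s. visits s (x + e) x))"
      by (simp add: avg_add avg_cmult)
    also have "\<dots> \<le> B + (1 + 2 * (2 * exp 5 * sqrt (t + 1)))"
    proof -
      have "avg (paths t) (\<lambda>s. \<Sum>z\<in>A. (real (visits s (x + e) z))\<^sup>2) \<le> B"
        using Suc[of "x + e"] by (simp add: B_def add.commute)
      then show ?thesis using mean_visits[of t "x + e" x] by linarith
    qed
    finally show ?thesis by simp
  qed
  have "avg (paths (Suc t)) (\<lambda>s. \<Sum>z\<in>A. (real (visits s x z))\<^sup>2) \<le> B + (1 + 4 * exp 5 * sqrt (t + 1))"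
    using e[of 1] e[of "- 1"] by (simp add: avg_paths_Suc del: visits.simps)
  also have "\<dots> = (t + 2) * (1 + 4 * exp 5 * sqrt (t + 1))" by (simp add: B_def algebra_simps)
  also have "\<dots> \<le> (t + 2) * (1 + 4 * exp 5 * sqrt (t + 2))"
    by (intro mult_left_mono add_left_mono) auto
  finally show ?case by (simp add: add.commute)
qed

section \<open>Speed of the walk\<close>

text \<open>The walk is measured by such functions rather than by word lengths. They are bounded by multiples of
  all word lengths, and pass to wreath products by summation over the lamps.\<close>

definition group_length :: "('a, 'm) monoid_scheme \<Rightarrow> ('a \<Rightarrow> real) \<Rightarrow> bool"
  where "group_length G N \<longleftrightarrow> N \<one>\<^bsub>G\<^esub> = 0 \<and> (\<forall>x\<in>carrier G. 0 \<le> N x) \<and>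
    (\<forall>x\<in>carrier G. \<forall>y\<in>carrier G. N (x \<otimes>\<^bsub>G\<^esub> y) \<le> N x + N y)"

definition lamp_sum :: "iter_elem monoid \<Rightarrow> (iter_elem \<Rightarrow> real) \<Rightarrow> iter_elem \<Rightarrow> real"
  where "lamp_sum G N w = (\<Sum>z | lamps w z \<noteq> \<one>\<^bsub>G\<^esub>. N (lamps w z))"

lemma (in iter_group) lamp_sum_eq:
  assumes "N \<one> = 0" "finite A" "{z. f z \<noteq> \<one>} \<subseteq> A"
  shows "lamp_sum G N (Wr f x) = (\<Sum>z\<in>A. N (f z))"
  unfolding lamp_sum_def using assms by (intro sum.mono_neutral_cong_left) auto

lemma (in iter_group) subadditive_lamp_sum:
  assumes "group_length G N"
  shows "group_length (wr G) (lamp_sum G N)"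
proof -
  have l0: "N \<one> = 0" and l: "\<And>x. x \<in> carrier G \<Longrightarrow> 0 \<le> N x"
    "\<And>x y. x \<in> carrier G \<Longrightarrow> y \<in> carrier G \<Longrightarrow> N (x \<otimes> y) \<le> N x + N y"
    using assms by (auto simp: group_length_def)
  have "lamp_sum G N (v \<otimes>\<^bsub>wr G\<^esub> w) \<le> lamp_sum G N v + lamp_sum G N w"
    if vw: "v \<in> carrier (wr G)" "w \<in> carrier (wr G)" for v w
  proof -
    from vw obtain f x g y where eq: "v = Wr f x" "w = Wr g y"
      and f: "\<And>z. f z \<in> carrier G" "finite {z. f z \<noteq> \<one>}"
      and g: "\<And>z. g z \<in> carrier G" "finite {z. g z \<noteq> \<one>}"
      by (elim wr_cases) blast
    define A where "A = {z. f z \<noteq> \<one>} \<union> {z. g (z - x) \<noteq> \<one>}"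
    have A: "finite A" using f(2) finite_int_translate(2)[OF g(2), of x] by (simp add: A_def)
    have "lamp_sum G N (v \<otimes>\<^bsub>wr G\<^esub> w) = (\<Sum>z\<in>A. N (f z \<otimes> g (z - x)))"
      using vw l0 A unfolding eq by (subst wr_mult) (auto intro!: lamp_sum_eq simp: A_def)
    also have "\<dots> \<le> (\<Sum>z\<in>A. N (f z)) + (\<Sum>z\<in>A. N (g (z - x)))"
      unfolding sum.distrib[symmetric] using f g l by (intro sum_mono) auto
    also have "(\<Sum>z\<in>A. N (f z)) = lamp_sum G N v"
      unfolding eq using l0 A by (intro lamp_sum_eq[symmetric]) (auto simp: A_def)
    also have "(\<Sum>z\<in>A. N (g (z - x))) = (\<Sum>z\<in>(\<lambda>z. z - x) ` A. N (g z))"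
      by (subst sum.reindex) (auto simp: inj_on_def)
    also have "\<dots> = lamp_sum G N w"
    proof -
      have "z \<in> (\<lambda>z. z - x) ` A" if "g z \<noteq> \<one>" for z
        using that by (intro image_eqI[of _ _ "z + x"]) (auto simp: A_def)
      then show ?thesis unfolding eq using l0 A by (intro lamp_sum_eq[symmetric]) auto
    qed
    finally show ?thesis .
  qed
  moreover have "0 \<le> lamp_sum G N w" if "w \<in> carrier (wr G)" for w
    using that l unfolding carrier_wr by (auto simp: lamp_sum_def intro!: sum_nonneg)
  moreover have "lamp_sum G N \<one>\<^bsub>wr G\<^esub> = 0"
    by (simp add: lamp_sum_def wr_one)
  ultimately show ?thesis unfolding group_length_def by blast
qed

definition has_speed :: "('a, 'm) monoid_scheme \<Rightarrow> 'a list \<Rightarrow> ('a \<Rightarrow> real) \<Rightarrow> real \<Rightarrow> bool"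
  where "has_speed G T N \<beta> \<longleftrightarrow>
    (\<exists>c>0. \<forall>n. c * real n powr \<beta> \<le> (step G T ^^ n) N \<one>\<^bsub>G\<^esub>)"

text \<open>A lower bound for a concave power by a parabola, which turns bounds on the first two moments of \<open>x\<close>
  into a lower bound on the mean of \<open>x powr \<beta>\<close>.\<close>

lemma powr_ge_parabola:
  fixes x M \<beta> :: real
  assumes "M > 0" "x \<ge> 0" "0 \<le> \<beta>" "\<beta> \<le> 1"
  shows "M powr \<beta> * (x / M - (x / M)\<^sup>2) \<le> x powr \<beta>"
proof (cases "x / M \<le> 1 \<and> x > 0")
  case True
  then have "x / M - (x / M)\<^sup>2 \<le> (x / M) powr 1" using assms by simp
  also have "\<dots> \<le> (x / M) powr \<beta>" using True assms by (intro powr_mono') auto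
  finally have "M powr \<beta> * (x / M - (x / M)\<^sup>2) \<le> M powr \<beta> * (x / M) powr \<beta>"
    by (intro mult_left_mono) auto
  also have "\<dots> = x powr \<beta>" using assms by (simp flip: powr_mult)
  finally show ?thesis .
next
  case False
  then have "x / M - (x / M)\<^sup>2 \<le> 0"
  proof (cases "x = 0")
    case False
    with \<open>\<not> (x / M \<le> 1 \<and> x > 0)\<close> assms have "1 \<le> x / M" by auto
    then have "x / M * 1 \<le> x / M * (x / M)" by (intro mult_left_mono) auto
    then show ?thesis by (simp add: power2_eq_square)
  qed simp
  then have "M powr \<beta> * (x / M - (x / M)\<^sup>2) \<le> 0" by (intro mult_nonneg_nonpos) auto
  also have "0 \<le> x powr \<beta>" by simp
  finally show ?thesis .
qed

text \<open>The walk visits about \<open>sqrt t\<close> sites about \<open>sqrt t\<close> times each, which gives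
  \<open>sqrt t * (sqrt t) powr \<beta>\<close>. Concavity of \<open>powr \<beta>\<close> reduces this to the fact that the local
  times are not concentrated, that is, to the bound on their second moment.\<close>

lemma (in iter_group) has_speed_walk:
  assumes "symmetric_steps G T" "group_length G N" "has_speed G T N \<beta>" "0 \<le> \<beta>" "\<beta> \<le> 1"
  shows "has_speed (wr G) (walk_steps G T) (lamp_sum G N) ((1 + \<beta>) / 2)"
proof -
  have T: "set T \<subseteq> carrier G" "T \<noteq> []" using assms(1) by (auto simp: symmetric_steps_def)
  have T': "set (walk_steps G T) \<subseteq> carrier (wr G)"
    using symmetric_walk_steps[OF assms(1)] by (simp add: symmetric_steps_def)
  have l0: "N \<one> = 0" and l: "\<And>x. x \<in> carrier G \<Longrightarrow> 0 \<le> N x"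
    using assms(2) by (auto simp: group_length_def)
  obtain c where c: "c > 0" "\<And>n. c * real n powr \<beta> \<le> (step G T ^^ n) N \<one>"
    using assms(3) by (auto simp: has_speed_def)
  define K where "K = 8 * (1 + 8 * exp (5::real))"
  have K: "K > 0" by (simp add: K_def add_pos_pos)
  have main: "c * K powr (\<beta> - 1) * real t powr ((1 + \<beta>) / 2) \<le>
    (step (wr G) (walk_steps G T) ^^ t) (lamp_sum G N) \<one>\<^bsub>wr G\<^esub>" if t: "t \<ge> 1" for t :: nat
  proof -
    define A where "A = {- int t..int t}"
    \<comment> \<open>With this threshold, the quadratic term of the parabola is at most half of the linear one.\<close>
    define M where "M = K * sqrt t"
    have M: "M > 0" using K t by (simp add: M_def)
    have 1: "Wr (\<lambda>_. \<one>) 0 \<in> carrier (wr G)" by simp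
    have sq: "avg (paths t) (\<lambda>s. \<Sum>z\<in>A. (real (switches s 0 z))\<^sup>2) \<le> K * (t * sqrt t)"
    proof -
      have "(real (switches s 0 z))\<^sup>2 \<le> 4 * (real (visits s 0 z))\<^sup>2" for s z
      proof -
        have "real (switches s 0 z) \<le> 2 * real (visits s 0 z)"
          using switches_le_visits[of s 0 z] by linarith
        from power_mono[OF this, of 2] show ?thesis by (simp add: power_mult_distrib)
      qed
      then have "avg (paths t) (\<lambda>s. \<Sum>z\<in>A. (real (switches s 0 z))\<^sup>2) \<le>
        avg (paths t) (\<lambda>s. 4 * (\<Sum>z\<in>A. (real (visits s 0 z))\<^sup>2))"
        unfolding sum_distrib_left by (intro avg_mono sum_mono)
      also have "\<dots> = 4 * avg (paths t) (\<lambda>s. \<Sum>z\<in>A. (real (visits s 0 z))\<^sup>2)" by (rule avg_cmult)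
      also have "\<dots> \<le> 4 * ((t + 1) * (1 + 4 * exp 5 * sqrt (t + 1)))"
        using mean_sum_visits_square[of A t 0] by (simp add: A_def add.commute)
      also have "\<dots> \<le> 4 * ((2 * t) * ((1 + 8 * exp 5) * sqrt t))"
      proof -
        have s1: "1 \<le> sqrt t" using t by simp
        have "sqrt (t + 1) \<le> sqrt (4 * t)" using t by (intro real_sqrt_le_mono) simp
        also have "\<dots> = 2 * sqrt t" by (simp add: real_sqrt_mult)
        finally have "4 * exp 5 * sqrt (t + 1) \<le> 8 * exp 5 * sqrt t" by simp
        then have "1 + 4 * exp 5 * sqrt (t + 1) \<le> (1 + 8 * exp 5) * sqrt t"
          using s1 unfolding distrib_right by linarith
        then show ?thesis using t by (intro mult_left_mono mult_mono) auto
      qed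
      also have "\<dots> = K * (t * sqrt t)" by (simp add: K_def)
      finally show ?thesis .
    qed
    have "c * K powr (\<beta> - 1) * real t powr ((1 + \<beta>) / 2) = c * (M powr \<beta> * (2 * t / M - K * (t * sqrt t) / M\<^sup>2))"
    proof -
      have "2 * t / M - K * (t * sqrt t) / M\<^sup>2 = sqrt t / K"
      proof -
        have "t / M = (t / sqrt t) / K" by (simp add: M_def)
        then have 1: "t / M = sqrt t / K" by (simp add: real_div_sqrt)
        have "K * (t * sqrt t) / M\<^sup>2 = sqrt t / K"
          using K t by (simp add: M_def power_mult_distrib) (simp add: power2_eq_square)
        with 1 show ?thesis by simp
      qed
      also have "\<dots> = K powr (- 1) * real t powr (1 / 2)"
        unfolding powr_neg_one[OF K] powr_half_sqrt[OF of_nat_0_le_iff] by simp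
      finally have "M powr \<beta> * (2 * t / M - K * (t * sqrt t) / M\<^sup>2) =
        K powr \<beta> * real t powr (1 / 2 * \<beta>) * (K powr (- 1) * real t powr (1 / 2))"
        using K unfolding M_def powr_half_sqrt[OF of_nat_0_le_iff, symmetric]
        by (simp add: powr_mult powr_powr)
      also have "\<dots> = K powr (\<beta> + - 1) * real t powr (1 / 2 * \<beta> + 1 / 2)"
        by (simp only: powr_add mult_ac)
      finally show ?thesis by (simp add: add_divide_distrib add.commute)
    qed
    also have "\<dots> \<le> c * (M powr \<beta> * (2 * t / M - avg (paths t) (\<lambda>s. \<Sum>z\<in>A. (real (switches s 0 z))\<^sup>2) / M\<^sup>2))"
      using sq c(1) by (intro mult_left_mono diff_left_mono divide_right_mono) auto
    also have "\<dots> = avg (paths t) (\<lambda>s. c * (M powr \<beta> * (2 * t / M - (\<Sum>z\<in>A. (real (switches s 0 z))\<^sup>2) / M\<^sup>2)))"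
      by (simp add: avg_cmult avg_diff avg_multc divide_inverse)
    also have "\<dots> = avg (paths t) (\<lambda>s. \<Sum>z\<in>A. c * (M powr \<beta> * (switches s 0 z / M - (switches s 0 z / M)\<^sup>2)))"
    proof (intro avg_cong)
      fix s assume "s \<in> set (paths t)"
      then have s: "length s = t" "set s \<subseteq> {1, - 1}" using in_paths by auto
      have "(\<Sum>z\<in>A. switches s 0 z) = 2 * t"
        using sum_switches[of A 0 s] s by (simp add: A_def)
      then have "2 * t = (\<Sum>z\<in>A. real (switches s 0 z))" by (metis of_nat_sum)
      then show "c * (M powr \<beta> * (2 * t / M - (\<Sum>z\<in>A. (real (switches s 0 z))\<^sup>2) / M\<^sup>2)) =
        (\<Sum>z\<in>A. c * (M powr \<beta> * (switches s 0 z / M - (switches s 0 z / M)\<^sup>2)))"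
        by (simp add: sum_subtractf sum_divide_distrib power_divide flip: sum_distrib_left)
    qed
    also have "\<dots> \<le> avg (paths t) (\<lambda>s. \<Sum>z\<in>A. (step G T ^^ switches s 0 z) N \<one>)"
    proof (intro avg_mono sum_mono)
      fix s z
      have "c * (M powr \<beta> * (switches s 0 z / M - (switches s 0 z / M)\<^sup>2)) \<le> c * real (switches s 0 z) powr \<beta>"
        using M c(1) assms by (intro mult_left_mono powr_ge_parabola) auto
      also have "\<dots> \<le> (step G T ^^ switches s 0 z) N \<one>" by (rule c(2))
      finally show "c * (M powr \<beta> * (switches s 0 z / M - (switches s 0 z / M)\<^sup>2)) \<le>
        (step G T ^^ switches s 0 z) N \<one>" .
    qed
    also have "\<dots> = (\<Sum>z\<in>A. (step (wr G) (walk_steps G T) ^^ t) (\<lambda>w. N (lamps w z)) (Wr (\<lambda>_. \<one>) 0))"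
      unfolding avg_sum using walk_one_lamp[OF T 1] by simp
    also have "\<dots> = (step (wr G) (walk_steps G T) ^^ t) (\<lambda>w. \<Sum>z\<in>A. N (lamps w z)) (Wr (\<lambda>_. \<one>) 0)"
      by (simp add: step_pow_sum)
    also have "\<dots> \<le> (step (wr G) (walk_steps G T) ^^ t) (lamp_sum G N) (Wr (\<lambda>_. \<one>) 0)"
    proof (rule step_pow_mono[OF W.is_monoid T' _ 1])
      fix w assume "w \<in> carrier (wr G)"
      then obtain f x where w: "w = Wr f x" "\<And>z. f z \<in> carrier G" "finite {z. f z \<noteq> \<one>}"
        by (elim wr_cases) blast
      have "(\<Sum>z\<in>A. N (f z)) \<le> (\<Sum>z\<in>A \<union> {z. f z \<noteq> \<one>}. N (f z))"
        using w l by (intro sum_mono2) (auto simp: A_def)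
      also have "\<dots> = lamp_sum G N w"
        unfolding w(1) using w(3) l0 by (intro lamp_sum_eq[symmetric]) (auto simp: A_def)
      finally show "(\<Sum>z\<in>A. N (lamps w z)) \<le> lamp_sum G N w" by (simp add: w(1))
    qed
    finally show ?thesis by (simp only: wr_one)
  qed
  have nn: "0 \<le> (step (wr G) (walk_steps G T) ^^ 0) (lamp_sum G N) \<one>\<^bsub>wr G\<^esub>"
    by (simp add: lamp_sum_def wr_one)
  show ?thesis unfolding has_speed_def
  proof (intro exI[of _ "c * K powr (\<beta> - 1)"] conjI allI)
    fix n show "c * K powr (\<beta> - 1) * real n powr ((1 + \<beta>) / 2) \<le>
      (step (wr G) (walk_steps G T) ^^ n) (lamp_sum G N) \<one>\<^bsub>wr G\<^esub>"
      using main[of n] nn by (cases "n = 0") auto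
  qed (use c K in simp)
qed


section \<open>Return probabilities\<close>

text \<open>Since \<open>0 powr \<gamma> = 0\<close>, the bound is 1 at \<open>n = 0\<close>, also for \<open>\<gamma> = 0\<close>, so that lamps that have
  never been touched contribute a factor 1. No constant is allowed in front of \<open>exp\<close>, because the
  bounds for all lamps are multiplied.\<close>

definition has_return_exponent :: "('a, 'm) monoid_scheme \<Rightarrow> 'a list \<Rightarrow> real \<Rightarrow> bool"
  where "has_return_exponent G T \<gamma> \<longleftrightarrow>
    (\<exists>c>0. \<forall>n. \<forall>x\<in>carrier G. \<forall>y\<in>carrier G.
      (step G T ^^ n) (\<lambda>w. of_bool (w = y)) x \<le> exp (- c * real n powr \<gamma>))"

text \<open>A walk returns only if all lamps return, so that the exponent \<open>\<Sum>z. (switches s x z) powr \<gamma>\<close>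
  has to be bounded below. By concavity, it is small only if some local time exceeds a threshold
  \<open>M\<close>, an event of probability about \<open>exp (- M\<^sup>2 / t)\<close>; otherwise, it is at least
  \<open>t * M powr (\<gamma> - 1)\<close>. The two terms balance at \<open>M = t powr (2 / (3 - \<gamma>))\<close>.\<close>

lemma (in iter_group) has_return_exponent_walk:
  assumes "symmetric_steps G T" "has_return_exponent G T \<gamma>" "0 \<le> \<gamma>" "\<gamma> < 1"
  shows "has_return_exponent (wr G) (walk_steps G T) ((1 + \<gamma>) / (3 - \<gamma>))"
proof -
  define g where "g = (1 + \<gamma>) / (3 - \<gamma>)"
  have g: "g > 0" using assms by (simp add: g_def)
  have T: "set T \<subseteq> carrier G" "T \<noteq> []" using assms(1) by (auto simp: symmetric_steps_def)
  have T': "set (walk_steps G T) \<subseteq> carrier (wr G)"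
    using symmetric_walk_steps[OF assms(1)] by (simp add: symmetric_steps_def)
  obtain c where c: "c > 0" "\<And>n x y. x \<in> carrier G \<Longrightarrow> y \<in> carrier G \<Longrightarrow>
      (step G T ^^ n) (\<lambda>w. of_bool (w = y)) x \<le> exp (- c * real n powr \<gamma>)"
    using assms(2) by (auto simp: has_return_exponent_def)
  define R where "R = (\<lambda>t p. avg (paths t) (\<lambda>s. exp (- c * (\<Sum>z\<in>{p - int t..p + int t}. real (switches s p z) powr \<gamma>))))"
  have upper: "(step (wr G) (walk_steps G T) ^^ t) (\<lambda>w. of_bool (w = Wr h q)) (Wr f p) \<le> R t p"
    if fp: "Wr f p \<in> carrier (wr G)" and hq: "Wr h q \<in> carrier (wr G)" for t f p h q
  proof -
    define A where "A = {p - int t..p + int t}"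
    have "(step (wr G) (walk_steps G T) ^^ t) (\<lambda>w. of_bool (w = Wr h q)) (Wr f p) \<le>
      (step (wr G) (walk_steps G T) ^^ t) (\<lambda>w. \<Prod>z\<in>A. of_bool (lamps w z = h z)) (Wr f p)"
      by (intro step_pow_mono[OF W.is_monoid T' _ fp]) (auto simp: prod_nonneg)
    also have "\<dots> = avg (paths t) (\<lambda>s. \<Prod>z\<in>A. (step G T ^^ switches s p z) (\<lambda>w. of_bool (w = h z)) (f z))"
      using walk_lamps_product[OF T _ fp, of A t "\<lambda>z w. of_bool (w = h z)"] by (simp add: A_def)
    also have "\<dots> \<le> avg (paths t) (\<lambda>s. \<Prod>z\<in>A. exp (- c * real (switches s p z) powr \<gamma>))"
    proof (intro avg_mono prod_mono conjI)
      fix s z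
      show "(step G T ^^ switches s p z) (\<lambda>w. of_bool (w = h z)) (f z) \<le> exp (- c * real (switches s p z) powr \<gamma>)"
        using fp hq by (intro c(2)) auto
      have "(step G T ^^ switches s p z) (\<lambda>w. 0) (f z) \<le> (step G T ^^ switches s p z) (\<lambda>w. of_bool (w = h z)) (f z)"
        using fp T by (intro step_pow_mono[OF is_monoid]) auto
      then show "0 \<le> (step G T ^^ switches s p z) (\<lambda>w. of_bool (w = h z)) (f z)"
        using T by (simp add: step_pow_const)
    qed
    also have "\<dots> = R t p" by (simp add: R_def A_def exp_sum sum_distrib_left)
    finally show ?thesis .
  qed
  have sumA: "(\<Sum>z\<in>{p - int t..p + int t}. real (switches s p z)) = 2 * t" if "s \<in> set (paths t)" for s t p
  proof -
    have "(\<Sum>z\<in>{p - int t..p + int t}. switches s p z) = 2 * t"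
      using sum_switches[of "{p - int t..p + int t}" p s] in_paths[OF that] by simp
    then show ?thesis by (metis of_nat_sum)
  qed
  have small: "R t p \<le> exp (- c)" if t: "t \<ge> 1" for t p
  proof -
    define A where "A = {p - int t..p + int t}"
    have "exp (- c * (\<Sum>z\<in>A. real (switches s p z) powr \<gamma>)) \<le> exp (- c)" if s: "s \<in> set (paths t)" for s
    proof -
      have "(\<Sum>z\<in>A. real (switches s p z)) > 0" using sumA[OF s, of p] t by (simp add: A_def)
      then obtain z where z: "z \<in> A" "switches s p z > 0"
        by (metis (mono_tags, lifting) gr0I of_nat_0 less_irrefl sum.neutral)
      have "1 \<le> real (switches s p z) powr \<gamma>" using z assms by (intro ge_one_powr_ge_zero) auto
      also have "\<dots> \<le> (\<Sum>z\<in>A. real (switches s p z) powr \<gamma>)"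
        using z by (intro member_le_sum) (auto simp: A_def)
      finally show ?thesis using c by simp
    qed
    then show ?thesis unfolding R_def A_def by (intro avg_le) auto
  qed
  define d where "d = min (2 * c) (1 / 64)"
  have d: "d > 0" using c by (simp add: d_def)
  have large: "R t p \<le> 19 * t * exp (- d * real t powr g)" if t: "t \<ge> 1" for t p
  proof -
    define A where "A = {p - int t..p + int t}"
    define M where "M = real t powr (2 / (3 - \<gamma>))"
    \<comment> \<open>This parameter minimises the exponent \<open>16 * b\<^sup>2 * t - b * M\<close> of the moment bound below.\<close>
    define b where "b = M / (32 * t)"
    have M: "M > 0" using t by (simp add: M_def)
    have "M \<le> real t powr 1" unfolding M_def using t assms by (intro powr_mono) (auto simp: field_simps)
    then have b: "0 \<le> b" "2 * b \<le> 1" using M t by (auto simp: b_def field_simps)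
    have tM: "t * M powr (\<gamma> - 1) = real t powr g"
    proof -
      have "t * M powr (\<gamma> - 1) = real t powr (1 + 2 / (3 - \<gamma>) * (\<gamma> - 1))"
        using t by (simp add: M_def powr_powr powr_add)
      also have "1 + 2 / (3 - \<gamma>) * (\<gamma> - 1) = g" using assms by (simp add: g_def field_simps)
      finally show ?thesis .
    qed
    have MM: "M\<^sup>2 / t = real t powr g"
    proof -
      have "M\<^sup>2 / t = real t powr (2 / (3 - \<gamma>) * 2 - 1)"
        using t M by (simp add: M_def powr_diff powr_powr flip: powr_numeral)
      also have "2 / (3 - \<gamma>) * 2 - 1 = g" using assms by (simp add: g_def field_simps)
      finally show ?thesis .
    qed
    have pointwise: "exp (- c * (\<Sum>z\<in>A. real (switches s p z) powr \<gamma>)) \<le>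
      exp (- (2 * c) * real t powr g) + (\<Sum>z\<in>A. exp (- b * M) * exp (b * switches s p z))"
      if s: "s \<in> set (paths t)" for s
    proof (cases "\<forall>z\<in>A. real (switches s p z) \<le> M")
      case True
      have "2 * real t powr g = (\<Sum>z\<in>A. real (switches s p z)) * M powr (\<gamma> - 1)"
        using sumA[OF s, of p] tM by (simp add: A_def)
      also have "\<dots> \<le> (\<Sum>z\<in>A. real (switches s p z) powr \<gamma>)"
        unfolding sum_distrib_right
      proof (intro sum_mono)
        fix z assume z: "z \<in> A"
        show "real (switches s p z) * M powr (\<gamma> - 1) \<le> real (switches s p z) powr \<gamma>"
        proof (cases "switches s p z = 0")
          case False
          have "real (switches s p z) * M powr (\<gamma> - 1) \<le> real (switches s p z) * real (switches s p z) powr (\<gamma> - 1)"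
            using False True z assms by (intro mult_left_mono powr_mono2') auto
          also have "\<dots> = real (switches s p z) powr (1 + (\<gamma> - 1))"
            using False by (simp only: powr_add) simp
          finally show ?thesis by simp
        qed simp
      qed
      finally have "exp (- c * (\<Sum>z\<in>A. real (switches s p z) powr \<gamma>)) \<le> exp (- (2 * c) * real t powr g)"
        using c by simp
      moreover have "0 \<le> (\<Sum>z\<in>A. exp (- b * M) * exp (b * switches s p z))"
        by (intro sum_nonneg) auto
      ultimately show ?thesis by linarith
    next
      case False
      then obtain z where z: "z \<in> A" "M < switches s p z" by auto
      have "0 \<le> (\<Sum>z\<in>A. real (switches s p z) powr \<gamma>)" by (intro sum_nonneg) auto
      then have "exp (- c * (\<Sum>z\<in>A. real (switches s p z) powr \<gamma>)) \<le> 1" using c by simp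
      also have "1 \<le> exp (b * (switches s p z - M))" using z b by simp
      also have "\<dots> = exp (- b * M) * exp (b * switches s p z)"
        by (simp add: right_diff_distrib flip: exp_add)
      also have "\<dots> \<le> (\<Sum>z\<in>A. exp (- b * M) * exp (b * switches s p z))"
        using z by (intro member_le_sum) (auto simp: A_def)
      finally show ?thesis using exp_ge_zero[of "- (2 * c) * real t powr g"] by linarith
    qed
    have "R t p \<le> avg (paths t) (\<lambda>s. exp (- (2 * c) * real t powr g) + (\<Sum>z\<in>A. exp (- b * M) * exp (b * switches s p z)))"
      unfolding R_def A_def[symmetric] by (intro avg_mono pointwise)
    also have "\<dots> = exp (- (2 * c) * real t powr g) + (\<Sum>z\<in>A. exp (- b * M) * avg (paths t) (\<lambda>s. exp (b * switches s p z)))"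
      by (simp add: avg_add avg_sum avg_cmult)
    also have "\<dots> \<le> exp (- (2 * c) * real t powr g) + (\<Sum>z\<in>A. exp (- b * M) * (2 * exp (2 * b) * exp (16 * b\<^sup>2 * t)))"
      using b by (intro add_left_mono sum_mono mult_left_mono exp_switches_le) auto
    also have "\<dots> = exp (- (2 * c) * real t powr g) + (2 * t + 1) * (2 * exp (2 * b) * exp (- b * M + 16 * b\<^sup>2 * t))"
      by (simp add: A_def exp_add exp_diff exp_minus field_simps)
    also have "- b * M + 16 * b\<^sup>2 * t = - (1 / 64) * (M\<^sup>2 / t)"
      using t by (simp add: b_def power2_eq_square field_simps)
    also have "exp (- (2 * c) * real t powr g) + (2 * t + 1) * (2 * exp (2 * b) * exp (- (1 / 64) * (M\<^sup>2 / t)))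
      \<le> 1 * exp (- d * real t powr g) + (3 * t) * (6 * exp (- d * real t powr g))"
    proof (intro add_mono mult_mono)
      have "exp (2 * b) \<le> exp 1" using b by simp
      then show "2 * exp (2 * b) \<le> 6" using exp_le by linarith
    qed (use t b in \<open>auto simp: MM d_def mult_right_mono\<close>)
    also have "\<dots> = (1 + 18 * real t) * exp (- d * real t powr g)" by (simp add: algebra_simps)
    also have "\<dots> \<le> 19 * real t * exp (- d * real t powr g)" using t by (intro mult_right_mono) auto
    finally show ?thesis .
  qed
  have "(\<lambda>n. ln 19 * (1 / real n powr g) + ln (real n) / real n powr g) \<longlonglongrightarrow> ln 19 * 0 + 0"
  proof (intro tendsto_add tendsto_mult tendsto_const lim_ln_over_power g)
    have "(\<lambda>n. real n powr (- g)) \<longlonglongrightarrow> 0"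
      using g by (intro tendsto_neg_powr filterlim_real_sequentially) simp
    then show "(\<lambda>n. 1 / real n powr g) \<longlonglongrightarrow> 0"
      by (simp add: powr_minus divide_inverse)
  qed
  then have "\<forall>\<^sub>F n in sequentially. ln 19 * (1 / real n powr g) + ln (real n) / real n powr g < d / 2"
    using d by (intro order_tendstoD) auto
  then obtain t0 where t0: "\<And>n. n \<ge> t0 \<Longrightarrow> ln 19 * (1 / real n powr g) + ln (real n) / real n powr g < d / 2"
    by (auto simp: eventually_sequentially)
  \<comment> \<open>For large times, half of the exponent absorbs the polynomial factor; for the finitely many small times, the trivial bound by \<open>exp (- c)\<close> is used.\<close>
  define e where "e = min (d / 2) (c / real (Suc t0) powr g)"
  have e: "e > 0" using c d by (simp add: e_def)
  have R: "R t p \<le> exp (- e * real t powr g)" for t p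
  proof -
    consider "t = 0" | "t \<ge> 1" "t < t0" | "t \<ge> 1" "t \<ge> t0" by linarith
    then show ?thesis
    proof cases
      case 1
      then show ?thesis by (simp add: R_def avg_def)
    next
      case 2
      have "e * real t powr g \<le> c / real (Suc t0) powr g * real (Suc t0) powr g"
        using 2 c g by (intro mult_mono powr_mono2) (auto simp: e_def)
      then have "exp (- c) \<le> exp (- e * real t powr g)" by simp
      with small[OF 2(1), of p] show ?thesis by linarith
    next
      case 3
      have tg: "real t powr g > 0" using 3 by simp
      have "(ln 19 + ln (real t)) / real t powr g < d / 2"
        using t0[OF 3(2)] by (simp add: add_divide_distrib)
      then have "ln 19 + ln (real t) \<le> d / 2 * real t powr g" using tg by (simp add: field_simps)
      then have "exp (ln 19 + ln (real t) - d * real t powr g) \<le> exp (- (d / 2) * real t powr g)" by simp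
      moreover have "exp (ln 19 + ln (real t) - d * real t powr g) = 19 * t * exp (- d * real t powr g)"
        using 3 by (simp add: exp_add exp_diff exp_minus divide_inverse)
      moreover have "e \<le> d / 2" unfolding e_def by (rule min.cobounded1)
      then have "exp (- (d / 2) * real t powr g) \<le> exp (- e * real t powr g)"
        using tg by (simp only: exp_le_cancel_iff mult_minus_left neg_le_iff_le mult_right_mono less_imp_le)
      ultimately show ?thesis using large[OF 3(1), of p] by linarith
    qed
  qed
  show ?thesis
    unfolding has_return_exponent_def g_def[symmetric]
  proof (intro exI[of _ e] conjI allI ballI)
    fix n x y assume "x \<in> carrier (wr G)" "y \<in> carrier (wr G)"
    then obtain f p h q where eq: "x = Wr f p" "y = Wr h q"
      "Wr f p \<in> carrier (wr G)" "Wr h q \<in> carrier (wr G)"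
      by (metis wr_cases)
    show "(step (wr G) (walk_steps G T) ^^ n) (\<lambda>w. of_bool (w = y)) x \<le> exp (- e * real n powr g)"
      using upper[OF eq(3,4), of n] R[of n p] by (simp add: eq)
  qed (rule e)
qed


section \<open>The walk at the bottom level\<close>

primrec int_abs :: "iter_elem \<Rightarrow> real"
  where
    "int_abs (Base x) = \<bar>real_of_int x\<bar>"
  | "int_abs (Wr f x) = 0"

lemma subadditive_int_abs: "group_length int_copy int_abs"
  by (auto simp: group_length_def carrier_int_copy int_copy_one int_copy_mult)

lemma symmetric_steps_int: "symmetric_steps int_copy [Base 1, Base (- 1)]"
  by (auto simp: symmetric_steps_def carrier_int_copy avg_def int_copy_inv)

lemma step_int: "step int_copy [Base 1, Base (- 1)] \<phi> (Base x) = (\<phi> (Base (x + 1)) + \<phi> (Base (x - 1))) / 2"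
  by (simp add: step_def avg_def int_copy_mult)

text \<open>The first absolute moment is bounded below by the second and the fourth one.\<close>

lemma has_speed_int: "has_speed int_copy [Base 1, Base (- 1)] int_abs (1 / 2)"
proof -
  let ?P = "step int_copy [Base 1, Base (- 1)]"
  have m2: "(?P ^^ n) (\<lambda>w. int_abs w ^ 2) (Base x) = real_of_int x ^ 2 + n" for n x
    by (induction n arbitrary: x) (simp_all add: step_int, simp add: power2_eq_square field_simps)
  have m4: "(?P ^^ n) (\<lambda>w. int_abs w ^ 4) (Base x) =
    real_of_int x ^ 4 + 6 * n * real_of_int x ^ 2 + 3 * real n ^ 2 - 2 * n" for n x
    by (induction n arbitrary: x) (simp_all add: step_int, simp add: power2_eq_square power4_eq_xxxx field_simps)
  have "1 / (2 * sqrt 6) * real n powr (1 / 2) \<le> (?P ^^ n) int_abs (Base 0)" for n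
  proof (cases "n = 0")
    case False
    define M where "M = sqrt (6 * n)"
    have M: "M > 0" "M\<^sup>2 = 6 * n" using False by (auto simp: M_def)
    have "1 / (2 * sqrt 6) * real n powr (1 / 2) = 1 / M * n + (- (1 / M ^ 3)) * (3 * real n ^ 2)"
    proof -
      have "M ^ 3 = M * (6 * n)" using M by (simp add: power3_eq_cube power2_eq_square)
      then have "1 / M * n + (- (1 / M ^ 3)) * (3 * real n ^ 2) = n / (2 * M)"
        using False M by (simp add: field_simps power2_eq_square)
      also have "\<dots> = 1 / (2 * sqrt 6) * (n / sqrt n)"
        by (simp add: M_def real_sqrt_mult)
      finally show ?thesis by (simp add: real_div_sqrt powr_half_sqrt)
    qed
    also have "\<dots> \<le> 1 / M * n + (- (1 / M ^ 3)) * (3 * real n ^ 2 - 2 * n)"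
      using M by (intro add_left_mono mult_left_mono_neg) auto
    also have "\<dots> = (?P ^^ n) (\<lambda>w. 1 / M * int_abs w ^ 2 + (- (1 / M ^ 3)) * int_abs w ^ 4) (Base 0)"
      by (simp only: step_pow_add step_pow_cmult m2 m4) simp
    also have "\<dots> \<le> (?P ^^ n) int_abs (Base 0)"
    proof (rule step_pow_mono)
      fix w
      have "M powr 1 * ((int_abs w)\<^sup>2 / M\<^sup>2 - ((int_abs w)\<^sup>2 / M\<^sup>2)\<^sup>2) \<le> int_abs w"
      proof (cases "int_abs w / M \<le> 1")
        case True
        have nn: "0 \<le> int_abs w" by (cases w) auto
        have "(int_abs w / M) * (int_abs w / M) \<le> (int_abs w / M) * 1"
          using True nn M by (intro mult_left_mono) auto
        then have "(int_abs w)\<^sup>2 / M\<^sup>2 - ((int_abs w)\<^sup>2 / M\<^sup>2)\<^sup>2 \<le> int_abs w / M"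
          by (smt (verit) power2_eq_square times_divide_times_eq zero_le_power2 mult.right_neutral)
        then show ?thesis using M by (simp add: field_simps)
      next
        case False
        have nn: "0 \<le> int_abs w" by (cases w) auto
        have "1 ^ 2 \<le> (int_abs w / M) ^ 2" using False by (intro power_mono) auto
        then have "1 \<le> (int_abs w)\<^sup>2 / M\<^sup>2" by (simp add: power_divide)
        then have "(int_abs w)\<^sup>2 / M\<^sup>2 * 1 \<le> (int_abs w)\<^sup>2 / M\<^sup>2 * ((int_abs w)\<^sup>2 / M\<^sup>2)"
          by (intro mult_left_mono) auto
        then have "(int_abs w)\<^sup>2 / M\<^sup>2 - ((int_abs w)\<^sup>2 / M\<^sup>2)\<^sup>2 \<le> 0"
          by (simp add: power2_eq_square)
        then have "M powr 1 * ((int_abs w)\<^sup>2 / M\<^sup>2 - ((int_abs w)\<^sup>2 / M\<^sup>2)\<^sup>2) \<le> 0"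
          by (intro mult_nonneg_nonpos) auto
        with nn show ?thesis by linarith
      qed
      moreover have "M powr 1 * ((int_abs w)\<^sup>2 / M\<^sup>2 - ((int_abs w)\<^sup>2 / M\<^sup>2)\<^sup>2) =
        1 / M * int_abs w ^ 2 + (- (1 / M ^ 3)) * int_abs w ^ 4"
        using M(1) by (simp add: field_simps power2_eq_square power3_eq_cube power4_eq_xxxx)
      ultimately show "1 / M * int_abs w ^ 2 + (- (1 / M ^ 3)) * int_abs w ^ 4 \<le> int_abs w" by simp
    qed (auto simp: carrier_int_copy group_int_copy group.is_monoid)
    finally show ?thesis .
  qed simp
  then show ?thesis
    unfolding has_speed_def int_copy_one by (intro exI[of _ "1 / (2 * sqrt 6)"]) auto
qed

lemma has_return_exponent_int: "has_return_exponent int_copy [Base 1, Base (- 1)] 0"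
proof -
  let ?P = "step int_copy [Base 1, Base (- 1)]"
  have "(?P ^^ n) (\<lambda>w. of_bool (w = y)) x \<le> exp (- ln 2 * real n powr 0)" if "x \<in> carrier int_copy" for n x y
  proof (cases n)
    case (Suc m)
    have "?P (\<lambda>w. of_bool (w = y)) w \<le> 1 / 2" if "w \<in> carrier int_copy" for w
      using that by (auto simp: carrier_int_copy step_int)
    then have "(?P ^^ m) (?P (\<lambda>w. of_bool (w = y))) x \<le> (?P ^^ m) (\<lambda>w. 1 / 2) x"
      using that by (intro step_pow_mono) (auto simp: carrier_int_copy group_int_copy group.is_monoid)
    also have "\<dots> = exp (- ln 2 * real n powr 0)"
      using Suc by (simp add: step_pow_const exp_minus)
    finally show ?thesis using Suc by (simp add: funpow_swap1)
  qed simp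
  then show ?thesis
    unfolding has_return_exponent_def by (intro exI[of _ "ln 2"]) auto
qed

section \<open>Walks confined to a finite set\<close>

text \<open>A step that would leave \<open>F\<close> is suppressed: with \<open>\<kappa> = 1\<close>, the walk stays where it is, with
  \<open>\<kappa> = 0\<close>, it is killed. In both cases the operator is symmetric on functions on \<open>F\<close>.\<close>

definition confined ::
    "('a, 'm) monoid_scheme \<Rightarrow> 'a list \<Rightarrow> 'a set \<Rightarrow> real \<Rightarrow> ('a \<Rightarrow> real) \<Rightarrow> 'a \<Rightarrow> real"
  where "confined G T F \<kappa> u x = avg T (\<lambda>a. if x \<otimes>\<^bsub>G\<^esub> a \<in> F then u (x \<otimes>\<^bsub>G\<^esub> a) else \<kappa> * u x)"

locale finite_walk = group G for G :: "('a, 'm) monoid_scheme" (structure) +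
  fixes T :: "'a list" and F :: "'a set"
  assumes T: "symmetric_steps G T" and F: "finite F" "F \<subseteq> carrier G"
begin

lemma T_ne: "T \<noteq> []" and T_closed: "a \<in> set T \<Longrightarrow> a \<in> carrier G"
  and T_inv: "avg T (\<lambda>a. \<phi> (inv a)) = avg T \<phi>" for \<phi> :: "'a \<Rightarrow> real"
  using T by (auto simp: symmetric_steps_def)

abbreviation Q where "Q \<equiv> confined G T F"

definition inner_F :: "('a \<Rightarrow> real) \<Rightarrow> ('a \<Rightarrow> real) \<Rightarrow> real"
  where "inner_F u v = (\<Sum>x\<in>F. u x * v x)"

lemma inner_F_shift:
  fixes u v :: "'a \<Rightarrow> real"
  assumes "a \<in> carrier G"
  shows "(\<Sum>x\<in>F. v x * (if x \<otimes> a \<in> F then u (x \<otimes> a) else 0)) =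
    (\<Sum>x\<in>F. u x * (if x \<otimes> inv a \<in> F then v (x \<otimes> inv a) else 0))"
proof -
  have eq: "(\<Sum>x\<in>F. g x * (if h x \<in> F then k x else 0)) = (\<Sum>x\<in>{x\<in>F. h x \<in> F}. g x * k x)"
    for g h and k :: "'a \<Rightarrow> real"
    using F by (simp add: sum.If_cases if_distrib sum.inter_filter cong: if_cong)
  have "(\<Sum>x\<in>{x\<in>F. x \<otimes> a \<in> F}. v x * u (x \<otimes> a)) = (\<Sum>x\<in>{x\<in>F. x \<otimes> inv a \<in> F}. u x * v (x \<otimes> inv a))"
    by (rule sum.reindex_bij_witness[of _ "\<lambda>y. y \<otimes> inv a" "\<lambda>x. x \<otimes> a"])
      (use F assms in \<open>auto simp: m_assoc subset_iff mult.commute[of "v _"]\<close>)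
  then show ?thesis by (simp only: eq)
qed

lemma confined_sym: "inner_F v (Q \<kappa> u) = inner_F (Q \<kappa> v) u"
proof -
  have split: "inner_F v (Q \<kappa> u) = avg T (\<lambda>a. \<Sum>x\<in>F. v x * (if x \<otimes> a \<in> F then u (x \<otimes> a) else 0)) +
    avg T (\<lambda>a. \<Sum>x\<in>F. if x \<otimes> a \<in> F then 0 else \<kappa> * v x * u x)" for u v
    unfolding inner_F_def confined_def avg_cmult[symmetric] avg_sum[symmetric] avg_add[symmetric] sum.distrib[symmetric]
    by (intro avg_cong sum.cong) auto
  have "avg T (\<lambda>a. \<Sum>x\<in>F. v x * (if x \<otimes> a \<in> F then u (x \<otimes> a) else 0)) =
    avg T (\<lambda>a. \<Sum>x\<in>F. u x * (if x \<otimes> inv a \<in> F then v (x \<otimes> inv a) else 0))"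
    by (intro avg_cong inner_F_shift T_closed)
  also have "\<dots> = avg T (\<lambda>a. \<Sum>x\<in>F. u x * (if x \<otimes> a \<in> F then v (x \<otimes> a) else 0))"
    by (rule T_inv)
  finally have "inner_F v (Q \<kappa> u) = inner_F u (Q \<kappa> v)"
    by (simp add: split mult_ac cong: if_cong)
  then show ?thesis by (simp add: inner_F_def mult.commute)
qed

lemma confined_pow_sym: "inner_F v ((Q \<kappa> ^^ n) u) = inner_F ((Q \<kappa> ^^ n) v) u"
proof (induction n arbitrary: u v)
  case (Suc n)
  have "inner_F v ((Q \<kappa> ^^ Suc n) u) = inner_F (Q \<kappa> v) ((Q \<kappa> ^^ n) u)"
    by (simp add: confined_sym)
  also have "\<dots> = inner_F ((Q \<kappa> ^^ Suc n) v) u"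
    by (simp only: Suc.IH funpow_Suc_right o_apply)
  finally show ?case .
qed simp

lemma confined_pow_double: "inner_F u ((Q \<kappa> ^^ (2 * n)) u) = inner_F ((Q \<kappa> ^^ n) u) ((Q \<kappa> ^^ n) u)"
  by (simp add: mult_2 funpow_add confined_pow_sym)

lemma confined_pow_add: "(Q \<kappa> ^^ n) (\<lambda>y. u y + v y) = (\<lambda>x. (Q \<kappa> ^^ n) u x + (Q \<kappa> ^^ n) v x)"
proof (induction n)
  case (Suc n)
  have *: "Q \<kappa> (\<lambda>y. u y + v y) x = Q \<kappa> u x + Q \<kappa> v x" for u v x
    unfolding confined_def avg_add[symmetric] by (intro avg_cong) (auto simp: distrib_left)
  show ?case unfolding funpow.simps o_apply Suc.IH by (rule ext) (rule *)
qed simp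

lemma confined_pow_cmult: "(Q \<kappa> ^^ n) (\<lambda>y. c * u y) = (\<lambda>x. c * (Q \<kappa> ^^ n) u x)"
proof (induction n)
  case (Suc n)
  have *: "Q \<kappa> (\<lambda>y. c * u y) x = c * Q \<kappa> u x" for u x
    unfolding confined_def avg_cmult[symmetric] by (intro avg_cong) auto
  show ?case unfolding funpow.simps o_apply Suc.IH by (rule ext) (rule *)
qed simp

lemma confined_pow_const: "(Q 1 ^^ n) (\<lambda>y. c) = (\<lambda>x. c)"
proof (induction n)
  case (Suc n)
  have *: "Q 1 (\<lambda>y. c) x = c" for x
    using T_ne by (simp add: confined_def cong: if_cong)
  show ?case unfolding funpow.simps o_apply Suc.IH by (rule ext) (rule *)
qed simp

lemma confined_pow_mono:
  assumes "\<And>y. y \<in> F \<Longrightarrow> u y \<le> v y" "x \<in> F"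
  shows "(Q 1 ^^ n) u x \<le> (Q 1 ^^ n) v x"
  using assms(2)
proof (induction n arbitrary: x)
  case (Suc n)
  then show ?case by (auto simp: confined_def[of _ _ _ 1 "(Q 1 ^^ n) _"] intro!: avg_mono)
qed (use assms(1) in simp)

lemma sum_confined_pow: "(\<Sum>x\<in>F. (Q 1 ^^ n) u x) = (\<Sum>x\<in>F. u x)"
  using confined_pow_sym[where v = "\<lambda>_. 1" and \<kappa> = 1 and n = n and u = u] by (simp add: inner_F_def confined_pow_const)

lemma energy_eq:
  "(\<Sum>x\<in>F. (Q 1 ^^ n) (\<lambda>y. (u y - u x)\<^sup>2) x) = 2 * (inner_F u u - inner_F u ((Q 1 ^^ n) u))"
proof -
  have "(Q 1 ^^ n) (\<lambda>y. (u y - u x)\<^sup>2) = (\<lambda>z. (Q 1 ^^ n) (\<lambda>y. u y ^ 2) z + ((- 2 * u x) * (Q 1 ^^ n) u z + u x ^ 2))" for x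
  proof -
    have "(\<lambda>y. (u y - u x)\<^sup>2) = (\<lambda>y. u y ^ 2 + ((- 2 * u x) * u y + u x ^ 2))"
      by (auto simp: power2_eq_square algebra_simps)
    then show ?thesis by (simp only: confined_pow_add confined_pow_cmult confined_pow_const)
  qed
  then have "(\<Sum>x\<in>F. (Q 1 ^^ n) (\<lambda>y. (u y - u x)\<^sup>2) x) =
    (\<Sum>x\<in>F. (Q 1 ^^ n) (\<lambda>y. u y ^ 2) x) + (- 2 * (\<Sum>x\<in>F. u x * (Q 1 ^^ n) u x) + (\<Sum>x\<in>F. u x ^ 2))"
    by (simp add: sum.distrib sum_distrib_left mult_ac sum_subtractf sum_negf)
  then show ?thesis
    by (simp add: sum_confined_pow inner_F_def power2_eq_square)
qed

text \<open>This is the Markov type 2 property of the line. Doubling the time at most doubles the energy,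
  since \<open>2 * (1 - Q ^ n) - (1 - Q ^ (2 * n)) = (1 - Q ^ n)\<^sup>2\<close> is positive.\<close>

lemma markov_type:
  "(\<Sum>x\<in>F. (Q 1 ^^ (2 ^ j)) (\<lambda>y. (u y - u x)\<^sup>2) x) \<le> 2 ^ j * (\<Sum>x\<in>F. Q 1 (\<lambda>y. (u y - u x)\<^sup>2) x)"
proof (induction j)
  case (Suc j)
  let ?w = "(Q 1 ^^ (2 ^ j)) u"
  have "0 \<le> (\<Sum>x\<in>F. (u x - ?w x)\<^sup>2)" by (intro sum_nonneg) auto
  also have "\<dots> = inner_F u u - 2 * inner_F u ?w + inner_F ?w ?w"
    by (simp add: inner_F_def power2_eq_square algebra_simps sum.distrib sum_subtractf sum_distrib_left)
  also have "inner_F ?w ?w = inner_F u ((Q 1 ^^ (2 ^ Suc j)) u)"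
    by (simp add: confined_pow_double)
  finally have "inner_F u u - inner_F u ((Q 1 ^^ (2 ^ Suc j)) u) \<le> 2 * (inner_F u u - inner_F u ?w)" by simp
  then have "(\<Sum>x\<in>F. (Q 1 ^^ (2 ^ Suc j)) (\<lambda>y. (u y - u x)\<^sup>2) x) \<le>
    2 * (\<Sum>x\<in>F. (Q 1 ^^ (2 ^ j)) (\<lambda>y. (u y - u x)\<^sup>2) x)"
    unfolding energy_eq by (rule mult_left_mono) simp
  also have "\<dots> \<le> 2 * (2 ^ j * (\<Sum>x\<in>F. Q 1 (\<lambda>y. (u y - u x)\<^sup>2) x))"
    using Suc by simp
  finally show ?case by simp
qed simp

lemma integral_avg:
  fixes g :: "'c \<Rightarrow> 'd \<Rightarrow> real"
  assumes "\<And>a. a \<in> set U \<Longrightarrow> integrable M (g a)"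
  shows "integrable M (\<lambda>\<tau>. avg U (\<lambda>a. g a \<tau>))" "(\<integral>\<tau>. avg U (\<lambda>a. g a \<tau>) \<partial>M) = avg U (\<lambda>a. \<integral>\<tau>. g a \<tau> \<partial>M)"
proof -
  have "integrable M (\<lambda>\<tau>. \<Sum>a\<leftarrow>U. g a \<tau>) \<and> (\<integral>\<tau>. (\<Sum>a\<leftarrow>U. g a \<tau>) \<partial>M) = (\<Sum>a\<leftarrow>U. \<integral>\<tau>. g a \<tau> \<partial>M)"
    using assms by (induction U) auto
  then show "integrable M (\<lambda>\<tau>. avg U (\<lambda>a. g a \<tau>))" "(\<integral>\<tau>. avg U (\<lambda>a. g a \<tau>) \<partial>M) = avg U (\<lambda>a. \<integral>\<tau>. g a \<tau> \<partial>M)"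
    by (auto simp: avg_def)
qed

lemma integral_confined_pow:
  fixes g :: "'a \<Rightarrow> 'c \<Rightarrow> real"
  assumes "\<And>y. y \<in> F \<Longrightarrow> integrable M (g y)" "x \<in> F"
  shows "integrable M (\<lambda>\<tau>. (Q 1 ^^ n) (\<lambda>y. g y \<tau>) x) \<and>
    (\<integral>\<tau>. (Q 1 ^^ n) (\<lambda>y. g y \<tau>) x \<partial>M) = (Q 1 ^^ n) (\<lambda>y. \<integral>\<tau>. g y \<tau> \<partial>M) x"
  using assms(2)
proof (induction n arbitrary: x)
  case (Suc n)
  let ?h = "\<lambda>a \<tau>. (Q 1 ^^ n) (\<lambda>y. g y \<tau>) (if x \<otimes> a \<in> F then x \<otimes> a else x)"
  have Q: "(Q 1 ^^ Suc n) v x = avg T (\<lambda>a. (Q 1 ^^ n) v (if x \<otimes> a \<in> F then x \<otimes> a else x))" for v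
    by (auto simp: confined_def[of _ _ _ 1 "(Q 1 ^^ n) v"] intro!: avg_cong)
  have "integrable M (?h a)" "(\<integral>\<tau>. ?h a \<tau> \<partial>M) = (Q 1 ^^ n) (\<lambda>y. \<integral>\<tau>. g y \<tau> \<partial>M) (if x \<otimes> a \<in> F then x \<otimes> a else x)"
    if "a \<in> set T" for a
    using Suc by auto
  then show ?case
    unfolding Q using integral_avg[of T M ?h] by (auto intro!: avg_cong)
qed (use assms(1) in simp)

text \<open>Integrating over the coordinates gives Markov type 2 for all square-integrable families.\<close>

lemma markov_type_L2:
  fixes f :: "'a \<Rightarrow> 'c \<Rightarrow> real"
  assumes "\<And>x y. x \<in> F \<Longrightarrow> y \<in> F \<Longrightarrow> integrable M (\<lambda>\<tau>. (f y \<tau> - f x \<tau>)\<^sup>2)"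
  shows "(\<Sum>x\<in>F. (Q 1 ^^ (2 ^ j)) (\<lambda>y. \<integral>\<tau>. (f y \<tau> - f x \<tau>)\<^sup>2 \<partial>M) x) \<le>
    2 ^ j * (\<Sum>x\<in>F. Q 1 (\<lambda>y. \<integral>\<tau>. (f y \<tau> - f x \<tau>)\<^sup>2 \<partial>M) x)"
proof -
  have *: "integrable M (\<lambda>\<tau>. \<Sum>x\<in>F. (Q 1 ^^ n) (\<lambda>y. (f y \<tau> - f x \<tau>)\<^sup>2) x)"
    "(\<integral>\<tau>. (\<Sum>x\<in>F. (Q 1 ^^ n) (\<lambda>y. (f y \<tau> - f x \<tau>)\<^sup>2) x) \<partial>M) =
      (\<Sum>x\<in>F. (Q 1 ^^ n) (\<lambda>y. \<integral>\<tau>. (f y \<tau> - f x \<tau>)\<^sup>2 \<partial>M) x)" for n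
    using integral_confined_pow[of M "\<lambda>y \<tau>. (f y \<tau> - f _ \<tau>)\<^sup>2"] assms
    by (auto intro!: Bochner_Integration.integral_sum[THEN trans] sum.cong)
  have "(\<integral>\<tau>. (\<Sum>x\<in>F. (Q 1 ^^ (2 ^ j)) (\<lambda>y. (f y \<tau> - f x \<tau>)\<^sup>2) x) \<partial>M) \<le>
    (\<integral>\<tau>. 2 ^ j * (\<Sum>x\<in>F. Q 1 (\<lambda>y. (f y \<tau> - f x \<tau>)\<^sup>2) x) \<partial>M)"
    using *(1)[of "2 ^ j"] *(1)[of 1] by (intro integral_mono markov_type) auto
  also have "\<dots> = 2 ^ j * (\<integral>\<tau>. (\<Sum>x\<in>F. Q 1 (\<lambda>y. (f y \<tau> - f x \<tau>)\<^sup>2) x) \<partial>M)" by simp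
  finally show ?thesis using *(2)[of "2 ^ j"] *(2)[of 1] by simp
qed

primrec products :: "nat \<Rightarrow> 'a set"
  where
    "products 0 = {\<one>}"
  | "products (Suc n) = insert \<one> (\<Union>a\<in>set T. (\<otimes>) a ` products n)"

lemma products_closed: "h \<in> products n \<Longrightarrow> h \<in> carrier G"
  using T_closed by (induction n arbitrary: h) auto

lemma finite_products: "finite (products n)"
  by (induction n) auto

lemma confined_eq_step:
  assumes "x \<in> F" "\<And>h. h \<in> products n \<Longrightarrow> x \<otimes> h \<in> F"
  shows "(Q 1 ^^ n) u x = (step G T ^^ n) u x"
  using assms
proof (induction n arbitrary: x)
  case (Suc n)
  have one: "\<one> \<in> products n" by (cases n) auto
  have "(Q 1 ^^ Suc n) u x = avg T (\<lambda>a. (step G T ^^ n) u (x \<otimes> a))"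
  proof -
    have "(if x \<otimes> a \<in> F then (Q 1 ^^ n) u (x \<otimes> a) else 1 * (Q 1 ^^ n) u x) = (step G T ^^ n) u (x \<otimes> a)"
      if a: "a \<in> set T" for a
    proof -
      have xa: "(x \<otimes> a) \<otimes> h \<in> F" if "h \<in> products n" for h
        using Suc.prems(2)[of "a \<otimes> h"] Suc.prems(1) a that F T_closed products_closed
        by (auto simp: m_assoc subset_iff)
      moreover have "x \<otimes> a \<in> F"
        using xa[OF one] Suc.prems(1) F(2) T_closed[OF a] by auto
      ultimately show ?thesis using Suc.IH by simp
    qed
    then show ?thesis by (simp add: confined_def[of _ _ _ 1 "(Q 1 ^^ n) u"] cong: avg_cong)
  qed
  then show ?case by (simp add: step_def[of _ _ "(step G T ^^ n) u"])
qed simp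

lemma killed_pow_le:
  assumes "x \<in> carrier G"
  shows "\<bar>(Q 0 ^^ n) u x\<bar> \<le> (step G T ^^ n) (\<lambda>y. \<bar>u y\<bar>) x"
  using assms
proof (induction n arbitrary: x)
  case (Suc n)
  have "\<bar>avg T \<phi>\<bar> \<le> avg T (\<lambda>a. \<bar>\<phi> a\<bar>)" for \<phi> :: "'a \<Rightarrow> real"
  proof -
    have "avg T \<phi> \<le> avg T (\<lambda>a. \<bar>\<phi> a\<bar>)" by (intro avg_mono) simp
    moreover have "avg T (\<lambda>a. - 1 * \<phi> a) \<le> avg T (\<lambda>a. \<bar>\<phi> a\<bar>)" by (intro avg_mono) simp
    then have "- avg T \<phi> \<le> avg T (\<lambda>a. \<bar>\<phi> a\<bar>)" unfolding avg_cmult by simp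
    ultimately show ?thesis by simp
  qed
  from this[of "\<lambda>a. if x \<otimes> a \<in> F then (Q 0 ^^ n) u (x \<otimes> a) else 0"]
  have "\<bar>(Q 0 ^^ Suc n) u x\<bar> \<le> avg T (\<lambda>a. \<bar>if x \<otimes> a \<in> F then (Q 0 ^^ n) u (x \<otimes> a) else 0\<bar>)"
    by (simp add: confined_def[of _ _ _ 0 "(Q 0 ^^ n) u"] cong: if_cong)
  also have "\<dots> \<le> avg T (\<lambda>a. (step G T ^^ n) (\<lambda>y. \<bar>u y\<bar>) (x \<otimes> a))"
  proof (intro avg_mono)
    fix a assume a: "a \<in> set T"
    have "\<bar>(Q 0 ^^ n) u (x \<otimes> a)\<bar> \<le> (step G T ^^ n) (\<lambda>y. \<bar>u y\<bar>) (x \<otimes> a)"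
      using Suc T_closed[OF a] by auto
    then show "\<bar>if x \<otimes> a \<in> F then (Q 0 ^^ n) u (x \<otimes> a) else 0\<bar> \<le> (step G T ^^ n) (\<lambda>y. \<bar>u y\<bar>) (x \<otimes> a)"
      by auto
  qed
  finally show ?case by (simp add: step_def[of _ _ "(step G T ^^ n) (\<lambda>y. \<bar>u y\<bar>)"])
qed simp

text \<open>The spectral counterpart: by the Cauchy--Schwarz inequality, the Rayleigh quotient \<open>\<rho>\<close> of \<open>u\<close>
  satisfies \<open>\<rho> ^ n * \<langle>u, u\<rangle> \<le> \<langle>u, Q ^ n u\<rangle>\<close> for \<open>n = 2 ^ j\<close>, while transition probabilities bounded by
  \<open>r\<close> give \<open>\<langle>u, Q ^ n u\<rangle> \<le> r * (\<Sum>x\<in>F. \<bar>u x\<bar>)\<^sup>2 \<le> r * card F * \<langle>u, u\<rangle>\<close>.\<close>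

lemma killed_rayleigh:
  assumes u: "\<And>x. x \<in> carrier G - F \<Longrightarrow> u x = 0" and pos: "inner_F u u > 0"
    and r: "\<And>x y. x \<in> F \<Longrightarrow> y \<in> F \<Longrightarrow> (step G T ^^ (2 ^ j)) (\<lambda>w. of_bool (w = y)) x \<le> r"
    and nonneg: "inner_F u (Q 0 u) \<ge> 0"
  shows "(inner_F u (Q 0 u) / inner_F u u) ^ (2 ^ j) \<le> r * card F"
proof -
  define b where "b = (\<lambda>i. inner_F u ((Q 0 ^^ (2 ^ i)) u) / inner_F u u)"
  have lower: "b 0 ^ (2 ^ i) \<le> b i" for i
  proof (induction i)
    case (Suc i)
    have "0 \<le> b 0 ^ (2 ^ i)" using nonneg pos by (simp add: b_def)
    then have "b 0 ^ (2 ^ Suc i) \<le> (b i)\<^sup>2"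
      using power_mono[OF Suc, of 2] by (simp add: power_mult[symmetric] mult.commute)
    also have "\<dots> \<le> (inner_F u u * inner_F u ((Q 0 ^^ (2 ^ Suc i)) u)) / (inner_F u u)\<^sup>2"
      using Cauchy_Schwarz_ineq_sum[of u "(Q 0 ^^ (2 ^ i)) u" F]
      unfolding b_def power_divide
      by (intro divide_right_mono) (simp_all add: confined_pow_double, simp_all add: inner_F_def power2_eq_square)
    also have "\<dots> = b (Suc i)" using pos by (simp add: b_def power2_eq_square)
    finally show ?case .
  qed simp
  define s where "s = (\<Sum>x\<in>F. \<bar>u x\<bar>)"
  have "r \<ge> 0"
  proof -
    obtain x where x: "x \<in> F" using pos by (fastforce simp: inner_F_def)
    have "(step G T ^^ (2 ^ j)) (\<lambda>_. 0) x \<le> (step G T ^^ (2 ^ j)) (\<lambda>w. of_bool (w = x)) x"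
      using x F T_closed by (intro step_pow_mono) auto
    then show ?thesis using r[OF x x] by (simp add: step_pow_const[OF T_ne])
  qed
  have upper: "\<bar>(Q 0 ^^ (2 ^ j)) u x\<bar> \<le> r * s" if x: "x \<in> F" for x
  proof -
    have xc: "x \<in> carrier G" using x F by auto
    have "\<bar>(Q 0 ^^ (2 ^ j)) u x\<bar> \<le> (step G T ^^ (2 ^ j)) (\<lambda>y. \<bar>u y\<bar>) x"
      by (rule killed_pow_le[OF xc])
    also have "\<dots> = (step G T ^^ (2 ^ j)) (\<lambda>w. \<Sum>y\<in>F. \<bar>u y\<bar> * of_bool (w = y)) x"
    proof (rule step_pow_cong)
      fix w assume "w \<in> carrier G"
      moreover have "(\<Sum>y\<in>F. \<bar>u y\<bar> * of_bool (w = y)) = (if w \<in> F then \<bar>u w\<bar> else 0)"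
        using F by (simp add: of_bool_def if_distrib sum.delta cong: if_cong)
      ultimately show "\<bar>u w\<bar> = (\<Sum>y\<in>F. \<bar>u y\<bar> * of_bool (w = y))" using u by auto
    qed (use T_closed xc in auto)
    also have "\<dots> = (\<Sum>y\<in>F. \<bar>u y\<bar> * (step G T ^^ (2 ^ j)) (\<lambda>w. of_bool (w = y)) x)"
      by (simp add: step_pow_sum step_pow_cmult)
    also have "\<dots> \<le> (\<Sum>y\<in>F. \<bar>u y\<bar> * r)"
      using r x by (intro sum_mono mult_left_mono) auto
    finally show ?thesis by (simp add: s_def sum_distrib_left mult.commute)
  qed
  have "inner_F u ((Q 0 ^^ (2 ^ j)) u) \<le> (\<Sum>x\<in>F. \<bar>u x\<bar> * (r * s))"
    unfolding inner_F_def
  proof (intro sum_mono)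
    fix x assume "x \<in> F"
    have "u x * (Q 0 ^^ (2 ^ j)) u x \<le> \<bar>u x\<bar> * \<bar>(Q 0 ^^ (2 ^ j)) u x\<bar>"
      by (simp flip: abs_mult)
    also have "\<dots> \<le> \<bar>u x\<bar> * (r * s)"
      using upper[OF \<open>x \<in> F\<close>] by (intro mult_left_mono) auto
    finally show "u x * (Q 0 ^^ (2 ^ j)) u x \<le> \<bar>u x\<bar> * (r * s)" .
  qed
  also have "\<dots> = r * (\<Sum>x\<in>F. \<bar>u x\<bar> * 1)\<^sup>2"
    by (simp add: s_def power2_eq_square flip: sum_distrib_right)
  also have "\<dots> \<le> r * (inner_F u u * card F)"
    using Cauchy_Schwarz_ineq_sum[of "\<lambda>x. \<bar>u x\<bar>" "\<lambda>_. 1" F] \<open>r \<ge> 0\<close>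
    by (intro mult_left_mono) (auto simp: inner_F_def power2_eq_square)
  finally have "b j \<le> r * card F"
    using pos by (simp add: b_def field_simps)
  with lower[of j] show ?thesis by (simp add: b_def)
qed

lemma killed_gap:
  assumes "\<And>x. x \<in> carrier G - F \<Longrightarrow> u x = 0"
    and "\<And>x y. x \<in> F \<Longrightarrow> y \<in> F \<Longrightarrow> (step G T ^^ (2 ^ j)) (\<lambda>w. of_bool (w = y)) x \<le> r"
    and "r * card F \<le> exp (- A)" "0 \<le> A" "A \<le> 2 ^ j"
  shows "A / (2 * 2 ^ j) * inner_F u u \<le> inner_F u u - inner_F u (Q 0 u)"
proof -
  define n where "n = (2::nat) ^ j"
  have n: "n > 0" by (simp add: n_def)
  have uu: "inner_F u u \<ge> 0" by (simp add: inner_F_def sum_nonneg)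
  have An: "A / n \<le> 1" using assms(5) by (simp add: n_def)
  show ?thesis
  proof (cases "inner_F u u = 0")
    case True
    then have "u x = 0" if "x \<in> F" for x
      using F that by (auto simp: inner_F_def sum_nonneg_eq_0_iff)
    then show ?thesis by (simp add: inner_F_def)
  next
    case False
    define q where "q = inner_F u (Q 0 u) / inner_F u u"
    have q: "q \<le> 1 - A / (2 * n)"
    proof (cases "q \<ge> 0")
      case True
      then have "inner_F u (Q 0 u) \<ge> 0" using False uu by (simp add: q_def zero_le_divide_iff)
      from killed_rayleigh[OF assms(1) _ assms(2) this] False uu
      have "q ^ n \<le> r * card F" by (simp add: q_def n_def)
      also have "\<dots> \<le> exp (- A)" by (rule assms)
      also have "\<dots> = exp (- A / n) ^ n" using n by (simp flip: exp_of_nat_mult)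
      finally have "q \<le> exp (- A / n)" using n by (simp add: power_mono_iff True)
      also have "\<dots> \<le> 1 - A / (2 * n)"
      proof -
        define y where "y = A / n"
        have y: "0 \<le> y" "y \<le> 1" using An assms(4) by (auto simp: y_def)
        have "1 \<le> (1 - y / 2) * (1 + y)" using y mult_nonneg_nonneg[of y "1 - y"]
          by (simp add: algebra_simps power2_eq_square)
        also have "\<dots> \<le> (1 - y / 2) * exp y" using y by (intro mult_left_mono exp_ge_add_one_self) auto
        finally have "exp (- y) * 1 \<le> exp (- y) * ((1 - y / 2) * exp y)" by (intro mult_left_mono) auto
        moreover have "exp (- y) * ((1 - y / 2) * exp y) = 1 - y / 2" by (simp add: exp_minus)
        moreover have "- A / n = - y" "A / (2 * n) = y / 2" by (simp_all add: y_def)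
        ultimately show ?thesis by (simp only: mult_1_right)
      qed
      finally show ?thesis .
    next
      case False
      have "A / n / 2 \<le> 1 / 2" using An by (rule divide_right_mono) simp
      with False show ?thesis by (simp add: mult.commute)
    qed
    have "A / (2 * n) * inner_F u u \<le> (1 - q) * inner_F u u"
      using q uu by (intro mult_right_mono) auto
    also have "\<dots> = inner_F u u - inner_F u (Q 0 u)"
      using False by (simp add: q_def left_diff_distrib)
    finally show ?thesis by (simp add: n_def)
  qed
qed

end

section \<open>Folner sets\<close>

definition folner :: "('a, 'm) monoid_scheme \<Rightarrow> bool"
  where "folner G \<longleftrightarrow> (\<forall>K. \<forall>\<epsilon>::real. finite K \<longrightarrow> K \<subseteq> carrier G \<longrightarrow> \<epsilon> > 0 \<longrightarrow>
    (\<exists>F. finite F \<and> F \<noteq> {} \<and> F \<subseteq> carrier G \<and>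
      card {x \<in> F. \<exists>h\<in>K. x \<otimes>\<^bsub>G\<^esub> h \<notin> F} \<le> \<epsilon> * card F))"

lemma finite_int_bounded:
  assumes "finite (A :: int set)"
  shows "\<exists>r. \<forall>k\<in>A. \<bar>k\<bar> \<le> int r"
proof (intro exI ballI)
  fix k assume "k \<in> A"
  then have "nat \<bar>k\<bar> \<le> Max ((\<lambda>k. nat \<bar>k\<bar>) ` A)" using assms by (intro Max_ge) auto
  then show "\<bar>k\<bar> \<le> int (Max ((\<lambda>k. nat \<bar>k\<bar>) ` A))" by linarith
qed

lemma folner_int: "folner int_copy"
  unfolding folner_def
proof (intro allI impI)
  fix K and \<epsilon> :: real
  assume K: "finite K" "K \<subseteq> carrier int_copy" and "\<epsilon> > 0"
  obtain K' where K': "finite K'" "K = Base ` K'"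
    using K finite_subset_image[of K Base UNIV] by (auto simp: carrier_int_copy)
  obtain r where r: "\<And>k. k \<in> K' \<Longrightarrow> \<bar>k\<bar> \<le> int r"
    using finite_int_bounded[OF K'(1)] by blast
  obtain N :: nat where N: "2 * r / \<epsilon> < N" using reals_Archimedean2 by blast
  then have N0: "N > 0" using \<open>\<epsilon> > 0\<close> by (intro gr0I) (auto simp: field_simps not_less)
  define F where "F = Base ` {0..<int N}"
  have cF: "card F = N" by (simp add: F_def card_image inj_on_def)
  have "{x \<in> F. \<exists>h\<in>K. x \<otimes>\<^bsub>int_copy\<^esub> h \<notin> F} \<subseteq> Base ` ({0..<int r} \<union> {int N - int r..<int N})"
  proof
    fix w assume "w \<in> {x \<in> F. \<exists>h\<in>K. x \<otimes>\<^bsub>int_copy\<^esub> h \<notin> F}"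
    then obtain x k where w: "w = Base x" "0 \<le> x" "x < int N" "k \<in> K'" "Base (x + k) \<notin> F"
      by (auto simp: F_def K' int_copy_mult)
    then have "\<not> (0 \<le> x + k \<and> x + k < int N)" by (auto simp: F_def)
    then show "w \<in> Base ` ({0..<int r} \<union> {int N - int r..<int N})"
      using w r[of k] by auto
  qed
  then have "card {x \<in> F. \<exists>h\<in>K. x \<otimes>\<^bsub>int_copy\<^esub> h \<notin> F} \<le> card (Base ` ({0..<int r} \<union> {int N - int r..<int N}))"
    by (intro card_mono) auto
  also have "\<dots> \<le> card ({0..<int r} \<union> {int N - int r..<int N})" by (intro card_image_le) auto
  also have "\<dots> \<le> card {0..<int r} + card {int N - int r..<int N}" by (rule card_Un_le)
  also have "\<dots> = 2 * r" by simp
  finally have "real (card {x \<in> F. \<exists>h\<in>K. x \<otimes>\<^bsub>int_copy\<^esub> h \<notin> F}) \<le> 2 * r" by linarith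
  also have "\<dots> \<le> \<epsilon> * card F" using N \<open>\<epsilon> > 0\<close> by (simp add: cF field_simps)
  finally show "\<exists>F. finite F \<and> F \<noteq> {} \<and> F \<subseteq> carrier int_copy \<and>
      card {x \<in> F. \<exists>h\<in>K. x \<otimes>\<^bsub>int_copy\<^esub> h \<notin> F} \<le> \<epsilon> * card F"
    using N0 by (intro exI[of _ F]) (auto simp: F_def carrier_int_copy)
qed

lemma card_functions_default:
  assumes "finite I"
  shows "card {f. (\<forall>z\<in>I. f z \<in> B z) \<and> (\<forall>z. z \<notin> I \<longrightarrow> f z = d)} = (\<Prod>z\<in>I. card (B z))"
proof -
  have "bij_betw (\<lambda>f. restrict f I) {f. (\<forall>z\<in>I. f z \<in> B z) \<and> (\<forall>z. z \<notin> I \<longrightarrow> f z = d)} (PiE I B)"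
    by (rule bij_betw_byWitness[where f' = "\<lambda>g z. if z \<in> I then g z else d"])
      (auto simp: fun_eq_iff PiE_def extensional_def split: if_splits)
  then show ?thesis using card_PiE[OF assms] by (simp add: bij_betw_same_card)
qed

text \<open>Folner sets of the wreath product: all lamps are extinguished outside a long interval, the lamps
  inside take values in a Folner set of \<open>G\<close>, and the position is in the interval. Multiplication by a
  bounded element only touches boundedly many lamps, so that with the Folner set of \<open>G\<close> good enough
  in terms of this bound, most elements stay inside.\<close>

lemma (in iter_group) folner_wr:
  assumes "folner G"
  shows "folner (wr G)"
  unfolding folner_def
proof (intro allI impI)
  fix K and \<epsilon> :: real
  assume K: "finite K" "K \<subseteq> carrier (wr G)" and "\<epsilon> > 0"
  define far where "far = (\<Union>w\<in>K. {z. lamps w z \<noteq> \<one>} \<union> {y. \<exists>g. w = Wr g y})"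
  have "finite far"
    unfolding far_def
  proof (intro finite_UN_I finite_UnI K(1))
    fix w assume "w \<in> K"
    then have "w \<in> carrier (wr G)" using K(2) by auto
    then obtain g y where "w = Wr g y" "finite {z. g z \<noteq> \<one>}" by (elim wr_cases) blast
    then show "finite {z. lamps w z \<noteq> \<one>}" "finite {y. \<exists>g. w = Wr g y}" by auto
  qed
  then obtain r where r: "\<And>k. k \<in> far \<Longrightarrow> \<bar>k\<bar> \<le> int r"
    using finite_int_bounded by blast
  define KG where "KG = (\<lambda>(w, z). lamps w z) ` (K \<times> {- int r..int r})"
  have KG: "finite KG" "KG \<subseteq> carrier G"
    using K by (auto simp: KG_def carrier_wr subset_iff)
  define \<epsilon>' where "\<epsilon>' = \<epsilon> / (2 * (2 * r + 1))"
  have "\<epsilon>' > 0" using \<open>\<epsilon> > 0\<close> by (simp add: \<epsilon>'_def)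
  obtain FG where FG: "finite FG" "FG \<noteq> {}" "FG \<subseteq> carrier G"
    "card {x \<in> FG. \<exists>h\<in>KG. x \<otimes> h \<notin> FG} \<le> \<epsilon>' * card FG"
    using assms[unfolded folner_def, rule_format, OF KG \<open>\<epsilon>' > 0\<close>] by blast
  define bad where "bad = {x \<in> FG. \<exists>h\<in>KG. x \<otimes> h \<notin> FG}"
  obtain N0 :: nat where N0: "2 * r / \<epsilon> < N0" using reals_Archimedean2 by blast
  define N where "N = N0 + r"
  have N: "2 * r \<le> \<epsilon> / 2 * (2 * N + 1)" "r \<le> N"
  proof -
    have "2 * r < \<epsilon> * N0" using N0 \<open>\<epsilon> > 0\<close> by (simp add: field_simps)
    also have "\<dots> \<le> \<epsilon> / 2 * (2 * N + 1)" using \<open>\<epsilon> > 0\<close> by (simp add: N_def algebra_simps)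
    finally show "2 * r \<le> \<epsilon> / 2 * (2 * N + 1)" by simp
  qed (simp add: N_def)
  define I where "I = {- int N..int N}"
  have I: "finite I" "card I = 2 * N + 1" by (auto simp: I_def)
  define Fs where "Fs = {f. (\<forall>z\<in>I. f z \<in> FG) \<and> (\<forall>z. z \<notin> I \<longrightarrow> f z = \<one>)}"
  have cFs: "card Fs = card FG ^ card I"
    using card_functions_default[OF I(1), of "\<lambda>_. FG" \<one>] by (simp add: Fs_def)
  have "card FG > 0" using FG by (simp add: card_gt_0_iff)
  then have "card Fs > 0" by (simp add: cFs)
  then have Fs: "finite Fs" "Fs \<noteq> {}" using card_gt_0_iff by blast+
  define F where "F = (\<lambda>(f, x). Wr f x) ` (Fs \<times> I)"
  have cF: "card F = card Fs * (2 * N + 1)"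
    using I by (simp add: F_def card_image inj_on_Wr card_cartesian_product)
  have Fs_support: "finite {z. f z \<noteq> \<one>}" if "f \<in> Fs" for f
    by (rule finite_subset[OF _ I(1)]) (use that in \<open>auto simp: Fs_def\<close>)
  have Fs_closed: "f z \<in> carrier G" if "f \<in> Fs" for f z
    using that FG(3) by (cases "z \<in> I") (auto simp: Fs_def)
  have Fc: "F \<subseteq> carrier (wr G)" using Fs_support Fs_closed by (auto simp: F_def)
  \<comment> \<open>In \<open>B1\<close>, the position is close to an end of the interval; in \<open>B2\<close>, a lamp close to the position has a value close to the boundary of \<open>FG\<close>.\<close>
  define B1 where "B1 = Fs \<times> {x\<in>I. \<bar>x\<bar> > int N - int r}"
  define B2 where "B2 = (\<Union>x\<in>I. \<Union>z\<in>I \<inter> {x - int r..x + int r}. {f\<in>Fs. f z \<in> bad} \<times> {x})"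
  have sub: "{w \<in> F. \<exists>h\<in>K. w \<otimes>\<^bsub>wr G\<^esub> h \<notin> F} \<subseteq> (\<lambda>(f, x). Wr f x) ` (B1 \<union> B2)"
  proof
    fix w assume "w \<in> {w \<in> F. \<exists>h\<in>K. w \<otimes>\<^bsub>wr G\<^esub> h \<notin> F}"
    then obtain f x h where w: "w = Wr f x" "f \<in> Fs" "x \<in> I" "h \<in> K" "w \<otimes>\<^bsub>wr G\<^esub> h \<notin> F" "w \<in> F"
      by (auto simp: F_def)
    obtain g y where h: "h = Wr g y" using w(4) K(2) by (meson subsetD wr_cases)
    have gy: "\<bar>y\<bar> \<le> int r" "\<And>z. g z \<noteq> \<one> \<Longrightarrow> \<bar>z\<bar> \<le> int r" "Wr g y \<in> carrier (wr G)"
      using w(4) h K(2) by (auto intro!: r bexI[of _ "Wr g y"] simp: far_def)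
    have "(f, x) \<in> B1 \<union> B2"
    proof (rule ccontr)
      assume "(f, x) \<notin> B1 \<union> B2"
      then have x: "\<bar>x\<bar> \<le> int N - int r" and good: "\<And>z. z \<in> I \<Longrightarrow> \<bar>z - x\<bar> \<le> int r \<Longrightarrow> f z \<notin> bad"
        using w by (auto simp: B1_def B2_def abs_le_iff)
      have "w \<otimes>\<^bsub>wr G\<^esub> h = Wr (\<lambda>z. f z \<otimes> g (z - x)) (x + y)"
        unfolding w(1) h using w(1,6) Fc gy(3) by (intro wr_mult) auto
      moreover have "(\<lambda>z. f z \<otimes> g (z - x)) \<in> Fs"
      proof -
        have "f z \<otimes> g (z - x) \<in> FG" if z: "z \<in> I" for z
        proof (cases "\<bar>z - x\<bar> \<le> int r")
          case True
          then have "g (z - x) \<in> KG" using w(4) h by (force simp: KG_def)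
          moreover have "f z \<in> FG" "f z \<notin> bad" using good[OF z True] w(2) z by (auto simp: Fs_def)
          ultimately show ?thesis by (auto simp: bad_def)
        next
          case False
          then have "g (z - x) = \<one>" using gy(2) by blast
          then show ?thesis using w(2) z Fs_closed[OF w(2)] by (auto simp: Fs_def)
        qed
        moreover have "f z \<otimes> g (z - x) = \<one>" if z: "z \<notin> I" for z
        proof -
          have "\<not> \<bar>z - x\<bar> \<le> int r" using z x by (auto simp: I_def)
          then have "g (z - x) = \<one>" using gy(2) by blast
          then show ?thesis using w(2) z by (simp add: Fs_def)
        qed
        ultimately show ?thesis by (simp add: Fs_def)
      qed
      moreover have "x + y \<in> I" using x gy(1) by (auto simp: I_def)
      ultimately have "w \<otimes>\<^bsub>wr G\<^esub> h \<in> F" by (auto simp: F_def)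
      then show False using w by simp
    qed
    then show "w \<in> (\<lambda>(f, x). Wr f x) ` (B1 \<union> B2)" using w(1) by force
  qed
  have finB: "finite (B1 \<union> B2)" using Fs I by (auto simp: B1_def B2_def)
  have cB1: "card B1 \<le> card Fs * (2 * r)"
  proof -
    have "{x\<in>I. \<bar>x\<bar> > int N - int r} \<subseteq> {- int N..<- int N + int r} \<union> {int N - int r<..int N}"
      by (auto simp: I_def)
    then have "card {x\<in>I. \<bar>x\<bar> > int N - int r} \<le> card ({- int N..<- int N + int r} \<union> {int N - int r<..int N})"
      by (intro card_mono) auto
    also have "\<dots> \<le> card {- int N..<- int N + int r} + card {int N - int r<..int N}" by (rule card_Un_le)
    also have "\<dots> = 2 * r" by simp
    finally show ?thesis by (simp add: B1_def card_cartesian_product)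
  qed
  have one_bad: "card {f\<in>Fs. f z \<in> bad} \<le> \<epsilon>' * card Fs" if z: "z \<in> I" for z
  proof -
    have "{f\<in>Fs. f z \<in> bad} = {f. (\<forall>u\<in>I. f u \<in> (if u = z then bad else FG)) \<and> (\<forall>u. u \<notin> I \<longrightarrow> f u = \<one>)}"
      using z by (auto simp: Fs_def bad_def)
    then have "card {f\<in>Fs. f z \<in> bad} = (\<Prod>u\<in>I. card (if u = z then bad else FG))"
      using card_functions_default[OF I(1), of "\<lambda>u. if u = z then bad else FG" \<one>] by simp
    also have "\<dots> = card bad * card FG ^ card (I - {z})"
      using z I by (simp add: prod.remove)
    also have "real \<dots> \<le> \<epsilon>' * card FG * card FG ^ card (I - {z})"
      using FG(4) by (simp add: bad_def mult_right_mono)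
    also have "\<dots> = \<epsilon>' * card Fs"
      using z I by (simp add: cFs card.remove[OF I(1) z] del: card_Diff_insert)
    finally show ?thesis .
  qed
  have cB2: "card B2 \<le> \<epsilon> / 2 * (card Fs * (2 * N + 1))"
  proof -
    have "card B2 \<le> (\<Sum>x\<in>I. card (\<Union>z\<in>I \<inter> {x - int r..x + int r}. {f\<in>Fs. f z \<in> bad} \<times> {x}))"
      unfolding B2_def by (rule card_UN_le[OF I(1)])
    also have "\<dots> \<le> (\<Sum>x\<in>I. \<Sum>z\<in>I \<inter> {x - int r..x + int r}. card ({f\<in>Fs. f z \<in> bad} \<times> {x}))"
      by (intro sum_mono card_UN_le) (simp add: I)
    finally have "real (card B2) \<le> (\<Sum>x\<in>I. \<Sum>z\<in>I \<inter> {x - int r..x + int r}. real (card {f\<in>Fs. f z \<in> bad}))"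
      by (simp add: card_cartesian_product flip: of_nat_sum)
    also have "\<dots> \<le> (\<Sum>x\<in>I. \<Sum>z\<in>{x - int r..x + int r}. \<epsilon>' * card Fs)"
      using \<open>\<epsilon>' > 0\<close> by (intro sum_mono order.trans[OF sum_mono[OF one_bad] sum_mono2]) auto
    also have "\<dots> = (2 * N + 1) * ((2 * r + 1) * \<epsilon>') * card Fs"
      using I by simp
    also have "(2 * r + 1) * \<epsilon>' = \<epsilon> / 2"
    proof -
      have "m * (\<epsilon> / (2 * m)) = \<epsilon> / 2" if "m \<noteq> 0" for m :: real using that by simp
      from this[of "real (2 * r + 1)"] show ?thesis by (simp add: \<epsilon>'_def)
    qed
    finally show ?thesis by (simp add: algebra_simps)
  qed
  have "card {w \<in> F. \<exists>h\<in>K. w \<otimes>\<^bsub>wr G\<^esub> h \<notin> F} \<le> card ((\<lambda>(f, x). Wr f x) ` (B1 \<union> B2))"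
    using sub finB by (intro card_mono) auto
  also have "\<dots> \<le> card (B1 \<union> B2)" using finB by (intro card_image_le)
  also have "\<dots> \<le> card B1 + card B2" by (rule card_Un_le)
  finally have "real (card {w \<in> F. \<exists>h\<in>K. w \<otimes>\<^bsub>wr G\<^esub> h \<notin> F}) \<le> real (card B1) + real (card B2)" by linarith
  also have "\<dots> \<le> card Fs * (\<epsilon> / 2 * (2 * N + 1)) + \<epsilon> / 2 * (card Fs * (2 * N + 1))"
  proof (intro add_mono cB2)
    have "real (card B1) \<le> real (card Fs) * real (2 * r)" using cB1 by (metis of_nat_le_iff of_nat_mult)
    also have "\<dots> \<le> card Fs * (\<epsilon> / 2 * (2 * N + 1))"
      using N(1) by (intro mult_left_mono) auto
    finally show "real (card B1) \<le> card Fs * (\<epsilon> / 2 * (2 * N + 1))" .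
  qed
  also have "\<dots> = \<epsilon> * card F" by (simp add: cF algebra_simps)
  finally show "\<exists>F. finite F \<and> F \<noteq> {} \<and> F \<subseteq> carrier (wr G) \<and>
      card {x \<in> F. \<exists>h\<in>K. x \<otimes>\<^bsub>wr G\<^esub> h \<notin> F} \<le> \<epsilon> * card F"
    using Fc Fs I by (intro exI[of _ F]) (auto simp: F_def I_def)
qed

section \<open>Lengths in wreath products\<close>

primrec pos :: "iter_elem \<Rightarrow> int"
  where
    "pos (Base n) = n"
  | "pos (Wr f x) = x"

text \<open>Up to constants, this is the length of a tour of a lamplighter that visits all lamps and sets
  each of them at the cost \<open>\<rho>\<close>, if \<open>\<rho>\<close> is such a length on \<open>G\<close>.\<close>

definition tour :: "iter_elem monoid \<Rightarrow> (iter_elem \<Rightarrow> real) \<Rightarrow> iter_elem \<Rightarrow> real"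
  where "tour G \<rho> w = \<bar>real_of_int (pos w)\<bar> + real (Max (insert 0 ((\<lambda>z. nat \<bar>z\<bar>) ` {z. lamps w z \<noteq> \<one>\<^bsub>G\<^esub>})))
    + lamp_sum G \<rho> w"

text \<open>Comparison with all lengths at once makes the notion independent of generating sets.\<close>

definition dominates :: "iter_elem monoid \<Rightarrow> (iter_elem \<Rightarrow> real) \<Rightarrow> bool"
  where "dominates G \<rho> \<longleftrightarrow> \<rho> \<one>\<^bsub>G\<^esub> = 0 \<and> (\<forall>x\<in>carrier G. x \<noteq> \<one>\<^bsub>G\<^esub> \<longrightarrow> 1 \<le> \<rho> x) \<and>
    (\<forall>N. group_length G N \<longrightarrow> (\<exists>C. \<forall>x\<in>carrier G. N x \<le> C * \<rho> x))"

lemma subadditive_shift_bound: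
  assumes "group H" "group_length H N" "\<And>x. h x \<in> carrier H" "\<And>x y. h x \<otimes>\<^bsub>H\<^esub> h y = h (x + y)"
    and "h 0 = \<one>\<^bsub>H\<^esub>" "N (h 1) \<le> s" "N (h (- 1)) \<le> s"
  shows "N (h x) \<le> s * \<bar>real_of_int x\<bar>"
proof -
  have N: "\<And>x y. x \<in> carrier H \<Longrightarrow> y \<in> carrier H \<Longrightarrow> N (x \<otimes>\<^bsub>H\<^esub> y) \<le> N x + N y" "N \<one>\<^bsub>H\<^esub> = 0"
    using assms(2) by (auto simp: group_length_def)
  have "N (h (int n * e)) \<le> s * real n" if "N (h e) \<le> s" for n and e :: int
  proof (induction n)
    case (Suc n)
    have "N (h (int n * e + e)) \<le> N (h (int n * e)) + N (h e)"
      using N(1)[OF assms(3,3), of "int n * e" e] by (simp add: assms(4))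
    then show ?case using Suc that by (simp add: algebra_simps)
  qed (simp add: assms(5) N)
  from this[OF assms(6), of "nat x"] this[OF assms(7), of "nat (- x)"] show ?thesis
    by (cases "x \<ge> 0") auto
qed

lemma dominates_int: "dominates int_copy int_abs"
  unfolding dominates_def
proof (intro conjI allI impI)
  fix N assume N: "group_length int_copy N"
  define s where "s = max (N (Base 1)) (N (Base (- 1)))"
  have "N (Base x) \<le> s * \<bar>real_of_int x\<bar>" for x
    by (rule subadditive_shift_bound[OF group_int_copy N])
      (auto simp: carrier_int_copy int_copy_mult int_copy_one s_def)
  then show "\<exists>C. \<forall>x\<in>carrier int_copy. N x \<le> C * int_abs x"
    by (auto simp: carrier_int_copy)
qed (auto simp: int_copy_one carrier_int_copy)

context iter_group
begin

lemma lamp_mult: "a \<in> carrier G \<Longrightarrow> b \<in> carrier G \<Longrightarrow> lamp G a \<otimes>\<^bsub>wr G\<^esub> lamp G b = lamp G (a \<otimes> b)"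
proof -
  assume a: "a \<in> carrier G" and b: "b \<in> carrier G"
  have "Wr (\<lambda>z. if z = 0 then a else \<one>) 0 \<otimes>\<^bsub>wr G\<^esub> lamp G b = lamp G (a \<otimes> b)"
    using lamp_closed[OF a] b by (subst mult_lamp) (auto simp: lamp_def fun_eq_iff)
  then show ?thesis by (simp only: lamp_def[of G a])
qed

lemma lamp_one: "lamp G \<one> = \<one>\<^bsub>wr G\<^esub>"
  by (simp add: lamp_def wr_one)

lemma shift_mult: "shift G d \<otimes>\<^bsub>wr G\<^esub> shift G e = shift G (d + e)"
  using mult_shift[of "\<lambda>_. \<one>" d e] by (simp add: shift_def)

lemma shift_zero: "shift G 0 = \<one>\<^bsub>wr G\<^esub>"
  by (simp add: shift_def wr_one)

text \<open>Sweeping once over the support from left to right.\<close>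

lemma subadditive_le_tour:
  assumes N: "group_length (wr G) N" and \<rho>: "\<rho> \<one> = 0" "\<And>x. x \<in> carrier G \<Longrightarrow> x \<noteq> \<one> \<Longrightarrow> 1 \<le> \<rho> x"
    and C: "C \<ge> 0" "\<And>a. a \<in> carrier G \<Longrightarrow> N (lamp G a) \<le> C * \<rho> a"
    and s: "s \<ge> 0" "N (shift G 1) \<le> s" "N (shift G (- 1)) \<le> s"
    and w: "w \<in> carrier (wr G)"
  shows "N w \<le> (6 * s + C) * tour G \<rho> w"
proof -
  have N1: "N \<one>\<^bsub>wr G\<^esub> = 0" and Nmult: "\<And>x y. x \<in> carrier (wr G) \<Longrightarrow> y \<in> carrier (wr G) \<Longrightarrow>
    N (x \<otimes>\<^bsub>wr G\<^esub> y) \<le> N x + N y"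
    using N by (auto simp: group_length_def)
  have shift: "N (shift G x) \<le> s * \<bar>real_of_int x\<bar>" for x
    using subadditive_shift_bound[of "wr G" N "shift G" s x] N s shift_mult shift_zero W.is_group by auto
  have sweep: "N (Wr f (int n)) \<le> s * n + C * (\<Sum>z\<in>{0..<int n}. \<rho> (f z))"
    if "\<And>z. f z \<in> carrier G" "\<And>z. z \<notin> {0..<int n} \<Longrightarrow> f z = \<one>" for n f
    using that
  proof (induction n arbitrary: f)
    case 0
    then have "f = (\<lambda>_. \<one>)" by auto
    then show ?case using N1 by (simp add: wr_one)
  next
    case (Suc n)
    define f' where "f' = f(int n := \<one>)"
    have f': "\<And>z. f' z \<in> carrier G" "\<And>z. z \<notin> {0..<int n} \<Longrightarrow> f' z = \<one>"
      using Suc.prems by (auto simp: f'_def)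
    have "finite {z. f' z \<noteq> \<one>}"
    proof (rule finite_subset)
      show "{z. f' z \<noteq> \<one>} \<subseteq> {0..<int n}" using f'(2) by blast
    qed simp
    then have w': "Wr f' (int n) \<in> carrier (wr G)" using f' by simp
    have fn: "f (int n) \<in> carrier G" using Suc.prems by simp
    have eq: "(Wr f' (int n) \<otimes>\<^bsub>wr G\<^esub> lamp G (f (int n))) \<otimes>\<^bsub>wr G\<^esub> shift G 1 = Wr f (int (Suc n))"
    proof -
      have "Wr f' (int n) \<otimes>\<^bsub>wr G\<^esub> lamp G (f (int n)) = Wr f (int n)"
        using mult_lamp[OF w' fn] fn by (simp add: f'_def)
      moreover from this have "Wr f (int n) \<in> carrier (wr G)"
        using W.m_closed[OF w' lamp_closed[OF fn]] by simp
      ultimately show ?thesis using mult_shift[of f "int n" 1] by (simp add: add.commute)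
    qed
    have "N (Wr f (int (Suc n))) \<le> N (Wr f' (int n)) + N (lamp G (f (int n))) + N (shift G 1)"
      unfolding eq[symmetric]
      using Nmult[OF W.m_closed[OF w' lamp_closed[OF fn]] shift_closed[of 1]] Nmult[OF w' lamp_closed[OF fn]] by linarith
    also have "\<dots> \<le> (s * n + C * (\<Sum>z\<in>{0..<int n}. \<rho> (f' z))) + C * \<rho> (f (int n)) + s"
      by (intro add_mono Suc.IH f' C fn s)
    also have "(\<Sum>z\<in>{0..<int n}. \<rho> (f' z)) = (\<Sum>z\<in>{0..<int n}. \<rho> (f z))"
      by (intro sum.cong) (auto simp: f'_def)
    also have "{0..<int (Suc n)} = insert (int n) {0..<int n}" by auto
    then have "(\<Sum>z\<in>{0..<int n}. \<rho> (f z)) = (\<Sum>z\<in>{0..<int (Suc n)}. \<rho> (f z)) - \<rho> (f (int n))" by simp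
    finally show ?case by (simp add: algebra_simps)
  qed
  obtain f x where w_eq: "w = Wr f x" and f: "\<And>z. f z \<in> carrier G" "finite {z. f z \<noteq> \<one>}"
    using w by (elim wr_cases) blast
  define A where "A = {z. f z \<noteq> \<one>}"
  define m where "m = Max (insert 0 ((\<lambda>z. nat \<bar>z\<bar>) ` A))"
  have m: "\<bar>z\<bar> \<le> int m" if "f z \<noteq> \<one>" for z
  proof -
    have "nat \<bar>z\<bar> \<le> m" unfolding m_def using that f(2) by (intro Max_ge) (auto simp: A_def)
    then show ?thesis by linarith
  qed
  have tour: "tour G \<rho> w = \<bar>real_of_int x\<bar> + m + lamp_sum G \<rho> w"
    by (simp add: tour_def w_eq m_def A_def)
  show ?thesis
  proof (cases "A = {}")
    case True
    then have "f = (\<lambda>_. \<one>)" by (auto simp: A_def)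
    then have "N w \<le> s * \<bar>real_of_int x\<bar>" using shift[of x] by (simp add: w_eq shift_def)
    also have "\<dots> \<le> (6 * s + C) * \<bar>real_of_int x\<bar>" using s C by (intro mult_right_mono) auto
    also have "\<bar>real_of_int x\<bar> = tour G \<rho> w"
      using True unfolding tour by (simp add: m_def lamp_sum_def w_eq A_def)
    finally show ?thesis .
  next
    case False
    have Lsum: "lamp_sum G \<rho> w = (\<Sum>z\<in>A. \<rho> (f z))" by (simp add: lamp_sum_def w_eq A_def)
    also have "\<dots> \<ge> (\<Sum>z\<in>A. 1)" using \<rho> f by (intro sum_mono) (auto simp: A_def)
    finally have "real (card A) \<le> lamp_sum G \<rho> w" by simp
    moreover have "1 \<le> card A" using False f(2) by (simp add: A_def card_gt_0_iff Suc_le_eq)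
    ultimately have L1: "1 \<le> lamp_sum G \<rho> w" by linarith
    \<comment> \<open>The walk starts at the left end of the support, and ends by moving from its right end to \<open>x\<close>.\<close>
    define g where "g = (\<lambda>z. f (z - int m))"
    have g: "\<And>z. g z \<in> carrier G" "\<And>z. z \<notin> {0..<int (2 * m + 1)} \<Longrightarrow> g z = \<one>"
    proof -
      fix z assume "z \<notin> {0..<int (2 * m + 1)}"
      then have "\<not> \<bar>z - int m\<bar> \<le> int m" by auto
      then show "g z = \<one>" using m[of "z - int m"] by (auto simp: g_def)
    qed (use f in \<open>auto simp: g_def\<close>)
    have "finite {z. g z \<noteq> \<one>}"
    proof (rule finite_subset)
      show "{z. g z \<noteq> \<one>} \<subseteq> {0..<int (2 * m + 1)}" using g(2) by blast
    qed simp
    then have wg: "Wr g (int (2 * m + 1)) \<in> carrier (wr G)" using g by simp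
    have eq: "w = (shift G (- int m) \<otimes>\<^bsub>wr G\<^esub> Wr g (int (2 * m + 1))) \<otimes>\<^bsub>wr G\<^esub> shift G (x - int m - 1)"
    proof -
      have "shift G (- int m) \<otimes>\<^bsub>wr G\<^esub> Wr g (int (2 * m + 1)) = Wr f (int m + 1)"
        using wg shift_closed[of "- int m"] f unfolding shift_def
        by (subst wr_mult) (auto simp: g_def)
      moreover have "Wr f (int m + 1) \<in> carrier (wr G)" using f by simp
      ultimately show ?thesis using mult_shift[of f "int m + 1" "x - int m - 1"] by (simp add: w_eq)
    qed
    have "N w \<le> N (shift G (- int m)) + N (Wr g (int (2 * m + 1))) + N (shift G (x - int m - 1))"
      unfolding eq using Nmult[OF W.m_closed[OF shift_closed wg] shift_closed] Nmult[OF shift_closed wg]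
      by (smt (verit, best))
    also have "\<dots> \<le> s * m + (s * (2 * m + 1) + C * lamp_sum G \<rho> w) + s * (\<bar>real_of_int x\<bar> + m + 1)"
    proof (intro add_mono)
      show "N (shift G (- int m)) \<le> s * m" using shift[of "- int m"] by simp
      have "(\<Sum>z\<in>{0..<int (2 * m + 1)}. \<rho> (g z)) = (\<Sum>z\<in>(\<lambda>z. z - int m) ` {0..<int (2 * m + 1)}. \<rho> (f z))"
        by (subst sum.reindex) (auto simp: inj_on_def g_def)
      also have "\<dots> = lamp_sum G \<rho> w"
      proof -
        have "z \<in> (\<lambda>z. z - int m) ` {0..<int (2 * m + 1)}" if "f z \<noteq> \<one>" for z
          using m[OF that] by (intro image_eqI[of _ _ "z + int m"]) auto
        then show ?thesis unfolding w_eq using \<rho>(1) by (intro lamp_sum_eq[symmetric]) auto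
      qed
      finally have sums: "(\<Sum>z\<in>{0..<int (2 * m + 1)}. \<rho> (g z)) = lamp_sum G \<rho> w" .
      have "N (Wr g (int (2 * m + 1))) \<le> s * real (2 * m + 1) + C * (\<Sum>z\<in>{0..<int (2 * m + 1)}. \<rho> (g z))"
        by (rule sweep) (use g in blast)+
      then show "N (Wr g (int (2 * m + 1))) \<le> s * (2 * m + 1) + C * lamp_sum G \<rho> w"
        unfolding sums .
      have "N (shift G (x - int m - 1)) \<le> s * \<bar>real_of_int (x - int m - 1)\<bar>" by (rule shift)
      also have "\<dots> \<le> s * (\<bar>real_of_int x\<bar> + m + 1)" using s by (intro mult_left_mono) auto
      finally show "N (shift G (x - int m - 1)) \<le> s * (\<bar>real_of_int x\<bar> + m + 1)" .
    qed
    also have "\<dots> = s * (\<bar>real_of_int x\<bar> + 4 * m + 2) + C * lamp_sum G \<rho> w" by (simp add: algebra_simps)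
    also have "\<dots> \<le> s * (6 * tour G \<rho> w) + C * tour G \<rho> w"
      using L1 s C unfolding tour by (intro add_mono mult_left_mono) auto
    finally show ?thesis by (simp add: algebra_simps)
  qed
qed

lemma tour_ge_1:
  assumes \<rho>: "\<rho> \<one> = 0" "\<And>x. x \<in> carrier G \<Longrightarrow> x \<noteq> \<one> \<Longrightarrow> 1 \<le> \<rho> x"
    and w: "w \<in> carrier (wr G)" "w \<noteq> \<one>\<^bsub>wr G\<^esub>"
  shows "1 \<le> tour G \<rho> w"
proof -
  obtain f x where w_eq: "w = Wr f x" and f: "\<And>z. f z \<in> carrier G" "finite {z. f z \<noteq> \<one>}"
    using w by (elim wr_cases) blast
  have L: "lamp_sum G \<rho> w \<ge> (\<Sum>z | f z \<noteq> \<one>. 1)"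
    unfolding lamp_sum_def w_eq lamps.simps using \<rho> f by (intro sum_mono) auto
  show ?thesis
  proof (cases "{z. f z \<noteq> \<one>} = {}")
    case True
    then have "f = (\<lambda>_. \<one>)" by auto
    then have "x \<noteq> 0" using w(2) by (auto simp: w_eq wr_one)
    then show ?thesis using L True by (simp add: tour_def w_eq)
  next
    case False
    then have "1 \<le> card {z. f z \<noteq> \<one>}" using f(2) by (simp add: card_gt_0_iff Suc_le_eq)
    moreover have "real (card {z. f z \<noteq> \<one>}) \<le> lamp_sum G \<rho> w" using L by simp
    ultimately have "1 \<le> lamp_sum G \<rho> w" by linarith
    then show ?thesis by (simp add: tour_def)
  qed
qed

lemma dominates_tour:
  assumes "dominates G \<rho>"
  shows "dominates (wr G) (tour G \<rho>)"
proof -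
  have \<rho>: "\<rho> \<one> = 0" "\<And>x. x \<in> carrier G \<Longrightarrow> x \<noteq> \<one> \<Longrightarrow> 1 \<le> \<rho> x"
    and dom: "\<And>N. group_length G N \<Longrightarrow> \<exists>C. \<forall>x\<in>carrier G. N x \<le> C * \<rho> x"
    using assms by (auto simp: dominates_def)
  have \<rho>0: "0 \<le> \<rho> x" if "x \<in> carrier G" for x
    using \<rho>(1) \<rho>(2)[OF that] by (cases "x = \<one>") auto
  have "\<exists>C. \<forall>x\<in>carrier (wr G). N x \<le> C * tour G \<rho> x" if N: "group_length (wr G) N" for N
  proof -
    have "group_length G (\<lambda>a. N (lamp G a))"
      using N unfolding group_length_def lamp_one by (auto simp flip: lamp_mult)
    then obtain C0 where C0: "\<And>a. a \<in> carrier G \<Longrightarrow> N (lamp G a) \<le> C0 * \<rho> a" using dom by blast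
    define C where "C = max 0 C0"
    have C: "N (lamp G a) \<le> C * \<rho> a" if "a \<in> carrier G" for a
      using C0[OF that] mult_right_mono[OF _ \<rho>0[OF that], of C0 C] by (simp add: C_def)
    define s where "s = max (N (shift G 1)) (N (shift G (- 1)))"
    have s: "s \<ge> 0" using N by (auto simp: group_length_def s_def le_max_iff_disj)
    show ?thesis
      using subadditive_le_tour[OF N \<rho> _ C s] by (auto simp: C_def s_def)
  qed
  moreover have "tour G \<rho> \<one>\<^bsub>wr G\<^esub> = 0" by (simp add: tour_def wr_one lamp_sum_def)
  ultimately show ?thesis using tour_ge_1[of \<rho>] \<rho> by (auto simp: dominates_def)
qed

text \<open>A set closed under multiplication is the zero set of a subadditive function, namely of the
  indicator function of its complement. So the previous bound also shows that the lamps and the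
  two unit shifts generate the wreath product.\<close>

lemma wr_generated:
  assumes "P \<one>\<^bsub>wr G\<^esub>" "\<And>a. a \<in> carrier G \<Longrightarrow> P (lamp G a)" "P (shift G 1)" "P (shift G (- 1))"
    and "\<And>v w. v \<in> carrier (wr G) \<Longrightarrow> w \<in> carrier (wr G) \<Longrightarrow> P v \<Longrightarrow> P w \<Longrightarrow> P (v \<otimes>\<^bsub>wr G\<^esub> w)"
    and "w \<in> carrier (wr G)"
  shows "P w"
proof -
  have "of_bool (\<not> P w) \<le> (6 * 0 + 0) * tour G (\<lambda>a. of_bool (a \<noteq> \<one>)) w"
  proof (rule subadditive_le_tour)
    show "group_length (wr G) (\<lambda>w. of_bool (\<not> P w))"
      using assms by (auto simp: group_length_def)
  qed (use assms in auto)
  then show ?thesis by (cases "P w") auto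
qed

end

section \<open>Embeddings of wreath products\<close>

text \<open>One index type serves all levels: \<open>Lamp z\<close> tags the coordinates of the embedding of the lamp
  group at \<open>z\<close>.\<close>

datatype idx = Pos | Tail bool int "int \<Rightarrow> iter_elem" | Lamp int idx

definition sqdist :: "('i \<Rightarrow> real) \<Rightarrow> ('i \<Rightarrow> real) \<Rightarrow> real"
  where "sqdist u v = (\<Sum>i | u i \<noteq> v i. (u i - v i)\<^sup>2)"

lemma sqdist_eq:
  assumes "finite A" "{i. u i \<noteq> v i} \<subseteq> A"
  shows "sqdist u v = (\<Sum>i\<in>A. (u i - v i)\<^sup>2)"
  unfolding sqdist_def using assms by (intro sum.mono_neutral_left) auto

lemma sqdist_same [simp]: "sqdist u u = 0"
  by (simp add: sqdist_def)

lemma sqdist_commute: "sqdist u v = sqdist v u"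
  unfolding sqdist_def by (intro sum.cong) (auto simp: power2_commute)

lemma sqdist_nonneg: "0 \<le> sqdist u v"
  by (simp add: sqdist_def sum_nonneg)

lemma sqdist_ge:
  assumes "finite {i. u i \<noteq> v i}" "finite A"
  shows "(\<Sum>i\<in>A. (u i - v i)\<^sup>2) \<le> sqdist u v"
proof -
  have "(\<Sum>i\<in>A. (u i - v i)\<^sup>2) \<le> (\<Sum>i\<in>A \<union> {i. u i \<noteq> v i}. (u i - v i)\<^sup>2)"
    using assms by (intro sum_mono2) auto
  also have "\<dots> = sqdist u v" using assms by (intro sqdist_eq[symmetric]) auto
  finally show ?thesis .
qed

lemma finite_diff_support:
  assumes "finite {i. u i \<noteq> 0}" "finite {i. v i \<noteq> (0::real)}"
  shows "finite {i. u i \<noteq> v i}"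
  by (rule finite_subset[OF _ finite_UnI[OF assms]]) auto

lemma sqdist_triangle:
  assumes "finite {i. u i \<noteq> 0}" "finite {i. v i \<noteq> 0}" "finite {i. w i \<noteq> 0}"
  shows "sqdist u w \<le> 2 * sqdist u v + 2 * sqdist v w"
proof -
  define A where "A = {i. u i \<noteq> 0} \<union> {i. v i \<noteq> 0} \<union> {i. w i \<noteq> 0}"
  have A: "finite A" using assms by (simp add: A_def)
  have "sqdist u w = (\<Sum>i\<in>A. (u i - w i)\<^sup>2)" by (intro sqdist_eq A) (auto simp: A_def)
  also have "\<dots> \<le> (\<Sum>i\<in>A. 2 * (u i - v i)\<^sup>2 + 2 * (v i - w i)\<^sup>2)"
  proof (intro sum_mono)
    fix i
    have "0 \<le> ((u i - v i) - (v i - w i))\<^sup>2" by simp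
    then show "(u i - w i)\<^sup>2 \<le> 2 * (u i - v i)\<^sup>2 + 2 * (v i - w i)\<^sup>2"
      by (simp add: power2_eq_square algebra_simps)
  qed
  also have "\<dots> = 2 * (\<Sum>i\<in>A. (u i - v i)\<^sup>2) + 2 * (\<Sum>i\<in>A. (v i - w i)\<^sup>2)"
    by (simp add: sum.distrib sum_distrib_left)
  also have "(\<Sum>i\<in>A. (u i - v i)\<^sup>2) = sqdist u v" by (intro sqdist_eq[symmetric] A) (auto simp: A_def)
  also have "(\<Sum>i\<in>A. (v i - w i)\<^sup>2) = sqdist v w" by (intro sqdist_eq[symmetric] A) (auto simp: A_def)
  finally show ?thesis .
qed

lemma sqdist_idx:
  assumes fin: "finite {i. u i \<noteq> v i}" and A: "finite A" "\<And>z j. u (Lamp z j) \<noteq> v (Lamp z j) \<Longrightarrow> z \<in> A"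
  shows "sqdist u v = (u Pos - v Pos)\<^sup>2 +
    (sqdist (\<lambda>(k, \<tau>). u (Tail True k \<tau>)) (\<lambda>(k, \<tau>). v (Tail True k \<tau>)) +
     sqdist (\<lambda>(k, \<tau>). u (Tail False k \<tau>)) (\<lambda>(k, \<tau>). v (Tail False k \<tau>))) +
    (\<Sum>z\<in>A. sqdist (\<lambda>j. u (Lamp z j)) (\<lambda>j. v (Lamp z j)))"
proof -
  let ?g = "\<lambda>i. (u i - v i)\<^sup>2"
  define DT where "DT = (\<lambda>b. {x. (case x of (k, \<tau>) \<Rightarrow> u (Tail b k \<tau>)) \<noteq> (case x of (k, \<tau>) \<Rightarrow> v (Tail b k \<tau>))})"
  define DL where "DL = (\<lambda>z. {j. u (Lamp z j) \<noteq> v (Lamp z j)})"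
  have finT: "finite (DT b)" for b
  proof -
    have "DT b = (\<lambda>(k, \<tau>). Tail b k \<tau>) -` {i. u i \<noteq> v i}" by (auto simp: DT_def)
    moreover have "inj (\<lambda>(k, \<tau>). Tail b k \<tau>)" by (auto simp: inj_def)
    ultimately show ?thesis using finite_vimageI[OF fin] by metis
  qed
  have finL: "finite (DL z)" for z
  proof -
    have "DL z = Lamp z -` {i. u i \<noteq> v i}" by (auto simp: DL_def)
    moreover have "inj (Lamp z)" by (auto simp: inj_def)
    ultimately show ?thesis using finite_vimageI[OF fin] by metis
  qed
  define T where "T = (\<lambda>b. (\<lambda>(k, \<tau>). Tail b k \<tau>) ` DT b)"
  define L where "L = (\<Union>z\<in>A. Lamp z ` DL z)"
  have finTL: "finite (T b)" "finite L" for b using finT finL A by (auto simp: T_def L_def)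
  have sT: "sum ?g (T b) = sqdist (\<lambda>(k, \<tau>). u (Tail b k \<tau>)) (\<lambda>(k, \<tau>). v (Tail b k \<tau>))" for b
    unfolding T_def by (subst sum.reindex) (auto simp: inj_on_def DT_def sqdist_def intro!: sum.cong)
  have sL: "sum ?g L = (\<Sum>z\<in>A. sqdist (\<lambda>j. u (Lamp z j)) (\<lambda>j. v (Lamp z j)))"
    unfolding L_def using A finL
    by (subst sum.UNION_disjoint)
      (auto simp: sum.reindex inj_on_def DL_def sqdist_def intro!: sum.cong)
  have "{i. u i \<noteq> v i} \<subseteq> {Pos} \<union> ((T True \<union> T False) \<union> L)"
  proof
    fix i assume i: "i \<in> {i. u i \<noteq> v i}"
    show "i \<in> {Pos} \<union> ((T True \<union> T False) \<union> L)"
    proof (cases i)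
      case (Tail b k \<tau>)
      then have "i \<in> T b" using i by (force simp: T_def DT_def)
      then show ?thesis by (cases b) auto
    next
      case (Lamp z j)
      then show ?thesis using i A by (auto simp: L_def DL_def)
    qed simp
  qed
  then have "sqdist u v = sum ?g ({Pos} \<union> ((T True \<union> T False) \<union> L))"
    using finTL by (intro sqdist_eq) auto
  also have "\<dots> = sum ?g {Pos} + (sum ?g (T True \<union> T False) + sum ?g L)"
    using finTL by (subst sum.union_disjoint; (subst sum.union_disjoint)?) (auto simp: T_def L_def)
  also have "sum ?g (T True \<union> T False) = sum ?g (T True) + sum ?g (T False)"
    using finTL by (intro sum.union_disjoint) (auto simp: T_def)
  finally show ?thesis by (simp add: sT sL)
qed

definition weight :: "real \<Rightarrow> int \<Rightarrow> real"
  where "weight s j = (if j > 0 then real_of_int j powr s else 0)"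

text \<open>The coordinates record the tails \<open>f\<close> restricted to \<open>{k..}\<close>, seen from the position \<open>p\<close> with a
  weight that grows with the distance. Only switching a lamp at or beyond \<open>k\<close> affects the tail at \<open>k\<close>,
  so that a lamp at \<open>p\<close> affects only tails of weight 0. A difference of two configurations at a distance
  \<open>n\<close> is seen in \<open>n\<close> tails.\<close>

definition tails :: "iter_elem monoid \<Rightarrow> real \<Rightarrow> (int \<Rightarrow> iter_elem) \<Rightarrow> int \<Rightarrow> int \<times> (int \<Rightarrow> iter_elem) \<Rightarrow> real"
  where "tails G s f p = (\<lambda>(k, \<tau>).
    if \<tau> = (\<lambda>z. if k \<le> z then f z else \<one>\<^bsub>G\<^esub>) \<and> (\<exists>z\<ge>k. f z \<noteq> \<one>\<^bsub>G\<^esub>) then weight s (k - p) else 0)"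

lemma finite_tails:
  assumes "finite {z. f z \<noteq> \<one>\<^bsub>G\<^esub>}"
  shows "finite {i. tails G s f p i \<noteq> 0}"
proof (rule finite_subset)
  show "{i. tails G s f p i \<noteq> 0} \<subseteq>
    (\<Union>z\<in>{z. f z \<noteq> \<one>\<^bsub>G\<^esub>}. (\<lambda>k. (k, \<lambda>z. if k \<le> z then f z else \<one>\<^bsub>G\<^esub>)) ` {p<..z})"
    by (auto simp: tails_def weight_def image_iff split: if_splits)
qed (use assms in auto)

lemma tails_switch: "tails G s (f(p := a)) p = tails G s f p"
proof
  fix i :: "int \<times> (int \<Rightarrow> iter_elem)"
  obtain k \<tau> where i: "i = (k, \<tau>)" by (cases i)
  show "tails G s (f(p := a)) p i = tails G s f p i"
  proof (cases "k \<le> p")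
    case True
    then show ?thesis by (simp add: i tails_def weight_def)
  next
    case False
    then have "(\<lambda>z. if k \<le> z then (f(p := a)) z else \<one>\<^bsub>G\<^esub>) = (\<lambda>z. if k \<le> z then f z else \<one>\<^bsub>G\<^esub>)"
      "(\<exists>z\<ge>k. (f(p := a)) z \<noteq> \<one>\<^bsub>G\<^esub>) \<longleftrightarrow> (\<exists>z\<ge>k. f z \<noteq> \<one>\<^bsub>G\<^esub>)"
      by (auto simp: fun_eq_iff)
    then show ?thesis by (simp only: i tails_def prod.case)
  qed
qed

text \<open>For \<open>s < 1 / 2\<close>, the increments \<open>j powr (s - 1)\<close> of the weight are square-summable. This is what
  makes a move of the lamplighter cheap.\<close>

lemma weight_increments:
  assumes "0 < s" "s < 1 / 2"
  shows "\<exists>K. \<forall>B. finite B \<longrightarrow> (\<Sum>j\<in>B. (weight s (j + 1) - weight s j)\<^sup>2) \<le> K"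
proof -
  define h where "h = (\<lambda>n. of_bool (n = 0) + real n powr (2 * s - 2))"
  have "summable (\<lambda>n. real n powr (2 * s - 2))"
    using assms by (simp add: summable_real_powr_iff)
  moreover have "summable (\<lambda>n. of_bool (n = 0) :: real)"
    by (rule summable_finite[of "{0::nat}"]) auto
  ultimately have h: "summable h" unfolding h_def by (intro summable_add)
  have bound: "(weight s (int n + 1) - weight s (int n))\<^sup>2 \<le> h n" for n
  proof (cases "n = 0")
    case False
    have 1: "(1 + 1 / real n) powr s \<le> (1 + 1 / real n) powr 1"
      using assms by (intro powr_mono) auto
    have "real n + 1 = real n * (1 + 1 / real n)" using False by (simp add: field_simps)
    then have "(real n + 1) powr s = real n powr s * (1 + 1 / real n) powr s"
      by (simp add: powr_mult)
    also have "\<dots> \<le> real n powr s * (1 + 1 / real n)"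
      using 1 by (intro mult_left_mono) (auto simp: powr_one)
    also have "\<dots> = real n powr s + real n powr (s - 1)"
      using False by (simp add: powr_diff distrib_left)
    finally have "weight s (int n + 1) - weight s (int n) \<le> real n powr (s - 1)"
      using False by (simp add: weight_def)
    moreover have "0 \<le> weight s (int n + 1) - weight s (int n)"
      using False assms by (simp add: weight_def powr_mono2)
    ultimately have "(weight s (int n + 1) - weight s (int n))\<^sup>2 \<le> (real n powr (s - 1))\<^sup>2"
      by (intro power_mono) auto
    also have "\<dots> = real n powr (2 * s - 2)"
      by (simp add: power2_eq_square flip: powr_add)
    finally show ?thesis using False by (simp add: h_def)
  qed (simp add: weight_def h_def)
  have "(\<Sum>j\<in>B. (weight s (j + 1) - weight s j)\<^sup>2) \<le> suminf h" if B: "finite B" for B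
  proof -
    have "(\<Sum>j\<in>B. (weight s (j + 1) - weight s j)\<^sup>2) = (\<Sum>j\<in>B \<inter> {0..}. (weight s (j + 1) - weight s j)\<^sup>2)"
      using B by (intro sum.mono_neutral_right) (auto simp: weight_def)
    also have "\<dots> = (\<Sum>n\<in>nat ` (B \<inter> {0..}). (weight s (int n + 1) - weight s (int n))\<^sup>2)"
      by (subst sum.reindex) (auto simp: inj_on_def)
    also have "\<dots> \<le> (\<Sum>n\<in>nat ` (B \<inter> {0..}). h n)" by (intro sum_mono bound)
    also have "\<dots> \<le> suminf h" using B by (intro sum_le_suminf h) (auto simp: h_def)
    finally show ?thesis .
  qed
  then show ?thesis by blast
qed

lemma sqdist_tails_shift:
  assumes "finite {z. f z \<noteq> \<one>\<^bsub>G\<^esub>}"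
    and K: "\<And>B. finite B \<Longrightarrow> (\<Sum>j\<in>B. (weight s (j + 1) - weight s j)\<^sup>2) \<le> K"
  shows "sqdist (tails G s f (p + 1)) (tails G s f p) \<le> K"
proof -
  define D where "D = {i. tails G s f (p + 1) i \<noteq> tails G s f p i}"
  have D: "finite D"
    unfolding D_def by (rule finite_diff_support[OF finite_tails[OF assms(1)] finite_tails[OF assms(1)]])
  have val: "snd i = (\<lambda>z. if fst i \<le> z then f z else \<one>\<^bsub>G\<^esub>)"
    "(tails G s f (p + 1) i - tails G s f p i)\<^sup>2 = (weight s ((fst i - p - 1) + 1) - weight s (fst i - p - 1))\<^sup>2"
    if "i \<in> D" for i
    using that by (auto simp: D_def tails_def algebra_simps power2_commute split: prod.splits if_splits)
  have "sqdist (tails G s f (p + 1)) (tails G s f p) =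
    (\<Sum>i\<in>D. (weight s ((fst i - p - 1) + 1) - weight s (fst i - p - 1))\<^sup>2)"
    unfolding sqdist_def D_def[symmetric] using val(2) by (rule sum.cong[OF refl])
  also have "\<dots> = (\<Sum>j\<in>(\<lambda>i. fst i - p - 1) ` D. (weight s (j + 1) - weight s j)\<^sup>2)"
  proof (subst sum.reindex)
    show "inj_on (\<lambda>i. fst i - p - 1) D"
    proof (rule inj_onI)
      fix i j assume "i \<in> D" "j \<in> D" "fst i - p - 1 = fst j - p - 1"
      then show "i = j" using val(1)[of i] val(1)[of j] by (simp add: prod_eq_iff)
    qed
  qed simp
  also have "\<dots> \<le> K" using D by (intro K) auto
  finally show ?thesis .
qed

lemma sum_powr_ge:
  assumes "0 \<le> s"
  shows "(real n / 2) powr (2 * s + 1) \<le> (\<Sum>j\<in>{1..n}. real j powr (2 * s))"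
proof (cases "n = 0")
  case False
  have "(real n / 2) powr (2 * s + 1) = real n / 2 * (real n / 2) powr (2 * s)"
    using False by (simp add: powr_add)
  also have "\<dots> \<le> real (card {(n + 1) div 2..n}) * (real n / 2) powr (2 * s)"
  proof (intro mult_right_mono)
    have "n \<le> 2 * card {(n + 1) div 2..n}" by simp
    then have "real n \<le> real (2 * card {(n + 1) div 2..n})" by (rule of_nat_mono)
    then show "real n / 2 \<le> real (card {(n + 1) div 2..n})" by simp
  qed simp
  also have "\<dots> = (\<Sum>j\<in>{(n + 1) div 2..n}. (real n / 2) powr (2 * s))" by simp
  also have "\<dots> \<le> (\<Sum>j\<in>{(n + 1) div 2..n}. real j powr (2 * s))"
  proof (intro sum_mono powr_mono2)
    fix j assume "j \<in> {(n + 1) div 2..n}"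
    then have "n \<le> 2 * j" by auto
    then show "real n / 2 \<le> real j" by linarith
  qed (use assms in auto)
  also have "\<dots> \<le> (\<Sum>j\<in>{1..n}. real j powr (2 * s))"
    using False by (intro sum_mono2) auto
  finally show ?thesis .
qed simp

lemma sqdist_tails_ge:
  assumes fin: "finite {z. f z \<noteq> \<one>\<^bsub>G\<^esub>}" "finite {z. g z \<noteq> \<one>\<^bsub>G\<^esub>}"
    and s: "0 \<le> s" and z0: "f z0 \<noteq> g z0" "max p q \<le> z0"
  shows "(real_of_int (z0 - max p q) / 2) powr (2 * s + 1) \<le> sqdist (tails G s f p) (tails G s g q)"
proof -
  define M where "M = max p q"
  define n where "n = nat (z0 - M)"
  define tl where "tl = (\<lambda>(h :: int \<Rightarrow> iter_elem) (k :: int) z. if k \<le> z then h z else \<one>\<^bsub>G\<^esub>)"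
  \<comment> \<open>Of the two tails at \<open>k\<close>, at least one is nontrivial; it is a coordinate at which only one of the two vectors does not vanish.\<close>
  define i where "i = (\<lambda>k. (k, tl (if \<exists>z\<ge>k. f z \<noteq> \<one>\<^bsub>G\<^esub> then f else g) k))"
  have coord: "(real j powr s)\<^sup>2 \<le> (tails G s f p (i (M + int j)) - tails G s g q (i (M + int j)))\<^sup>2"
    if j: "j \<in> {1..n}" for j
  proof -
    define k where "k = M + int j"
    have k: "k \<le> z0" "p < k" "q < k" "j \<le> k - p" "j \<le> k - q" using j by (auto simp: k_def n_def M_def)
    have ne: "tl f k \<noteq> tl g k"
    proof
      assume "tl f k = tl g k"
      then have "tl f k z0 = tl g k z0" by (rule fun_cong)
      then show False using k z0 by (simp add: tl_def)
    qed
    have w: "real j powr s \<le> weight s (k - p)" "real j powr s \<le> weight s (k - q)"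
      using k s by (auto simp: weight_def intro!: powr_mono2)
    have tails_tl: "tails G s h r (k, tl h' k) = (if tl h' k = tl h k \<and> (\<exists>z\<ge>k. h z \<noteq> \<one>\<^bsub>G\<^esub>) then weight s (k - r) else 0)"
      for h h' r by (simp add: tails_def tl_def)
    have "\<bar>real j powr s\<bar> \<le> \<bar>tails G s f p (i k) - tails G s g q (i k)\<bar>"
    proof (cases "\<exists>z\<ge>k. f z \<noteq> \<one>\<^bsub>G\<^esub>")
      case True
      then have "i k = (k, tl f k)" by (simp add: i_def)
      then show ?thesis using True ne w(1) by (simp add: tails_tl)
    next
      case False
      then have ik: "i k = (k, tl g k)" unfolding i_def by (simp only: if_False)
      have "\<exists>z\<ge>k. g z \<noteq> \<one>\<^bsub>G\<^esub>" using False z0(1) k(1) by (intro exI[of _ z0]) auto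
      then have "tails G s g q (i k) = weight s (k - q)" unfolding ik by (simp add: tails_tl)
      moreover have "tails G s f p (i k) = 0" unfolding ik tails_tl using False by (simp only: simp_thms if_False)
      ultimately show ?thesis using w(2) by simp
    qed
    then show ?thesis unfolding k_def[symmetric] by (simp only: abs_le_square_iff)
  qed
  have inj: "inj_on (\<lambda>j. i (M + int j)) {1..n}" by (auto simp: inj_on_def i_def)
  have "(real n / 2) powr (2 * s + 1) \<le> (\<Sum>j\<in>{1..n}. real j powr (2 * s))" by (rule sum_powr_ge[OF s])
  also have "\<dots> = (\<Sum>j\<in>{1..n}. (real j powr s)\<^sup>2)"
    by (intro sum.cong) (simp_all add: power2_eq_square flip: powr_add)
  also have "\<dots> \<le> (\<Sum>j\<in>{1..n}. (tails G s f p (i (M + int j)) - tails G s g q (i (M + int j)))\<^sup>2)"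
    by (intro sum_mono coord)
  also have "\<dots> = (\<Sum>x\<in>(\<lambda>j. i (M + int j)) ` {1..n}. (tails G s f p x - tails G s g q x)\<^sup>2)"
    by (subst sum.reindex[OF inj]) simp
  also have "\<dots> \<le> sqdist (tails G s f p) (tails G s g q)"
    by (rule sqdist_ge[OF finite_diff_support[OF finite_tails[OF fin(1)] finite_tails[OF fin(2)]]]) simp
  finally show ?thesis using z0(2) by (simp add: n_def M_def)
qed

definition emb :: "iter_elem monoid \<Rightarrow> real \<Rightarrow> (iter_elem \<Rightarrow> idx \<Rightarrow> real) \<Rightarrow> iter_elem \<Rightarrow> idx \<Rightarrow> real"
  where "emb G s \<theta> w i = (case i of
      Pos \<Rightarrow> real_of_int (pos w)
    | Tail b k \<tau> \<Rightarrow> (if b then tails G s (lamps w) (pos w) (k, \<tau>)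
        else tails G s (\<lambda>z. lamps w (- z)) (- pos w) (k, \<tau>))
    | Lamp z j \<Rightarrow> \<theta> (lamps w z) j)"

text \<open>The Lipschitz condition is expressed by a bounded displacement under each right multiplication,
  which again does not refer to generators.\<close>

definition embeds :: "iter_elem monoid \<Rightarrow> (iter_elem \<Rightarrow> real) \<Rightarrow> real \<Rightarrow> (iter_elem \<Rightarrow> idx \<Rightarrow> real) \<Rightarrow> bool"
  where "embeds G \<rho> \<alpha> \<theta> \<longleftrightarrow> \<theta> \<one>\<^bsub>G\<^esub> = (\<lambda>_. 0) \<and> (\<forall>x\<in>carrier G. finite {i. \<theta> x i \<noteq> 0}) \<and>
    (\<forall>h\<in>carrier G. \<exists>L. \<forall>x\<in>carrier G. sqdist (\<theta> x) (\<theta> (x \<otimes>\<^bsub>G\<^esub> h)) \<le> L) \<and>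
    (\<exists>c>0. \<forall>x\<in>carrier G. \<forall>y\<in>carrier G. x \<noteq> y \<longrightarrow>
      c * \<rho> (inv\<^bsub>G\<^esub> x \<otimes>\<^bsub>G\<^esub> y) powr (2 * \<alpha>) \<le> sqdist (\<theta> x) (\<theta> y))"

lemma finite_emb:
  assumes "finite {z. f z \<noteq> \<one>\<^bsub>G\<^esub>}" "\<theta> \<one>\<^bsub>G\<^esub> = (\<lambda>_. 0)" "\<And>z. finite {i. \<theta> (f z) i \<noteq> 0}"
  shows "finite {i. emb G s \<theta> (Wr f p) i \<noteq> 0}"
proof (rule finite_subset)
  have "finite {z. f (- z) \<noteq> \<one>\<^bsub>G\<^esub>}"
    using finite_vimageI[OF assms(1), of uminus] by (simp add: vimage_def)
  then show "finite ({Pos} \<union> (\<lambda>(k, \<tau>). Tail True k \<tau>) ` {i. tails G s f p i \<noteq> 0} \<union>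
    (\<lambda>(k, \<tau>). Tail False k \<tau>) ` {i. tails G s (\<lambda>z. f (- z)) (- p) i \<noteq> 0} \<union>
    (\<Union>z\<in>{z. f z \<noteq> \<one>\<^bsub>G\<^esub>}. Lamp z ` {i. \<theta> (f z) i \<noteq> 0}))"
    using assms finite_tails[of _ G s] by auto
  show "{i. emb G s \<theta> (Wr f p) i \<noteq> 0} \<subseteq> {Pos} \<union> (\<lambda>(k, \<tau>). Tail True k \<tau>) ` {i. tails G s f p i \<noteq> 0} \<union>
    (\<lambda>(k, \<tau>). Tail False k \<tau>) ` {i. tails G s (\<lambda>z. f (- z)) (- p) i \<noteq> 0} \<union>
    (\<Union>z\<in>{z. f z \<noteq> \<one>\<^bsub>G\<^esub>}. Lamp z ` {i. \<theta> (f z) i \<noteq> 0})"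
  proof
    fix i assume "i \<in> {i. emb G s \<theta> (Wr f p) i \<noteq> 0}"
    then show "i \<in> {Pos} \<union> (\<lambda>(k, \<tau>). Tail True k \<tau>) ` {i. tails G s f p i \<noteq> 0} \<union>
      (\<lambda>(k, \<tau>). Tail False k \<tau>) ` {i. tails G s (\<lambda>z. f (- z)) (- p) i \<noteq> 0} \<union>
      (\<Union>z\<in>{z. f z \<noteq> \<one>\<^bsub>G\<^esub>}. Lamp z ` {i. \<theta> (f z) i \<noteq> 0})"
    proof (cases i)
      case (Tail b k \<tau>)
      with \<open>i \<in> _\<close> show ?thesis by (cases b) (force simp: emb_def)+
    next
      case (Lamp z j)
      with \<open>i \<in> _\<close> have "\<theta> (f z) j \<noteq> 0" by (simp add: emb_def)
      moreover from this have "f z \<noteq> \<one>\<^bsub>G\<^esub>" using assms(2) by auto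
      ultimately show ?thesis using Lamp by auto
    qed simp
  qed
qed

lemma sqdist_emb:
  assumes "finite {z. f z \<noteq> \<one>\<^bsub>G\<^esub>}" "finite {z. g z \<noteq> \<one>\<^bsub>G\<^esub>}" "\<theta> \<one>\<^bsub>G\<^esub> = (\<lambda>_. 0)"
    "\<And>z. finite {i. \<theta> (f z) i \<noteq> 0}" "\<And>z. finite {i. \<theta> (g z) i \<noteq> 0}"
    and A: "finite A" "{z. f z \<noteq> g z} \<subseteq> A"
  shows "sqdist (emb G s \<theta> (Wr f p)) (emb G s \<theta> (Wr g q)) = (real_of_int p - real_of_int q)\<^sup>2 +
    (sqdist (tails G s f p) (tails G s g q) +
     sqdist (tails G s (\<lambda>z. f (- z)) (- p)) (tails G s (\<lambda>z. g (- z)) (- q))) +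
    (\<Sum>z\<in>A. sqdist (\<theta> (f z)) (\<theta> (g z)))"
proof -
  have "finite {i. emb G s \<theta> (Wr f p) i \<noteq> emb G s \<theta> (Wr g q) i}"
    by (rule finite_diff_support[OF finite_emb[where f = f, OF assms(1,3,4)] finite_emb[where f = g, OF assms(2,3,5)]])
  then show ?thesis
    using A by (subst sqdist_idx[of _ _ A]) (auto simp: emb_def)
qed

lemma powr_tangent:
  fixes x a \<beta> :: real
  assumes "\<beta> \<ge> 1" "a > 0" "x \<ge> 0"
  shows "\<beta> * a powr (\<beta> - 1) * x - (\<beta> - 1) * a powr \<beta> \<le> x powr \<beta>"
proof (cases "x = 0")
  case False
  then have x: "x > 0" using assms by simp
  have "(x powr \<beta>) powr (1 / \<beta>) * (a powr \<beta>) powr (1 - 1 / \<beta>) \<le> 1 / \<beta> * x powr \<beta> + (1 - 1 / \<beta>) * a powr \<beta>"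
    using assms x by (intro Youngs_inequality_0) auto
  moreover have "\<beta> * (1 - 1 / \<beta>) = \<beta> - 1" using assms by (simp add: right_diff_distrib)
  ultimately have "x * a powr (\<beta> - 1) \<le> 1 / \<beta> * x powr \<beta> + (1 - 1 / \<beta>) * a powr \<beta>"
    using assms x by (simp add: powr_powr)
  then have "\<beta> * (x * a powr (\<beta> - 1)) \<le> \<beta> * (1 / \<beta> * x powr \<beta> + (1 - 1 / \<beta>) * a powr \<beta>)"
    using assms by (intro mult_left_mono) auto
  also have "\<dots> = x powr \<beta> + (\<beta> - 1) * a powr \<beta>"
    using assms by (simp add: distrib_left left_diff_distrib right_diff_distrib)
  finally show ?thesis by (simp add: mult_ac)
qed (use assms in auto)

lemma sum_powr_power_mean:
  fixes r :: "'a \<Rightarrow> real"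
  assumes "finite A" "\<beta> \<ge> 1" "\<And>z. z \<in> A \<Longrightarrow> r z \<ge> 0" "sum r A > 0"
  shows "real (card A) powr (1 - \<beta>) * sum r A powr \<beta> \<le> (\<Sum>z\<in>A. r z powr \<beta>)"
proof -
  have A: "card A > 0" using assms by (auto simp: card_gt_0_iff)
  define a where "a = sum r A / card A"
  have a: "a > 0" using assms A by (simp add: a_def)
  have "real (card A) powr (1 - \<beta>) * sum r A powr \<beta> = card A * a powr \<beta>"
    using A assms by (simp add: a_def powr_divide powr_diff)
  also have "\<dots> = \<beta> * a powr (\<beta> - 1) * (card A * a) - card A * ((\<beta> - 1) * a powr \<beta>)"
  proof -
    have e: "a powr \<beta> = a powr (\<beta> - 1) * a" using a by (simp add: powr_diff)
    show ?thesis unfolding e by (simp add: algebra_simps)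
  qed
  also have "\<dots> = (\<Sum>z\<in>A. \<beta> * a powr (\<beta> - 1) * r z - (\<beta> - 1) * a powr \<beta>)"
    using A by (simp add: sum_subtractf a_def flip: sum_distrib_left)
  also have "\<dots> \<le> (\<Sum>z\<in>A. r z powr \<beta>)"
    using assms a by (intro sum_mono powr_tangent) auto
  finally show ?thesis .
qed

text \<open>The exponent of the wreath product: if \<open>D\<close> is the total distance of the lamps and \<open>R\<close> the width
  of the region in which they differ, the squared distance of the images is at least \<open>R powr 2\<close> (almost)
  and \<open>R powr (1 - \<beta>) * D powr \<beta>\<close>, where \<open>\<beta> = 2 * \<alpha>\<close>. For given \<open>D\<close>, the worst case is
  \<open>R = D powr (\<beta> / (\<beta> + 1))\<close>.\<close>

lemma worst_width:
  fixes R D S n c \<beta> \<sigma> \<tau> :: real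
  assumes \<beta>: "1 \<le> \<beta>" and \<sigma>: "1 < \<sigma>" "\<sigma> < 2" and \<tau>: "0 \<le> \<tau>" "\<tau> \<le> \<sigma> * (\<beta> / (\<beta> + 1))"
    and c: "c > 0" and R: "R = 0 \<or> R \<ge> 1" and D: "D = 0 \<or> D \<ge> 1" and RD: "R + D \<ge> 1"
    and SR: "R powr \<sigma> / 36 \<le> S"
    and n: "D \<ge> 1 \<Longrightarrow> 0 < n" "D \<ge> 1 \<Longrightarrow> n \<le> 3 * max 1 R"
    and SD: "D \<ge> 1 \<Longrightarrow> c * (n powr (1 - \<beta>) * D powr \<beta>) \<le> S"
  shows "min (1 / 144) (c * 3 powr (1 - \<beta>) / 4) * (R + D) powr \<tau> \<le> S"
proof -
  define k where "k = min (1 / 144) (c * 3 powr (1 - \<beta>) / 4)"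
  have k: "0 < k" "k \<le> 1 / 144" "k \<le> c * 3 powr (1 - \<beta>) / 4" using c by (auto simp: k_def)
  have "\<beta> / (\<beta> + 1) \<le> 1" using \<beta> by simp
  then have "\<sigma> * (\<beta> / (\<beta> + 1)) \<le> \<sigma> * 1" using \<sigma> by (intro mult_left_mono) auto
  then have \<tau>\<sigma>: "\<tau> \<le> \<sigma>" "\<tau> \<le> 2" using \<tau> \<sigma> by auto
  have two: "(2 * x) powr \<tau> \<le> 4 * x powr \<tau>" if "x \<ge> 1" for x :: real
  proof -
    have "(2 * x) powr \<tau> = 2 powr \<tau> * x powr \<tau>" using that by (simp add: powr_mult)
    also have "\<dots> \<le> 2 powr 2 * x powr \<tau>" using \<tau>\<sigma> by (intro mult_right_mono powr_mono) auto
    finally show ?thesis by simp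
  qed
  show ?thesis
    unfolding k_def[symmetric]
  proof (cases "D \<le> R")
    case True
    then have R1: "R \<ge> 1" using R RD by auto
    have "k * (R + D) powr \<tau> \<le> k * (2 * R) powr \<tau>"
      using True R1 D \<tau> k by (intro mult_left_mono powr_mono2) auto
    also have "\<dots> \<le> 1 / 144 * (4 * R powr \<sigma>)"
    proof (intro mult_mono)
      have "R powr \<tau> \<le> R powr \<sigma>" using R1 \<tau>\<sigma> by (intro powr_mono) auto
      then show "(2 * R) powr \<tau> \<le> 4 * R powr \<sigma>" using two[OF R1] by linarith
    qed (use k in auto)
    finally show "k * (R + D) powr \<tau> \<le> S" using SR by simp
  next
    case False
    then have D1: "D \<ge> 1" using D R by auto
    define t where "t = \<beta> / (\<beta> + 1)"
    have t: "0 \<le> t" using \<beta> by (simp add: t_def)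
    have "k * (R + D) powr \<tau> \<le> k * (2 * D) powr \<tau>"
      using False D1 R \<tau> k by (intro mult_left_mono powr_mono2) auto
    also have "\<dots> \<le> k * (4 * D powr \<tau>)" using two[OF D1] k by (intro mult_left_mono) auto
    also have "\<dots> \<le> S"
    proof (cases "D powr t \<le> R")
      case True
      have "D powr \<tau> \<le> D powr (t * \<sigma>)" using D1 \<tau> by (intro powr_mono) (auto simp: t_def mult.commute)
      also have "\<dots> = (D powr t) powr \<sigma>" by (simp add: powr_powr)
      also have "\<dots> \<le> R powr \<sigma>" using True \<sigma> by (intro powr_mono2) auto
      finally have "k * (4 * D powr \<tau>) \<le> 1 / 144 * (4 * R powr \<sigma>)" using k by (intro mult_mono) auto
      then show ?thesis using SR by simp
    next
      case False
      have Dt: "1 \<le> D powr t" using D1 t by (intro ge_one_powr_ge_zero) auto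
      have n3: "n \<le> 3 * D powr t" using n(2)[OF D1] False Dt by auto
      have "D powr \<tau> \<le> D powr (2 * t)"
      proof (intro powr_mono)
        have "\<sigma> * t \<le> 2 * t" using \<sigma> t by (intro mult_right_mono) auto
        then show "\<tau> \<le> 2 * t" using \<tau>(2) by (simp add: t_def)
      qed (use D1 in auto)
      also have "2 * t = t * (1 - \<beta>) + \<beta>" using \<beta> by (simp add: t_def field_simps)
      also have "D powr (t * (1 - \<beta>) + \<beta>) = (D powr t) powr (1 - \<beta>) * D powr \<beta>"
        by (simp add: powr_add powr_powr)
      finally have "k * (4 * D powr \<tau>) \<le> (c * 3 powr (1 - \<beta>) / 4) * (4 * ((D powr t) powr (1 - \<beta>) * D powr \<beta>))"
        using k by (intro mult_mono) auto
      also have "\<dots> = c * ((3 * D powr t) powr (1 - \<beta>) * D powr \<beta>)"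
        by (simp add: powr_mult)
      also have "\<dots> \<le> c * (n powr (1 - \<beta>) * D powr \<beta>)"
        using n(1)[OF D1] n3 \<beta> c by (intro mult_left_mono mult_right_mono powr_mono2') auto
      also have "\<dots> \<le> S" by (rule SD[OF D1])
      finally show ?thesis .
    qed
    finally show "k * (R + D) powr \<tau> \<le> S" .
  qed
qed

lemma (in iter_group) inv_mult_eq_one:
  "a \<in> carrier G \<Longrightarrow> b \<in> carrier G \<Longrightarrow> inv a \<otimes> b = \<one> \<longleftrightarrow> a = b"
  by (metis inv_closed inv_equality inv_inv l_inv)

lemma (in iter_group) tour_difference:
  assumes x: "Wr f p \<in> carrier (wr G)" and y: "Wr g q \<in> carrier (wr G)"
  shows "tour G \<rho> (inv\<^bsub>wr G\<^esub> Wr f p \<otimes>\<^bsub>wr G\<^esub> Wr g q) =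
    \<bar>real_of_int (p - q)\<bar> + real (Max (insert 0 ((\<lambda>z. nat \<bar>z - p\<bar>) ` {z. f z \<noteq> g z}))) +
    (\<Sum>z | f z \<noteq> g z. \<rho> (inv (f z) \<otimes> g z))"
proof -
  have f: "\<And>z. f z \<in> carrier G" and g: "\<And>z. g z \<in> carrier G" using x y by auto
  have S: "{z. inv (f (z + p)) \<otimes> g (z + p) \<noteq> \<one>} = (\<lambda>z. z - p) ` {z. f z \<noteq> g z}"
  proof -
    have "{z. inv (f (z + p)) \<otimes> g (z + p) \<noteq> \<one>} = {z. f (z + p) \<noteq> g (z + p)}"
      using f g inv_mult_eq_one by auto
    also have "\<dots> = (\<lambda>z. z - p) ` {z. f z \<noteq> g z}"
      by (auto simp: image_iff) (metis add_diff_cancel_right')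
    finally show ?thesis .
  qed
  have "(\<Sum>z\<in>(\<lambda>z. z - p) ` {z. f z \<noteq> g z}. \<rho> (inv (f (z + p)) \<otimes> g (z + p))) =
    (\<Sum>z | f z \<noteq> g z. \<rho> (inv (f z) \<otimes> g z))"
    by (subst sum.reindex) (auto simp: inj_on_def)
  then show ?thesis
    unfolding Wr_inv_mult[OF x y] tour_def lamp_sum_def lamps.simps pos.simps S
    by (simp add: image_image abs_minus_commute)
qed

text \<open>Besides the position, the embedding consists of the tails seen from the position, in both
  directions, which control the width of the region in which two configurations differ, and of all
  lamps, each with weight 1, embedded by \<open>\<theta>\<close>. The latter is compatible with the Lipschitz condition,
  since a switch affects one lamp and a move affects none.\<close>

lemma (in iter_group) embeds_wr:
  assumes emb: "embeds G \<rho> \<alpha> \<theta>" and \<rho>: "\<And>x. x \<in> carrier G \<Longrightarrow> x \<noteq> \<one> \<Longrightarrow> 1 \<le> \<rho> x" "\<rho> \<one> = 0"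
    and \<alpha>: "1 / 2 \<le> \<alpha>" and \<alpha>': "0 \<le> \<alpha>'" "\<alpha>' < 2 * \<alpha> / (2 * \<alpha> + 1)"
  shows "\<exists>s. embeds (wr G) (tour G \<rho>) \<alpha>' (emb G s \<theta>)"
proof -
  define t where "t = 2 * \<alpha> / (2 * \<alpha> + 1)"
  have t: "t > 0" using \<alpha> by (simp add: t_def)
  \<comment> \<open>The exponent 2 would be optimal, but needs weights of exponent \<open>s = 1 / 2\<close>. The loss is chosen small enough for \<open>\<alpha>'\<close>.\<close>
  define \<sigma> where "\<sigma> = max (3 / 2) (2 * \<alpha>' / t)"
  have "\<alpha>' < t" using \<alpha>'(2) by (simp only: t_def)
  then have \<sigma>: "1 < \<sigma>" "\<sigma> < 2" using t by (auto simp: \<sigma>_def field_simps)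
  have "2 * \<alpha>' / t \<le> \<sigma>" by (simp add: \<sigma>_def)
  then have "2 * \<alpha>' \<le> \<sigma> * t" using t by (simp add: field_simps)
  then have \<sigma>\<tau>: "2 * \<alpha>' \<le> \<sigma> * (2 * \<alpha> / (2 * \<alpha> + 1))" by (simp only: t_def)
  define s where "s = (\<sigma> - 1) / 2"
  have s: "0 < s" "s < 1 / 2" "2 * s + 1 = \<sigma>" using \<sigma> by (auto simp: s_def field_simps)
  let ?E = "emb G s \<theta>"
  have \<theta>1: "\<theta> \<one> = (\<lambda>_. 0)" and \<theta>fin: "\<And>x. x \<in> carrier G \<Longrightarrow> finite {i. \<theta> x i \<noteq> 0}"
    and \<theta>up: "\<And>h. h \<in> carrier G \<Longrightarrow> \<exists>L. \<forall>x\<in>carrier G. sqdist (\<theta> x) (\<theta> (x \<otimes> h)) \<le> L"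
    using emb by (auto simp: embeds_def)
  obtain c where c: "c > 0" "\<And>x y. x \<in> carrier G \<Longrightarrow> y \<in> carrier G \<Longrightarrow> x \<noteq> y \<Longrightarrow>
      c * \<rho> (inv x \<otimes> y) powr (2 * \<alpha>) \<le> sqdist (\<theta> x) (\<theta> y)"
    using emb by (auto simp: embeds_def)
  have Efin: "finite {i. ?E w i \<noteq> 0}" if w: "w \<in> carrier (wr G)" for w
  proof -
    obtain f p where "w = Wr f p" "\<And>z. f z \<in> carrier G" "finite {z. f z \<noteq> \<one>}"
      using w by (elim wr_cases) blast
    then show ?thesis using finite_emb[of f G \<theta> s p] \<theta>1 \<theta>fin by simp
  qed
  have E1: "?E \<one>\<^bsub>wr G\<^esub> = (\<lambda>_. 0)"
    by (auto simp: fun_eq_iff wr_one emb_def tails_def \<theta>1 split: idx.split)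
  have sq: "sqdist (?E (Wr f p)) (?E (Wr g q)) = (real_of_int p - real_of_int q)\<^sup>2 +
      (sqdist (tails G s f p) (tails G s g q) +
       sqdist (tails G s (\<lambda>z. f (- z)) (- p)) (tails G s (\<lambda>z. g (- z)) (- q))) +
      (\<Sum>z\<in>A. sqdist (\<theta> (f z)) (\<theta> (g z)))"
    if "Wr f p \<in> carrier (wr G)" "Wr g q \<in> carrier (wr G)" "finite A" "{z. f z \<noteq> g z} \<subseteq> A" for f p g q A
    using that \<theta>1 \<theta>fin by (intro sqdist_emb) auto
  have refl_fin: "finite {z. f (- z) \<noteq> \<one>}" if "finite {z. f z \<noteq> \<one>}" for f :: "int \<Rightarrow> iter_elem"
    using finite_vimageI[OF that, of uminus] by (simp add: vimage_def)
  obtain K where K: "\<And>B. finite B \<Longrightarrow> (\<Sum>j\<in>B. (weight s (j + 1) - weight s j)\<^sup>2) \<le> K"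
    using weight_increments[OF s(1,2)] by blast
  have up_lamp: "\<exists>L. \<forall>w\<in>carrier (wr G). sqdist (?E w) (?E (w \<otimes>\<^bsub>wr G\<^esub> lamp G a)) \<le> L" if a: "a \<in> carrier G" for a
  proof -
    obtain L where L: "\<And>x. x \<in> carrier G \<Longrightarrow> sqdist (\<theta> x) (\<theta> (x \<otimes> a)) \<le> L" using \<theta>up[OF a] by blast
    have "sqdist (?E w) (?E (w \<otimes>\<^bsub>wr G\<^esub> lamp G a)) \<le> L" if w: "w \<in> carrier (wr G)" for w
    proof -
      obtain f p where w_eq: "w = Wr f p" and f: "\<And>z. f z \<in> carrier G" "finite {z. f z \<noteq> \<one>}"
        using w by (elim wr_cases) blast
      have wf: "Wr f p \<in> carrier (wr G)" using w by (simp add: w_eq)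
      have wa: "Wr (f(p := f p \<otimes> a)) p \<in> carrier (wr G)"
        using W.m_closed[OF wf lamp_closed[OF a]] by (simp only: mult_lamp[OF wf a])
      have reflect: "(\<lambda>z. (f(p := f p \<otimes> a)) (- z)) = (\<lambda>z. f (- z))(- p := f p \<otimes> a)"
        by (auto simp: fun_eq_iff)
      have sub: "{z. f z \<noteq> (f(p := f p \<otimes> a)) z} \<subseteq> {p}" by auto
      have "sqdist (?E w) (?E (w \<otimes>\<^bsub>wr G\<^esub> lamp G a)) = sqdist (\<theta> (f p)) (\<theta> (f p \<otimes> a))"
        unfolding w_eq mult_lamp[OF wf a] sq[OF wf wa finite.insertI[OF finite.emptyI] sub] reflect tails_switch
        by simp
      then show ?thesis using L[OF f(1), of p] by simp
    qed
    then show ?thesis by blast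
  qed
  have unit: "sqdist (?E (Wr f (p + 1))) (?E (Wr f p)) \<le> 1 + (K + K)" if w: "Wr f p \<in> carrier (wr G)" for f p
  proof -
    have fin: "finite {z. f z \<noteq> \<one>}" using w by simp
    have "sqdist (tails G s f (p + 1)) (tails G s f p) \<le> K"
      by (rule sqdist_tails_shift[OF fin K])
    moreover have "sqdist (tails G s (\<lambda>z. f (- z)) (- (p + 1))) (tails G s (\<lambda>z. f (- z)) (- p)) \<le> K"
      using sqdist_tails_shift[OF refl_fin[OF fin] K, of "- p - 1"] by (simp add: sqdist_commute)
    ultimately show ?thesis using w sq[of f "p + 1" f p "{}"] by simp
  qed
  have up_shift: "\<exists>L. \<forall>w\<in>carrier (wr G). sqdist (?E w) (?E (w \<otimes>\<^bsub>wr G\<^esub> shift G e)) \<le> L" if e: "e = 1 \<or> e = - 1" for e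
  proof (intro exI ballI)
    fix w assume w: "w \<in> carrier (wr G)"
    then obtain f p where w_eq: "w = Wr f p" by (elim wr_cases) blast
    show "sqdist (?E w) (?E (w \<otimes>\<^bsub>wr G\<^esub> shift G e)) \<le> 1 + (K + K)"
      using e unit[of f p] unit[of f "p - 1"] w by (auto simp: w_eq mult_shift sqdist_commute)
  qed
  have upper: "\<exists>L. \<forall>w\<in>carrier (wr G). sqdist (?E w) (?E (w \<otimes>\<^bsub>wr G\<^esub> h)) \<le> L" if h: "h \<in> carrier (wr G)" for h
    using _ up_lamp up_shift up_shift _ h
  proof (rule wr_generated)
    show "\<exists>L. \<forall>w\<in>carrier (wr G). sqdist (?E w) (?E (w \<otimes>\<^bsub>wr G\<^esub> \<one>\<^bsub>wr G\<^esub>)) \<le> L"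
      by (intro exI[of _ 0]) simp
  next
    fix u v
    assume uv: "u \<in> carrier (wr G)" "v \<in> carrier (wr G)"
      and "\<exists>L. \<forall>w\<in>carrier (wr G). sqdist (?E w) (?E (w \<otimes>\<^bsub>wr G\<^esub> u)) \<le> L"
      and "\<exists>L. \<forall>w\<in>carrier (wr G). sqdist (?E w) (?E (w \<otimes>\<^bsub>wr G\<^esub> v)) \<le> L"
    then obtain L1 L2 where L: "\<And>w. w \<in> carrier (wr G) \<Longrightarrow> sqdist (?E w) (?E (w \<otimes>\<^bsub>wr G\<^esub> u)) \<le> L1"
      "\<And>w. w \<in> carrier (wr G) \<Longrightarrow> sqdist (?E w) (?E (w \<otimes>\<^bsub>wr G\<^esub> v)) \<le> L2" by blast
    show "\<exists>L. \<forall>w\<in>carrier (wr G). sqdist (?E w) (?E (w \<otimes>\<^bsub>wr G\<^esub> (u \<otimes>\<^bsub>wr G\<^esub> v))) \<le> L"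
    proof (intro exI ballI)
      fix w assume w: "w \<in> carrier (wr G)"
      have wu: "w \<otimes>\<^bsub>wr G\<^esub> u \<in> carrier (wr G)" and wuv: "w \<otimes>\<^bsub>wr G\<^esub> u \<otimes>\<^bsub>wr G\<^esub> v \<in> carrier (wr G)"
        using w uv by auto
      have "sqdist (?E w) (?E (w \<otimes>\<^bsub>wr G\<^esub> u \<otimes>\<^bsub>wr G\<^esub> v)) \<le>
        2 * sqdist (?E w) (?E (w \<otimes>\<^bsub>wr G\<^esub> u)) + 2 * sqdist (?E (w \<otimes>\<^bsub>wr G\<^esub> u)) (?E (w \<otimes>\<^bsub>wr G\<^esub> u \<otimes>\<^bsub>wr G\<^esub> v))"
        by (rule sqdist_triangle[OF Efin[OF w] Efin[OF wu] Efin[OF wuv]])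
      then show "sqdist (?E w) (?E (w \<otimes>\<^bsub>wr G\<^esub> (u \<otimes>\<^bsub>wr G\<^esub> v))) \<le> 2 * L1 + 2 * L2"
        using L(1)[OF w] L(2)[OF wu] uv w by (simp add: W.m_assoc)
    qed
  qed auto
  define c' where "c' = min (1 / 144) (c * 3 powr (1 - 2 * \<alpha>) / 4)"
  have lower: "c' * tour G \<rho> (inv\<^bsub>wr G\<^esub> x \<otimes>\<^bsub>wr G\<^esub> y) powr (2 * \<alpha>') \<le> sqdist (?E x) (?E y)"
    if xy: "x \<in> carrier (wr G)" "y \<in> carrier (wr G)" "x \<noteq> y" for x y
  proof -
    obtain f p g q where eq: "x = Wr f p" "y = Wr g q"
      and f: "\<And>z. f z \<in> carrier G" "finite {z. f z \<noteq> \<one>}"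
      and g: "\<And>z. g z \<in> carrier G" "finite {z. g z \<noteq> \<one>}"
      using xy by (elim wr_cases) blast
    have wx: "Wr f p \<in> carrier (wr G)" and wy: "Wr g q \<in> carrier (wr G)" using xy eq by auto
    define A where "A = {z. f z \<noteq> g z}"
    have "A \<subseteq> {z. f z \<noteq> \<one>} \<union> {z. g z \<noteq> \<one>}" by (auto simp: A_def)
    then have A: "finite A" using f g finite_subset by blast
    define m where "m = Max (insert 0 ((\<lambda>z. nat \<bar>z - p\<bar>) ` A))"
    have m: "\<bar>z - p\<bar> \<le> int m" if "z \<in> A" for z
    proof -
      have "nat \<bar>z - p\<bar> \<le> m" unfolding m_def using that A by (intro Max_ge) auto
      then show ?thesis by linarith
    qed
    define r where "r = (\<lambda>z. \<rho> (inv (f z) \<otimes> g z))"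
    have r: "1 \<le> r z" if "z \<in> A" for z
      using that f g inv_mult_eq_one[of "f z" "g z"] unfolding r_def A_def by (intro \<rho>) auto
    define R where "R = \<bar>real_of_int (p - q)\<bar> + real m"
    define D where "D = sum r A"
    define S where "S = sqdist (?E x) (?E y)"
    have tour: "tour G \<rho> (inv\<^bsub>wr G\<^esub> x \<otimes>\<^bsub>wr G\<^esub> y) = R + D"
      unfolding eq tour_difference[OF wx wy] by (simp add: R_def D_def m_def A_def r_def)
    have S: "S = (real_of_int p - real_of_int q)\<^sup>2 + (sqdist (tails G s f p) (tails G s g q) +
       sqdist (tails G s (\<lambda>z. f (- z)) (- p)) (tails G s (\<lambda>z. g (- z)) (- q))) +
      (\<Sum>z\<in>A. sqdist (\<theta> (f z)) (\<theta> (g z)))"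
      unfolding S_def eq using A by (intro sq wx wy) (auto simp: A_def)
    have S1: "(real_of_int p - real_of_int q)\<^sup>2 \<le> S" "sqdist (tails G s f p) (tails G s g q) \<le> S"
      "sqdist (tails G s (\<lambda>z. f (- z)) (- p)) (tails G s (\<lambda>z. g (- z)) (- q)) \<le> S"
      "(\<Sum>z\<in>A. sqdist (\<theta> (f z)) (\<theta> (g z))) \<le> S"
    proof -
      have "0 \<le> (\<Sum>z\<in>A. sqdist (\<theta> (f z)) (\<theta> (g z)))" by (intro sum_nonneg sqdist_nonneg)
      moreover note sqdist_nonneg[of "tails G s f p" "tails G s g q"]
        sqdist_nonneg[of "tails G s (\<lambda>z. f (- z)) (- p)" "tails G s (\<lambda>z. g (- z)) (- q)"]
        zero_le_power2[of "real_of_int p - real_of_int q"]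
      ultimately show "(real_of_int p - real_of_int q)\<^sup>2 \<le> S" "sqdist (tails G s f p) (tails G s g q) \<le> S"
        "sqdist (tails G s (\<lambda>z. f (- z)) (- p)) (tails G s (\<lambda>z. g (- z)) (- q)) \<le> S"
        "(\<Sum>z\<in>A. sqdist (\<theta> (f z)) (\<theta> (g z))) \<le> S"
        unfolding S by linarith+
    qed
    have R01: "R = 0 \<or> R \<ge> 1"
    proof -
      have "R = real_of_int (\<bar>p - q\<bar> + int m)" by (simp add: R_def)
      moreover have "\<bar>p - q\<bar> + int m = 0 \<or> \<bar>p - q\<bar> + int m \<ge> 1" by linarith
      ultimately show ?thesis by (metis of_int_0 of_int_1 of_int_le_iff)
    qed
    have D_card: "real (card A) \<le> D" unfolding D_def using sum_mono[of A "\<lambda>_. 1" r] r by simp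
    have D01: "D = 0 \<or> D \<ge> 1"
    proof (cases "A = {}")
      case False
      then have "1 \<le> card A" using A by (simp add: card_gt_0_iff Suc_le_eq)
      then show ?thesis using D_card by linarith
    qed (simp add: D_def)
    have RD: "R + D \<ge> 1"
    proof (cases "A = {}")
      case True
      then have "f = g" by (auto simp: A_def)
      then have "p \<noteq> q" using xy eq by auto
      then show ?thesis using R01 by (auto simp: R_def D_def sum_nonneg True)
    next
      case False
      then have "1 \<le> card A" using A by (simp add: card_gt_0_iff Suc_le_eq)
      then show ?thesis using D_card by (simp add: R_def)
    qed
    have SR: "R powr \<sigma> / 36 \<le> S"
    proof (cases "R = 0")
      case True
      then show ?thesis using S1(1) by (simp add: order_trans[OF zero_le_power2])
    next
      case False
      then have R1: "R \<ge> 1" using R01 by auto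
      show ?thesis
      \<comment> \<open>Either the width comes from a lamp far from both positions, seen in the tails, or it is comparable to the distance of the positions.\<close>
      proof (cases "2 * \<bar>p - q\<bar> \<le> int m")
        case True
        have "m \<in> insert 0 ((\<lambda>z. nat \<bar>z - p\<bar>) ` A)" unfolding m_def using A by (intro Max_in) auto
        moreover have "m \<noteq> 0"
        proof
          assume "m = 0"
          with True have "p = q" by simp
          with \<open>m = 0\<close> \<open>R \<noteq> 0\<close> show False by (simp add: R_def)
        qed
        ultimately obtain z where z: "z \<in> A" "m = nat \<bar>z - p\<bar>" by auto
        have half: "(R / 6) powr \<sigma> \<le> (real_of_int d / 2) powr (2 * s + 1)" if d: "int m - \<bar>p - q\<bar> \<le> d" for d
        proof -
          have "R = real_of_int (\<bar>p - q\<bar> + int m)" by (simp add: R_def)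
          also have "\<dots> \<le> real_of_int (3 * d)"
          proof -
            have "2 * e \<le> int m \<Longrightarrow> int m - e \<le> d \<Longrightarrow> e + int m \<le> 3 * d" for e by linarith
            from this[OF True d] show ?thesis unfolding of_int_le_iff .
          qed
          finally have "R \<le> 3 * real_of_int d" by simp
          then show ?thesis unfolding s(3) using R1 \<sigma> by (intro powr_mono2) auto
        qed
        have "(R / 6) powr \<sigma> \<le> S"
        proof (cases "z > p")
          case zp: True
          have mz: "int m = z - p" using z zp by simp
          with True have far: "max p q \<le> z" by (auto simp: max_def abs_if split: if_splits)
          have "(real_of_int (z - max p q) / 2) powr (2 * s + 1) \<le> sqdist (tails G s f p) (tails G s g q)"
            using f(2) g(2) s(1) z(1) far by (intro sqdist_tails_ge) (auto simp: A_def)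
          moreover have "int m - \<bar>p - q\<bar> \<le> z - max p q" using mz by (auto simp: max_def abs_if)
          ultimately show ?thesis using half S1(2) by fastforce
        next
          case zp: False
          have mz: "int m = p - z" using z zp by simp
          with True have far: "max (- p) (- q) \<le> - z" by (auto simp: max_def abs_if split: if_splits)
          have "(real_of_int (- z - max (- p) (- q)) / 2) powr (2 * s + 1) \<le>
            sqdist (tails G s (\<lambda>z. f (- z)) (- p)) (tails G s (\<lambda>z. g (- z)) (- q))"
            using f(2) g(2) s(1) z(1) far by (intro sqdist_tails_ge refl_fin) (auto simp: A_def)
          moreover have "int m - \<bar>p - q\<bar> \<le> - z - max (- p) (- q)" using mz by (auto simp: max_def abs_if)
          ultimately show ?thesis using half S1(3) by fastforce
        qed
        moreover have "R powr \<sigma> / 36 \<le> (R / 6) powr \<sigma>"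
        proof -
          have "6 powr \<sigma> \<le> (6 powr 2 :: real)" using \<sigma> by (intro powr_mono) auto
          then have "R powr \<sigma> / 36 \<le> R powr \<sigma> / 6 powr \<sigma>" by (intro divide_left_mono) auto
          also have "\<dots> = (R / 6) powr \<sigma>" using R1 by (simp add: powr_divide)
          finally show ?thesis .
        qed
        ultimately show ?thesis by linarith
      next
        case False
        have "R powr \<sigma> \<le> R powr 2" using R1 \<sigma> by (intro powr_mono) auto
        also have "\<dots> = R\<^sup>2" using R1 by simp
        also have "\<dots> \<le> (3 * real_of_int \<bar>p - q\<bar>)\<^sup>2"
        proof (intro power_mono)
          have "R = real_of_int (\<bar>p - q\<bar> + int m)" by (simp add: R_def)
          also have "\<dots> \<le> real_of_int (3 * \<bar>p - q\<bar>)" 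
          proof -
            have "\<not> 2 * e \<le> int m \<Longrightarrow> e + int m \<le> 3 * e" for e by linarith
            from this[OF False] show ?thesis unfolding of_int_le_iff .
          qed
          finally show "R \<le> 3 * real_of_int \<bar>p - q\<bar>" by simp
        qed (use R1 in auto)
        also have "\<dots> = 9 * (real_of_int p - real_of_int q)\<^sup>2" by (simp add: power_mult_distrib)
        finally show ?thesis
          using S1(1) zero_le_power2[of "real_of_int p - real_of_int q"] by linarith
      qed
    qed
    have n3: "real (card A) \<le> 3 * max 1 R"
    proof -
      have "A \<subseteq> {p - int m..p + int m}" using m by fastforce
      then have "card A \<le> card {p - int m..p + int m}" by (intro card_mono) auto
      then have "real (card A) \<le> 2 * real m + 1" by (simp add: nat_add_distrib)
      moreover have "real m \<le> max 1 R" by (simp add: R_def le_max_iff_disj)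
      moreover have "1 \<le> max 1 R" by simp
      ultimately show ?thesis by linarith
    qed
    have SD: "c * (real (card A) powr (1 - 2 * \<alpha>) * D powr (2 * \<alpha>)) \<le> S" if "D \<ge> 1"
    proof -
      have "real (card A) powr (1 - 2 * \<alpha>) * D powr (2 * \<alpha>) \<le> (\<Sum>z\<in>A. r z powr (2 * \<alpha>))"
        unfolding D_def using A \<alpha> r that by (intro sum_powr_power_mean) (auto simp: D_def order_trans[OF zero_le_one])
      then have "c * (real (card A) powr (1 - 2 * \<alpha>) * D powr (2 * \<alpha>)) \<le> c * (\<Sum>z\<in>A. r z powr (2 * \<alpha>))"
        using c by (intro mult_left_mono) auto
      also have "\<dots> \<le> (\<Sum>z\<in>A. sqdist (\<theta> (f z)) (\<theta> (g z)))"
        unfolding sum_distrib_left r_def using f g by (intro sum_mono c) (auto simp: A_def)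
      finally show ?thesis using S1(4) by linarith
    qed
    have n0: "real (card A) > 0" if "D \<ge> 1"
      using that A by (cases "A = {}") (auto simp: D_def card_gt_0_iff)
    have "c' * (R + D) powr (2 * \<alpha>') \<le> S"
      unfolding c'_def using \<alpha> \<alpha>' \<sigma> \<sigma>\<tau> c(1) R01 D01 RD SR n0 n3 SD
      by (intro worst_width[where n = "real (card A)" and \<sigma> = \<sigma>]) auto
    then show ?thesis by (simp add: tour S_def)
  qed
  have "c' > 0" using c by (simp add: c'_def)
  then have "embeds (wr G) (tour G \<rho>) \<alpha>' ?E"
    unfolding embeds_def using E1 Efin upper lower by blast
  then show ?thesis by blast
qed

lemma embeds_int: "\<exists>\<theta>. embeds int_copy int_abs 1 \<theta>"
proof
  define \<theta> where "\<theta> = (\<lambda>w i. if i = Pos then real_of_int (pos w) else 0)"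
  have sq: "sqdist (\<theta> (Base x)) (\<theta> (Base y)) = (real_of_int x - real_of_int y)\<^sup>2" for x y
    by (subst sqdist_eq[of "{Pos}"]) (auto simp: \<theta>_def)
  show "embeds int_copy int_abs 1 \<theta>"
    unfolding embeds_def
  proof (intro conjI ballI)
    fix h assume "h \<in> carrier int_copy"
    then obtain y where "h = Base y" by (auto simp: carrier_int_copy)
    then show "\<exists>L. \<forall>x\<in>carrier int_copy. sqdist (\<theta> x) (\<theta> (x \<otimes>\<^bsub>int_copy\<^esub> h)) \<le> L"
      by (intro exI[of _ "(real_of_int y)\<^sup>2"]) (auto simp: carrier_int_copy int_copy_mult sq)
  next
    show "\<exists>c>0. \<forall>x\<in>carrier int_copy. \<forall>y\<in>carrier int_copy. x \<noteq> y \<longrightarrow>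
      c * int_abs (inv\<^bsub>int_copy\<^esub> x \<otimes>\<^bsub>int_copy\<^esub> y) powr (2 * 1) \<le> sqdist (\<theta> x) (\<theta> y)"
      by (intro exI[of _ 1]) (auto simp: carrier_int_copy int_copy_inv int_copy_mult sq power2_commute)
  qed (auto simp: \<theta>_def int_copy_one carrier_int_copy)
qed

section \<open>Word metrics\<close>

locale word_metric = group G for G :: "('a, 'm) monoid_scheme" (structure) +
  fixes S :: "'a set"
  assumes finite_S: "finite S" and generating: "symmetric_generating_set G S"
begin

abbreviation word_prod :: "'a list \<Rightarrow> 'a"
  where "word_prod w \<equiv> foldr (\<lambda>s h. s \<otimes> h) w \<one>"

abbreviation word_len :: "'a \<Rightarrow> nat"
  where "word_len \<equiv> word_length G S"

lemma S_closed: "s \<in> S \<Longrightarrow> s \<in> carrier G" and S_inv: "s \<in> S \<Longrightarrow> inv s \<in> S"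
  using generating by (auto simp: symmetric_generating_set_def)

lemma word_prod_closed: "set w \<subseteq> S \<Longrightarrow> word_prod w \<in> carrier G"
  using S_closed by (induction w) auto

lemma word_prod_append: "set v \<subseteq> S \<Longrightarrow> set w \<subseteq> S \<Longrightarrow> word_prod (v @ w) = word_prod v \<otimes> word_prod w"
proof (induction v)
  case (Cons s v)
  then show ?case using S_closed word_prod_closed by (simp add: m_assoc)
qed (simp add: word_prod_closed)

lemma word_exists:
  assumes "g \<in> carrier G"
  shows "\<exists>w. set w \<subseteq> S \<and> word_prod w = g"
proof -
  have "g \<in> generate G S" using assms generating by (simp add: symmetric_generating_set_def)
  then show ?thesis
  proof induction
    case one
    then show ?case by (intro exI[of _ "[]"]) simp
  next
    case (incl h)
    then show ?case using S_closed by (intro exI[of _ "[h]"]) simp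
  next
    case (inv h)
    then show ?case using S_closed S_inv by (intro exI[of _ "[inv h]"]) simp
  next
    case (eng h1 h2)
    then obtain v w where "set v \<subseteq> S" "word_prod v = h1" "set w \<subseteq> S" "word_prod w = h2" by blast
    then show ?case by (intro exI[of _ "v @ w"]) (simp add: word_prod_append del: foldr_append)
  qed
qed

lemma word_length_witness:
  assumes "g \<in> carrier G"
  obtains w where "length w = word_len g" "set w \<subseteq> S" "word_prod w = g"
proof -
  have "\<exists>n. \<exists>w. length w = n \<and> set w \<subseteq> S \<and> word_prod w = g"
    using word_exists[OF assms] by blast
  from LeastI_ex[OF this] show ?thesis using that unfolding word_length_def by blast
qed

lemma word_length_le: "set w \<subseteq> S \<Longrightarrow> word_len (word_prod w) \<le> length w"
  unfolding word_length_def by (rule Least_le) blast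

lemma subadditive_word_length: "group_length G (\<lambda>g. real (word_len g))"
proof -
  have "word_len (x \<otimes> y) \<le> word_len x + word_len y" if xy: "x \<in> carrier G" "y \<in> carrier G" for x y
  proof -
    obtain v where v: "length v = word_len x" "set v \<subseteq> S" "word_prod v = x"
      using word_length_witness[OF xy(1)] .
    obtain w where w: "length w = word_len y" "set w \<subseteq> S" "word_prod w = y"
      using word_length_witness[OF xy(2)] .
    have "word_prod (v @ w) = x \<otimes> y" using word_prod_append[OF v(2) w(2)] v(3) w(3) by (simp only:)
    then show ?thesis using word_length_le[of "v @ w"] v w by (simp del: foldr_append)
  qed
  moreover have "word_len \<one> = 0" using word_length_le[of "[]"] by simp
  ultimately show ?thesis by (simp add: group_length_def flip: of_nat_add)
qed

lemma subadditive_le_word_length: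
  assumes N: "group_length G N"
  shows "\<exists>M>0. \<forall>g\<in>carrier G. N g \<le> M * real (word_len g)"
proof -
  define M where "M = Max (insert 1 (N ` S))"
  have M: "1 \<le> M" "\<And>s. s \<in> S \<Longrightarrow> N s \<le> M" using finite_S by (auto simp: M_def)
  have "N (word_prod w) \<le> M * real (length w)" if "set w \<subseteq> S" for w
    using that
  proof (induction w)
    case (Cons s w)
    have "N (s \<otimes> word_prod w) \<le> N s + N (word_prod w)"
      using N Cons.prems S_closed word_prod_closed by (auto simp: group_length_def)
    then show ?case using Cons M(2)[of s] by (simp add: algebra_simps)
  qed (use N in \<open>simp add: group_length_def\<close>)
  then have "N g \<le> M * real (word_len g)" if "g \<in> carrier G" for g
    using word_length_witness[OF that] by metis
  then show ?thesis using M(1) by (intro exI[of _ M]) auto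
qed

lemma countable_carrier: "countable (carrier G)"
proof -
  have "carrier G \<subseteq> word_prod ` lists S" using word_exists by (force simp: lists_eq_set)
  moreover have "countable (word_prod ` lists S)" using finite_S by (intro countable_image countable_lists countable_finite)
  ultimately show ?thesis by (rule countable_subset)
qed

lemma word_ball_bound: "finite (word_ball G S r)" "card (word_ball G S r) \<le> (card S + 1) ^ r"
proof -
  let ?W = "{w. set w \<subseteq> S \<and> length w \<le> r}"
  have fin: "finite ?W" by (rule finite_lists_length_le[OF finite_S])
  have sub: "word_ball G S r \<subseteq> (\<lambda>w. inv (word_prod w)) ` ?W"
  proof
    fix x assume "x \<in> word_ball G S r"
    then have x: "x \<in> carrier G" "word_len (inv x) \<le> r" by (auto simp: word_ball_def word_dist_def)
    obtain w where w: "length w = word_len (inv x)" "set w \<subseteq> S" "word_prod w = inv x"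
      using word_length_witness[of "inv x"] x by auto
    then have "inv (word_prod w) = x" using x by simp
    then show "x \<in> (\<lambda>w. inv (word_prod w)) ` ?W" using w x by (intro image_eqI[of _ _ w]) auto
  qed
  then show "finite (word_ball G S r)" using fin finite_subset by blast
  have "card (word_ball G S r) \<le> card ((\<lambda>w. inv (word_prod w)) ` ?W)" using sub fin by (intro card_mono) auto
  also have "\<dots> \<le> card ?W" by (rule card_image_le[OF fin])
  also have "\<dots> = (\<Sum>i\<le>r. card S ^ i)" by (rule card_lists_length_le[OF finite_S])
  also have "\<dots> \<le> (card S + 1) ^ r"
  proof (induction r)
    case (Suc r)
    have "(\<Sum>i\<le>Suc r. card S ^ i) = 1 + card S * (\<Sum>i\<le>r. card S ^ i)"
      by (simp only: sum.atMost_Suc_shift) (simp add: sum_distrib_left)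
    also have "\<dots> \<le> (card S + 1) ^ r + card S * (card S + 1) ^ r" using Suc by (intro add_mono mult_left_mono) auto
    finally show ?case by simp
  qed simp
  finally show "card (word_ball G S r) \<le> (card S + 1) ^ r" .
qed

end


section \<open>Upper bound for the compression exponent\<close>

lemma L2_diff_integrable:
  assumes "f \<in> L2_functions" "g \<in> L2_functions"
  shows "integrable (lebesgue_on {0..1}) (\<lambda>t. (f t - g t)\<^sup>2)"
proof (rule Bochner_Integration.integrable_bound)
  have "integrable (lebesgue_on {0..1}) (\<lambda>t. (f t)\<^sup>2)" "integrable (lebesgue_on {0..1}) (\<lambda>t. (g t)\<^sup>2)"
    using assms by (auto simp: L2_functions_def)
  then show "integrable (lebesgue_on {0..1}) (\<lambda>t. 2 * (f t)\<^sup>2 + 2 * (g t)\<^sup>2)" by auto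
  show "(\<lambda>t. (f t - g t)\<^sup>2) \<in> borel_measurable (lebesgue_on {0..1})"
    using assms by (auto simp: L2_functions_def)
  have "(a - b)\<^sup>2 \<le> 2 * a\<^sup>2 + 2 * b\<^sup>2" for a b :: real
    using zero_le_power2[of "a + b"] by (simp add: power2_eq_square algebra_simps)
  then show "AE t in lebesgue_on {0..1}. norm ((f t - g t)\<^sup>2) \<le> norm (2 * (f t)\<^sup>2 + 2 * (g t)\<^sup>2)" by simp
qed

lemma L2_norm_square: "(L2_norm f)\<^sup>2 = (\<integral>t. (f t)\<^sup>2 \<partial>lebesgue_on {0..1})"
  by (simp add: L2_norm_def)

lemma exponent_le_1_if_dyadic_bound:
  fixes e C :: real
  assumes "C > 0" "\<And>j::nat. (2 ^ j) powr e \<le> C * 2 ^ j"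
  shows "e \<le> 1"
proof (rule ccontr)
  assume "\<not> e \<le> 1"
  then have e: "e - 1 > 0" by simp
  obtain j :: nat where j: "ln C / ((e - 1) * ln 2) < j" using reals_Archimedean2 by blast
  have "ln ((2 ^ j) powr e) \<le> ln (C * 2 ^ j)" using assms by (subst ln_le_cancel_iff) auto
  then have "e * (j * ln 2) \<le> ln C + j * ln 2"
    using assms(1) by (simp add: ln_mult ln_powr ln_realpow)
  then have "j * ((e - 1) * ln 2) \<le> ln C" by (simp add: algebra_simps)
  moreover have "ln C < j * ((e - 1) * ln 2)" using j e by (simp add: field_simps)
  ultimately show False by simp
qed

text \<open>A Lipschitz map moves by at most \<open>O(sqrt n)\<close> during \<open>n\<close> steps of the walk, by Markov type 2,
  applied on a Folner set so large that most starting points do not feel its boundary. As the walk has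
  moved by \<open>n powr \<beta>\<close> on average, the compression is at most \<open>n powr (1 / 2)\<close> at distance
  \<open>n powr \<beta>\<close>. Steps are only doubled, so that \<open>n\<close> is a power of 2.\<close>

lemma (in word_metric) compression_le:
  assumes T: "symmetric_steps G T" and fol: "folner G" and N: "group_length G N"
    and speed: "has_speed G T N \<beta>" and \<beta>: "0 < \<beta>" "\<beta> \<le> 1"
    and lip: "lipschitz_into_L2 G S f" and c: "c > 0"
    and compression: "\<And>x y. x \<in> carrier G \<Longrightarrow> y \<in> carrier G \<Longrightarrow> x \<noteq> y \<Longrightarrow>
      c * real (word_dist G S x y) powr \<alpha> \<le> L2_norm (\<lambda>t. f x t - f y t)"
  shows "\<alpha> \<le> 1 / (2 * \<beta>)"
proof (cases "\<alpha> \<le> 1 / 2")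
  case True
  have "1 / 2 \<le> 1 / (2 * \<beta>)" using \<beta> by (simp add: field_simps)
  with True show ?thesis by linarith
next
  case False
  then have \<alpha>: "1 < 2 * \<alpha>" by simp
  have T': "T \<noteq> []" "set T \<subseteq> carrier G" using T by (auto simp: symmetric_steps_def)
  have N0: "\<And>x. x \<in> carrier G \<Longrightarrow> 0 \<le> N x" using N by (simp add: group_length_def)
  obtain M where M: "M > 0" "\<And>g. g \<in> carrier G \<Longrightarrow> N g \<le> M * real (word_len g)"
    using subadditive_le_word_length[OF N] by blast
  obtain c0 where c0: "c0 > 0" "\<And>n. c0 * real n powr \<beta> \<le> (step G T ^^ n) N \<one>"
    using speed by (auto simp: has_speed_def)
  obtain L where L: "\<And>x y. x \<in> carrier G \<Longrightarrow> y \<in> carrier G \<Longrightarrow>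
      L2_norm (\<lambda>t. f x t - f y t) \<le> L * real (word_dist G S x y)"
    and fL2: "\<And>x. x \<in> carrier G \<Longrightarrow> f x \<in> L2_functions"
    using lip by (auto simp: lipschitz_into_L2_def)
  define D where "D = (\<lambda>x y. \<integral>t. (f y t - f x t)\<^sup>2 \<partial>lebesgue_on {0..1})"
  have D: "D x y = (L2_norm (\<lambda>t. f y t - f x t))\<^sup>2" "D x y = (L2_norm (\<lambda>t. f x t - f y t))\<^sup>2" for x y
    unfolding D_def L2_norm_square by (simp_all add: power2_commute)
  have D0: "0 \<le> D x y" "D x x = 0" for x y by (simp_all add: D_def)
  have L2n: "0 \<le> L2_norm g" for g by (simp add: L2_norm_def)
  define a where "a = real (Max (word_len ` set T))"
  define B where "B = (\<bar>L\<bar> * a)\<^sup>2"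
  define c1 where "c1 = c\<^sup>2 * (1 / M) powr (2 * \<alpha>)"
  have c1: "c1 > 0" using c M by (simp add: c1_def)
  define C where "C = (2 * (B + 1)) / (c1 * c0 powr (2 * \<alpha>))"
  have C: "C > 0" using c1 c0 by (simp add: C_def B_def add_nonneg_pos)
  have upper: "D x (x \<otimes> s) \<le> B" if "x \<in> carrier G" "s \<in> set T" for x s
  proof -
    have s: "s \<in> carrier G" using that T' by auto
    have "inv x \<otimes> (x \<otimes> s) = s" using that s by (simp flip: m_assoc)
    then have "L2_norm (\<lambda>t. f x t - f (x \<otimes> s) t) \<le> L * real (word_len s)"
      using L[of x "x \<otimes> s"] that s by (simp add: word_dist_def)
    also have "\<dots> \<le> \<bar>L\<bar> * a"
      using that by (intro mult_mono) (auto simp: a_def)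
    finally have "L2_norm (\<lambda>t. f x t - f (x \<otimes> s) t) \<le> \<bar>L\<bar> * a" .
    then show ?thesis unfolding D(2) B_def using L2n by (intro power_mono) auto
  qed
  have lower: "c1 * N (inv x \<otimes> y) powr (2 * \<alpha>) \<le> D x y" if xy: "x \<in> carrier G" "y \<in> carrier G" for x y
  proof (cases "x = y")
    case True
    have "N (inv x \<otimes> y) = 0" using True xy N by (simp add: group_length_def)
    then show ?thesis using D0 True by simp
  next
    case False
    have "N (inv x \<otimes> y) powr (2 * \<alpha>) \<le> (M * real (word_dist G S x y)) powr (2 * \<alpha>)"
      using M N0 xy \<alpha> by (intro powr_mono2) (auto simp: word_dist_def)
    then have "c1 * N (inv x \<otimes> y) powr (2 * \<alpha>) \<le> c1 * (M * real (word_dist G S x y)) powr (2 * \<alpha>)"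
      using c1 by simp
    also have "\<dots> = (c * real (word_dist G S x y) powr \<alpha>)\<^sup>2"
    proof -
      define d where "d = real (word_dist G S x y)"
      have "(1 / M) powr (2 * \<alpha>) * (M * d) powr (2 * \<alpha>) = (1 / M * (M * d)) powr (2 * \<alpha>)"
        using M by (intro powr_mult[symmetric])
      also have "1 / M * (M * d) = d" using M by simp
      also have "d powr (2 * \<alpha>) = (d powr \<alpha>)\<^sup>2"
        unfolding power2_eq_square powr_add[symmetric] mult_2 ..
      finally show ?thesis by (simp add: c1_def d_def power_mult_distrib mult.assoc)
    qed
    also have "\<dots> \<le> D x y"
      unfolding D(2) using compression[OF xy False] c by (intro power_mono) auto
    finally show ?thesis .
  qed
  have "(2 ^ j) powr (\<beta> * (2 * \<alpha>)) \<le> C * 2 ^ j" for j :: nat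
  proof -
    define n where "n = (2::nat) ^ j"
    have n: "n > 0" by (simp add: n_def)
    interpret start: finite_walk G T "{}" by unfold_locales (auto simp: T)
    define K where "K = start.products n"
    have K: "finite K" "K \<subseteq> carrier G"
      using start.finite_products start.products_closed by (auto simp: K_def)
    obtain F where F: "finite F" "F \<noteq> {}" "F \<subseteq> carrier G"
      "real (card {x \<in> F. \<exists>h\<in>K. x \<otimes> h \<notin> F}) \<le> 1 / 2 * real (card F)"
      using fol[unfolded folner_def, rule_format, OF K, of "1 / 2"] by auto
    interpret W: finite_walk G T F by unfold_locales (use T F in auto)
    define good where "good = {x \<in> F. \<forall>h\<in>K. x \<otimes> h \<in> F}"
    have cF: "card F > 0" using F by (simp add: card_gt_0_iff)
    have "F = good \<union> {x \<in> F. \<exists>h\<in>K. x \<otimes> h \<notin> F}" by (auto simp: good_def)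
    moreover have "card (good \<union> {x \<in> F. \<exists>h\<in>K. x \<otimes> h \<notin> F}) = card good + card {x \<in> F. \<exists>h\<in>K. x \<otimes> h \<notin> F}"
      using F(1) by (intro card_Un_disjoint) (auto simp: good_def)
    ultimately have "card F = card good + card {x \<in> F. \<exists>h\<in>K. x \<otimes> h \<notin> F}" by simp
    then have good: "real (card F) / 2 \<le> real (card good)" using F(4) by simp
    define e where "e = (step G T ^^ n) N \<one>"
    have e: "c0 * real n powr \<beta> \<le> e" "e > 0"
      using c0(2)[of n] c0(1) n by (auto simp: e_def intro: less_le_trans[rotated])
    have far: "c1 * e powr (2 * \<alpha>) \<le> (W.Q 1 ^^ n) (D x) x" if x: "x \<in> good" for x
    proof -
      have xc: "x \<in> F" "x \<in> carrier G" using x F by (auto simp: good_def)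
      \<comment> \<open>The tangent of \<open>x powr (2 * \<alpha>)\<close> at the mean, so that Jensen's inequality needs only linearity.\<close>
      define \<psi> where "\<psi> = (\<lambda>y. c1 * (2 * \<alpha> * e powr (2 * \<alpha> - 1)) * N y + - (c1 * ((2 * \<alpha> - 1) * e powr (2 * \<alpha>))))"
      have "c1 * e powr (2 * \<alpha>) = c1 * (2 * \<alpha> * e powr (2 * \<alpha> - 1)) * e + - (c1 * ((2 * \<alpha> - 1) * e powr (2 * \<alpha>)))"
      proof -
        have "e powr (2 * \<alpha>) = e powr (2 * \<alpha> - 1) * e" using e by (simp add: powr_diff)
        then show ?thesis by (simp add: algebra_simps)
      qed
      also have "\<dots> = (step G T ^^ n) \<psi> \<one>"
        unfolding \<psi>_def step_pow_add step_pow_cmult step_pow_const[OF T'(1)] e_def ..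
      also have "\<dots> = (step G T ^^ n) (\<lambda>y. \<psi> (inv x \<otimes> y)) x"
        using step_pow_translate[OF is_monoid T'(2), of "inv x" x n \<psi>] xc by simp
      also have "\<dots> \<le> (step G T ^^ n) (D x) x"
      proof (rule step_pow_mono[OF is_monoid T'(2) _ xc(2)])
        fix y assume y: "y \<in> carrier G"
        have "2 * \<alpha> * e powr (2 * \<alpha> - 1) * N (inv x \<otimes> y) - (2 * \<alpha> - 1) * e powr (2 * \<alpha>) \<le> N (inv x \<otimes> y) powr (2 * \<alpha>)"
          using \<alpha> e N0 xc y by (intro powr_tangent) auto
        from mult_left_mono[OF this, of c1]
        have "\<psi> (inv x \<otimes> y) \<le> c1 * N (inv x \<otimes> y) powr (2 * \<alpha>)"
          using c1 by (simp add: \<psi>_def algebra_simps)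
        also have "\<dots> \<le> D x y" by (rule lower[OF xc(2) y])
        finally show "\<psi> (inv x \<otimes> y) \<le> D x y" .
      qed
      also have "\<dots> = (W.Q 1 ^^ n) (D x) x"
      proof (rule W.confined_eq_step[symmetric, OF xc(1)])
        fix h assume "h \<in> W.products n"
        then show "x \<otimes> h \<in> F" using x by (auto simp: good_def K_def)
      qed
      finally show ?thesis .
    qed
    have near: "W.Q 1 (D x) x \<le> B" if x: "x \<in> F" for x
      unfolding confined_def
    proof (rule avg_le[OF T'(1)])
      fix s assume "s \<in> set T"
      then show "(if x \<otimes> s \<in> F then D x (x \<otimes> s) else 1 * D x x) \<le> B"
        using upper[of x s] x F D0 by (auto simp: B_def)
    qed
    have "real (card good) * (c1 * e powr (2 * \<alpha>)) = (\<Sum>x\<in>good. c1 * e powr (2 * \<alpha>))" by simp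
    also have "\<dots> \<le> (\<Sum>x\<in>good. (W.Q 1 ^^ n) (D x) x)" by (intro sum_mono far)
    also have "\<dots> \<le> (\<Sum>x\<in>F. (W.Q 1 ^^ n) (D x) x)"
    proof (rule sum_mono2[OF F(1)])
      fix x assume "x \<in> F - good"
      then show "0 \<le> (W.Q 1 ^^ n) (D x) x"
        using W.confined_pow_mono[of "\<lambda>_. 0" "D x" x n] D0 W.confined_pow_const[of n 0] by simp
    qed (auto simp: good_def)
    also have "\<dots> \<le> 2 ^ j * (\<Sum>x\<in>F. W.Q 1 (D x) x)"
      unfolding n_def D_def using F(3) fL2 by (intro W.markov_type_L2 L2_diff_integrable) auto
    also have "\<dots> \<le> 2 ^ j * (\<Sum>x\<in>F. B)" using near by (intro mult_left_mono sum_mono) auto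
    also have "\<dots> = real n * (real (card F) * B)" by (simp add: n_def)
    finally have 1: "real (card good) * (c1 * e powr (2 * \<alpha>)) \<le> real n * (real (card F) * B)" .
    have "real (card F) / 2 * (c1 * (c0 * real n powr \<beta>) powr (2 * \<alpha>)) \<le> real (card good) * (c1 * e powr (2 * \<alpha>))"
      using good c1 c0(1) e \<alpha> by (intro mult_mono mult_left_mono powr_mono2) auto
    with 1 have "real (card F) / 2 * (c1 * (c0 * real n powr \<beta>) powr (2 * \<alpha>)) \<le> real n * (real (card F) * B)" by linarith
    also have "\<dots> = real (card F) / 2 * (2 * B * real n)" by simp
    finally have "c1 * (c0 * real n powr \<beta>) powr (2 * \<alpha>) \<le> 2 * B * real n"
      using cF by (simp add: mult_le_cancel_left_pos)
    also have "\<dots> \<le> 2 * (B + 1) * real n" by (intro mult_right_mono) auto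
    finally have "c1 * (c0 powr (2 * \<alpha>) * real n powr (\<beta> * (2 * \<alpha>))) \<le> 2 * (B + 1) * real n"
      using c0(1) by (simp add: powr_mult powr_powr)
    then have "real n powr (\<beta> * (2 * \<alpha>)) \<le> C * real n"
      using c1 c0(1) by (simp add: C_def field_simps)
    then show ?thesis by (simp add: n_def)
  qed
  from exponent_le_1_if_dyadic_bound[OF C this] have "\<beta> * (2 * \<alpha>) \<le> 1" .
  then show ?thesis using \<beta> by (simp add: field_simps)
qed


section \<open>Lower bound for the compression exponent\<close>

text \<open>Countably many coordinates are realised in \<open>L\<^sub>2([0,1])\<close> by normalised indicator functions of
  disjoint intervals.\<close>

definition block :: "nat \<Rightarrow> real set"
  where "block n = {1 / (real n + 2)<..1 / (real n + 1)}"

definition block_height :: "nat \<Rightarrow> real"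
  where "block_height n = sqrt ((real n + 1) * (real n + 2))"

lemma block_disjoint:
  assumes "t \<in> block m" "t \<in> block n"
  shows "m = n"
proof -
  have "m \<le> n" if "t \<in> block m" "t \<in> block n" for m n
  proof -
    have "1 / (real n + 2) < 1 / (real m + 1)" using that by (auto simp: block_def)
    then show ?thesis by (simp add: field_simps)
  qed
  with assms show ?thesis by (meson antisym)
qed

lemma block_integral:
  "integrable (lebesgue_on {0..1}) (\<lambda>t. (block_height n)\<^sup>2 * indicator (block n) t)"
  "(\<integral>t. (block_height n)\<^sup>2 * indicator (block n) t \<partial>lebesgue_on {0..1}) = 1"
proof -
  have sub: "block n \<subseteq> {0..1}"
  proof
    fix t assume "t \<in> block n"
    then have "1 / (real n + 2) < t" "t \<le> 1 / (real n + 1)" by (auto simp: block_def)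
    moreover have "0 \<le> 1 / (real n + 2)" "1 / (real n + 1) \<le> 1" by auto
    ultimately have "0 \<le> t" "t \<le> 1" by linarith+
    then show "t \<in> {0..1}" by simp
  qed
  have le: "1 / (real n + 2) \<le> 1 / (real n + 1)" by (simp add: field_simps)
  have sets: "block n \<in> sets (lebesgue_on {0..1})"
    using sub by (subst sets_restrict_space_iff) (auto simp: block_def)
  have "measure lebesgue (block n) = 1 / (real n + 1) - 1 / (real n + 2)"
    by (simp add: block_def measure_completion field_simps)
  also have "\<dots> = 1 / ((real n + 1) * (real n + 2))" by (simp add: field_simps)
  finally have m: "measure (lebesgue_on {0..1}) (block n) = 1 / ((real n + 1) * (real n + 2))"
    using sub by (subst measure_restrict_space) auto
  have fin: "emeasure (lebesgue_on {0..1}) (block n) < \<infinity>"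
  proof -
    have "emeasure (lebesgue_on {0..1}) (block n) = emeasure lebesgue (block n)"
      using sub by (subst emeasure_restrict_space) auto
    also have "\<dots> < \<infinity>" using le by (simp add: block_def)
    finally show ?thesis .
  qed
  show "integrable (lebesgue_on {0..1}) (\<lambda>t. (block_height n)\<^sup>2 * indicator (block n) t)"
    using sets fin by (intro integrable_mult_right integrable_real_indicator)
  have "(\<integral>t. (block_height n)\<^sup>2 * indicator (block n) t \<partial>lebesgue_on {0..1}) =
    (block_height n)\<^sup>2 * measure (lebesgue_on {0..1}) (block n)"
    using sets sub by (simp add: Int_absorb2)
  then show "(\<integral>t. (block_height n)\<^sup>2 * indicator (block n) t \<partial>lebesgue_on {0..1}) = 1"
    by (simp add: m block_height_def)
qed

lemma L2_realisation:
  fixes \<theta> :: "'a \<Rightarrow> 'i \<Rightarrow> real"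
  assumes X: "countable X" and fin: "\<And>x. x \<in> X \<Longrightarrow> finite {i. \<theta> x i \<noteq> 0}"
  shows "\<exists>\<Phi>. \<Phi> \<in> X \<rightarrow> L2_functions \<and> (\<forall>x\<in>X. \<forall>y\<in>X. L2_norm (\<lambda>t. \<Phi> x t - \<Phi> y t) = sqrt (sqdist (\<theta> x) (\<theta> y)))"
proof -
  define I where "I = (\<Union>x\<in>X. {i. \<theta> x i \<noteq> 0})"
  have "countable I" unfolding I_def by (intro countable_UN X countable_finite fin)
  then obtain e :: "'i \<Rightarrow> nat" where e: "inj_on e I" by (auto simp: countable_def)
  define b where "b = (\<lambda>i t. block_height (e i) * indicator (block (e i)) t :: real)"
  have sq: "(\<Sum>i\<in>A. a i * b i t)\<^sup>2 = (\<Sum>i\<in>A. (a i)\<^sup>2 * ((block_height (e i))\<^sup>2 * indicator (block (e i)) t))"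
    if A: "finite A" "A \<subseteq> I" for A a t
  proof -
    have off: "b i t * b j t = 0" if "i \<in> A" "j \<in> A" "i \<noteq> j" for i j
    proof -
      have "e i \<noteq> e j" using that A e by (meson inj_onD subsetD)
      then show ?thesis using block_disjoint[of t "e i" "e j"] by (auto simp: b_def indicator_def)
    qed
    have "(\<Sum>i\<in>A. a i * b i t)\<^sup>2 = (\<Sum>i\<in>A. \<Sum>j\<in>A. (a i * b i t) * (a j * b j t))"
      by (simp add: power2_eq_square sum_product)
    also have "\<dots> = (\<Sum>i\<in>A. \<Sum>j\<in>A. if j = i then (a i * b i t)\<^sup>2 else 0)"
    proof (intro sum.cong refl)
      fix i j assume "i \<in> A" "j \<in> A"
      then show "(a i * b i t) * (a j * b j t) = (if j = i then (a i * b i t)\<^sup>2 else 0)"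
        using off[of i j] by (auto simp: power2_eq_square)
    qed
    also have "\<dots> = (\<Sum>i\<in>A. (a i * b i t)\<^sup>2)" using A by (simp add: sum.delta)
    finally have "(\<Sum>i\<in>A. a i * b i t)\<^sup>2 = (\<Sum>i\<in>A. (a i * b i t)\<^sup>2)" .
    moreover have "(b i t)\<^sup>2 = (block_height (e i))\<^sup>2 * indicator (block (e i)) t" for i
      by (cases "t \<in> block (e i)") (auto simp: b_def)
    ultimately show ?thesis by (simp add: power_mult_distrib)
  qed
  have int: "integrable (lebesgue_on {0..1}) (\<lambda>t. (\<Sum>i\<in>A. a i * b i t)\<^sup>2)"
    "(\<integral>t. (\<Sum>i\<in>A. a i * b i t)\<^sup>2 \<partial>lebesgue_on {0..1}) = (\<Sum>i\<in>A. (a i)\<^sup>2)"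
    if A: "finite A" "A \<subseteq> I" for A a
  proof -
    show "integrable (lebesgue_on {0..1}) (\<lambda>t. (\<Sum>i\<in>A. a i * b i t)\<^sup>2)"
      unfolding sq[OF A] using block_integral(1) by (intro Bochner_Integration.integrable_sum integrable_mult_right) auto
    have "(\<integral>t. (\<Sum>i\<in>A. a i * b i t)\<^sup>2 \<partial>lebesgue_on {0..1}) =
      (\<Sum>i\<in>A. \<integral>t. (a i)\<^sup>2 * ((block_height (e i))\<^sup>2 * indicator (block (e i)) t) \<partial>lebesgue_on {0..1})"
      unfolding sq[OF A] using block_integral(1) by (intro Bochner_Integration.integral_sum integrable_mult_right) auto
    also have "\<dots> = (\<Sum>i\<in>A. (a i)\<^sup>2 * 1)"
      unfolding integral_mult_right_zero[of _ "(a _)\<^sup>2"] block_integral(2) ..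
    finally show "(\<integral>t. (\<Sum>i\<in>A. a i * b i t)\<^sup>2 \<partial>lebesgue_on {0..1}) = (\<Sum>i\<in>A. (a i)\<^sup>2)" by simp
  qed
  define \<Phi> where "\<Phi> = (\<lambda>x t. \<Sum>i | \<theta> x i \<noteq> 0. \<theta> x i * b i t)"
  have supp: "finite {i. \<theta> x i \<noteq> 0}" "{i. \<theta> x i \<noteq> 0} \<subseteq> I" if "x \<in> X" for x
    using that fin by (auto simp: I_def)
  have meas: "b i \<in> borel_measurable (lebesgue_on {0..1})" for i
  proof -
    have "block n \<inter> {0..1} \<in> sets (lebesgue_on {0..1})" for n
      by (rule sets_restrict_space_iff[THEN iffD2]) (auto simp: block_def)
    then have "(indicator (block n) :: real \<Rightarrow> real) \<in> borel_measurable (lebesgue_on {0..1})" for n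
      by (subst borel_measurable_indicator_iff) auto
    then show ?thesis unfolding b_def by (intro borel_measurable_times borel_measurable_const)
  qed
  have "\<Phi> \<in> X \<rightarrow> L2_functions"
    using int(1)[OF supp] meas by (auto simp: \<Phi>_def L2_functions_def intro!: borel_measurable_sum borel_measurable_times)
  moreover have "L2_norm (\<lambda>t. \<Phi> x t - \<Phi> y t) = sqrt (sqdist (\<theta> x) (\<theta> y))" if "x \<in> X" "y \<in> X" for x y
  proof -
    define A where "A = {i. \<theta> x i \<noteq> 0} \<union> {i. \<theta> y i \<noteq> 0}"
    have A: "finite A" "A \<subseteq> I" using supp that by (auto simp: A_def)
    have ext: "\<Phi> w t = (\<Sum>i\<in>A. \<theta> w i * b i t)" if "{i. \<theta> w i \<noteq> 0} \<subseteq> A" for w t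
      unfolding \<Phi>_def using A that by (intro sum.mono_neutral_left) auto
    have "\<Phi> x t - \<Phi> y t = (\<Sum>i\<in>A. (\<theta> x i - \<theta> y i) * b i t)" for t
      by (simp add: ext A_def left_diff_distrib sum_subtractf)
    then have "L2_norm (\<lambda>t. \<Phi> x t - \<Phi> y t) = sqrt (\<Sum>i\<in>A. (\<theta> x i - \<theta> y i)\<^sup>2)"
      using int(2)[OF A] by (simp add: L2_norm_def)
    also have "(\<Sum>i\<in>A. (\<theta> x i - \<theta> y i)\<^sup>2) = sqdist (\<theta> x) (\<theta> y)"
      using A by (intro sqdist_eq[symmetric]) (auto simp: A_def)
    finally show ?thesis .
  qed
  ultimately show ?thesis by blast
qed

lemma sqrt_sqdist_triangle:
  assumes "finite {i. u i \<noteq> 0}" "finite {i. v i \<noteq> 0}" "finite {i. w i \<noteq> (0::real)}"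
  shows "sqrt (sqdist u w) \<le> sqrt (sqdist u v) + sqrt (sqdist v w)"
proof -
  define A where "A = {i. u i \<noteq> 0} \<union> {i. v i \<noteq> 0} \<union> {i. w i \<noteq> 0}"
  have A: "finite A" using assms by (simp add: A_def)
  have L2: "sqrt (sqdist a b) = L2_set (\<lambda>i. a i - b i) A" if "{i. a i \<noteq> b i} \<subseteq> A" for a b
    using sqdist_eq[OF A that] by (simp add: L2_set_def)
  have "L2_set (\<lambda>i. (u i - v i) + (v i - w i)) A \<le> L2_set (\<lambda>i. u i - v i) A + L2_set (\<lambda>i. v i - w i) A"
    by (rule L2_set_triangle_ineq)
  then show ?thesis by (subst (1 2 3) L2) (auto simp: A_def)
qed

lemma compression_ge:
  fixes G :: "iter_elem monoid"
  assumes "word_metric G S" and emb: "embeds G \<rho> \<alpha> \<theta>" and dom: "dominates G \<rho>" and \<alpha>: "0 \<le> \<alpha>"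
  shows "ereal \<alpha> \<le> hilbert_compression_exponent G S"
proof -
  interpret word_metric G S by fact
  have \<theta>fin: "\<And>x. x \<in> carrier G \<Longrightarrow> finite {i. \<theta> x i \<noteq> 0}"
    using emb by (auto simp: embeds_def)
  obtain \<Phi> where "\<Phi> \<in> carrier G \<rightarrow> L2_functions \<and>
    (\<forall>x\<in>carrier G. \<forall>y\<in>carrier G. L2_norm (\<lambda>t. \<Phi> x t - \<Phi> y t) = sqrt (sqdist (\<theta> x) (\<theta> y)))"
    using L2_realisation[where \<theta> = \<theta>, OF countable_carrier \<theta>fin] ..
  then have \<Phi>: "\<Phi> \<in> carrier G \<rightarrow> L2_functions"
    "\<And>x y. x \<in> carrier G \<Longrightarrow> y \<in> carrier G \<Longrightarrow> L2_norm (\<lambda>t. \<Phi> x t - \<Phi> y t) = sqrt (sqdist (\<theta> x) (\<theta> y))"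
    by simp_all
  have "\<forall>s\<in>S. \<exists>L. \<forall>x\<in>carrier G. sqdist (\<theta> x) (\<theta> (x \<otimes>\<^bsub>G\<^esub> s)) \<le> L"
    using emb S_closed by (auto simp: embeds_def)
  then obtain Ls where Ls: "\<And>s x. s \<in> S \<Longrightarrow> x \<in> carrier G \<Longrightarrow> sqdist (\<theta> x) (\<theta> (x \<otimes>\<^bsub>G\<^esub> s)) \<le> Ls s"
    by metis
  define L where "L = sqrt (Max (insert 0 (Ls ` S)))"
  have L: "sqrt (sqdist (\<theta> x) (\<theta> (x \<otimes>\<^bsub>G\<^esub> s))) \<le> L" if "s \<in> S" "x \<in> carrier G" for s x
  proof -
    have "Ls s \<le> Max (insert 0 (Ls ` S))" using finite_S that by (intro Max_ge) auto
    then show ?thesis using Ls[OF that] unfolding L_def by simp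
  qed
  have words: "sqrt (sqdist (\<theta> x) (\<theta> (x \<otimes>\<^bsub>G\<^esub> word_prod w))) \<le> L * length w"
    if "set w \<subseteq> S" "x \<in> carrier G" for w x
    using that
  proof (induction w arbitrary: x)
    case (Cons s w)
    have s: "s \<in> S" "s \<in> carrier G" and w: "set w \<subseteq> S" "word_prod w \<in> carrier G"
      using Cons.prems S_closed word_prod_closed by auto
    have xs: "x \<otimes>\<^bsub>G\<^esub> s \<in> carrier G" "x \<otimes>\<^bsub>G\<^esub> s \<otimes>\<^bsub>G\<^esub> word_prod w \<in> carrier G"
      using Cons.prems s w by auto
    have "sqrt (sqdist (\<theta> x) (\<theta> (x \<otimes>\<^bsub>G\<^esub> s \<otimes>\<^bsub>G\<^esub> word_prod w))) \<le> sqrt (sqdist (\<theta> x) (\<theta> (x \<otimes>\<^bsub>G\<^esub> s))) +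
      sqrt (sqdist (\<theta> (x \<otimes>\<^bsub>G\<^esub> s)) (\<theta> (x \<otimes>\<^bsub>G\<^esub> s \<otimes>\<^bsub>G\<^esub> word_prod w)))"
      using Cons.prems xs by (intro sqrt_sqdist_triangle \<theta>fin) auto
    also have "\<dots> \<le> L + L * length w"
      using L[OF s(1) Cons.prems(2)] Cons.IH[OF w(1) xs(1)] by linarith
    finally show ?case using Cons.prems s w by (simp add: m_assoc algebra_simps)
  qed simp
  have lip: "L2_norm (\<lambda>t. \<Phi> x t - \<Phi> y t) \<le> L * real (word_dist G S x y)" if xy: "x \<in> carrier G" "y \<in> carrier G" for x y
  proof -
    obtain w where w: "length w = word_len (inv\<^bsub>G\<^esub> x \<otimes>\<^bsub>G\<^esub> y)" "set w \<subseteq> S" "word_prod w = inv\<^bsub>G\<^esub> x \<otimes>\<^bsub>G\<^esub> y"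
      using word_length_witness[of "inv\<^bsub>G\<^esub> x \<otimes>\<^bsub>G\<^esub> y"] xy by auto
    have "x \<otimes>\<^bsub>G\<^esub> (inv\<^bsub>G\<^esub> x \<otimes>\<^bsub>G\<^esub> y) = y" using xy by (simp flip: m_assoc)
    then show ?thesis using words[OF w(2) xy(1)] w xy by (simp add: \<Phi>(2) word_dist_def)
  qed
  obtain c where c: "c > 0" "\<And>x y. x \<in> carrier G \<Longrightarrow> y \<in> carrier G \<Longrightarrow> x \<noteq> y \<Longrightarrow>
      c * \<rho> (inv\<^bsub>G\<^esub> x \<otimes>\<^bsub>G\<^esub> y) powr (2 * \<alpha>) \<le> sqdist (\<theta> x) (\<theta> y)"
    using emb by (auto simp: embeds_def)
  have "\<exists>C. \<forall>x\<in>carrier G. N x \<le> C * \<rho> x" if "group_length G N" for N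
    using dom that by (simp add: dominates_def)
  from this[OF subadditive_word_length]
  obtain C0 where C0: "\<And>x. x \<in> carrier G \<Longrightarrow> real (word_len x) \<le> C0 * \<rho> x" by blast
  have \<rho>1: "1 \<le> \<rho> x" if "x \<in> carrier G" "x \<noteq> \<one>\<^bsub>G\<^esub>" for x
    using dom that by (auto simp: dominates_def)
  define C where "C = max 1 C0"
  have low: "sqrt c * (1 / C) powr \<alpha> * real (word_dist G S x y) powr \<alpha> \<le> L2_norm (\<lambda>t. \<Phi> x t - \<Phi> y t)"
    if xy: "x \<in> carrier G" "y \<in> carrier G" "x \<noteq> y" for x y
  proof -
    define h where "h = inv\<^bsub>G\<^esub> x \<otimes>\<^bsub>G\<^esub> y"
    have h: "h \<in> carrier G" "h \<noteq> \<one>\<^bsub>G\<^esub>"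
    proof -
      show "h \<in> carrier G" using xy by (simp add: h_def)
      show "h \<noteq> \<one>\<^bsub>G\<^esub>"
      proof
        assume "h = \<one>\<^bsub>G\<^esub>"
        then have "x \<otimes>\<^bsub>G\<^esub> h = x" using xy by simp
        moreover have "x \<otimes>\<^bsub>G\<^esub> h = y" using xy by (simp add: h_def flip: m_assoc)
        ultimately show False using xy by simp
      qed
    qed
    have "C0 * \<rho> h \<le> C * \<rho> h" using \<rho>1[OF h] by (intro mult_right_mono) (auto simp: C_def)
    then have "real (word_len h) \<le> C * \<rho> h" using C0[OF h(1)] by linarith
    then have "1 / C * real (word_len h) \<le> \<rho> h" by (simp add: C_def field_simps)
    then have "(1 / C * real (word_len h)) powr \<alpha> \<le> \<rho> h powr \<alpha>"
      using \<alpha> by (intro powr_mono2) (auto simp: C_def)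
    moreover have "(1 / C * real (word_len h)) powr \<alpha> = (1 / C) powr \<alpha> * real (word_len h) powr \<alpha>"
      by (rule powr_mult)
    ultimately have "sqrt c * ((1 / C) powr \<alpha> * real (word_len h) powr \<alpha>) \<le> sqrt c * \<rho> h powr \<alpha>"
      using c(1) by (intro mult_left_mono) auto
    also have "\<dots> = sqrt (c * \<rho> h powr (2 * \<alpha>))"
    proof -
      have "\<rho> h powr (2 * \<alpha>) = (\<rho> h powr \<alpha>)\<^sup>2" by (simp add: power2_eq_square flip: powr_add)
      then show ?thesis by (simp add: real_sqrt_mult)
    qed
    also have "\<dots> \<le> sqrt (sqdist (\<theta> x) (\<theta> y))" using c(2)[OF xy] by (simp add: h_def)
    also have "\<dots> = L2_norm (\<lambda>t. \<Phi> x t - \<Phi> y t)" using \<Phi>(2) xy by simp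
    finally show ?thesis by (simp add: h_def word_dist_def mult.assoc)
  qed
  have "lipschitz_into_L2 G S \<Phi>"
    unfolding lipschitz_into_L2_def using \<Phi>(1) lip by blast
  moreover have "sqrt c * (1 / C) powr \<alpha> > 0" using c by (simp add: C_def)
  ultimately show ?thesis
    unfolding hilbert_compression_exponent_def using \<alpha> low by (intro Sup_upper) blast
qed

section \<open>Upper bound for the Poincare exponent\<close>

lemma infsum_finite_sum:
  fixes g :: "'b \<Rightarrow> 'a \<Rightarrow> real"
  assumes "finite S" "\<And>s. s \<in> S \<Longrightarrow> g s summable_on A"
  shows "(\<Sum>\<^sub>\<infinity>x\<in>A. \<Sum>s\<in>S. g s x) = (\<Sum>s\<in>S. infsum (g s) A)"
proof -
  have "((\<lambda>x. \<Sum>s\<in>S. g s x) has_sum (\<Sum>s\<in>S. infsum (g s) A)) A"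
    using assms by (induction S) (auto intro!: has_sum_add)
  then show ?thesis by (rule infsumI)
qed

definition energy :: "('a, 'm) monoid_scheme \<Rightarrow> ('a \<Rightarrow> real) \<Rightarrow> 'a \<Rightarrow> real"
  where "energy G u h = (\<Sum>\<^sub>\<infinity>x\<in>carrier G. (u (x \<otimes>\<^bsub>G\<^esub> h) - u x)\<^sup>2)"

context group
begin

lemma bij_right_mult: "h \<in> carrier G \<Longrightarrow> bij_betw (\<lambda>x. x \<otimes> h) (carrier G) (carrier G)"
  by (rule bij_betw_byWitness[where f' = "\<lambda>x. x \<otimes> inv h"]) (auto simp: m_assoc)

lemma bij_inv: "bij_betw (\<lambda>x. inv x) (carrier G) (carrier G)"
  by (rule bij_betw_byWitness[where f' = "\<lambda>x. inv x"]) auto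

lemma finite_shift_support:
  assumes "finite {x \<in> carrier G. u x \<noteq> (0::real)}" "h \<in> carrier G"
  shows "finite {x \<in> carrier G. u (x \<otimes> h) \<noteq> 0}"
proof (rule finite_subset)
  show "{x \<in> carrier G. u (x \<otimes> h) \<noteq> 0} \<subseteq> (\<lambda>x. x \<otimes> inv h) ` {x \<in> carrier G. u x \<noteq> 0}"
  proof
    fix x assume x: "x \<in> {x \<in> carrier G. u (x \<otimes> h) \<noteq> 0}"
    then have "x = (x \<otimes> h) \<otimes> inv h" using assms by (simp add: m_assoc)
    then show "x \<in> (\<lambda>x. x \<otimes> inv h) ` {x \<in> carrier G. u x \<noteq> 0}"
      using x assms by (intro image_eqI[of _ _ "x \<otimes> h"]) auto
  qed
qed (use assms in simp)

lemma energy_summable: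
  assumes "finite {x \<in> carrier G. u x \<noteq> (0::real)}" "h \<in> carrier G"
  shows "(\<lambda>x. (u (x \<otimes> h) - u x)\<^sup>2) summable_on carrier G"
proof (rule finite_nonzero_values_imp_summable_on)
  have "{x \<in> carrier G. (u (x \<otimes> h) - u x)\<^sup>2 \<noteq> 0} \<subseteq> {x \<in> carrier G. u (x \<otimes> h) \<noteq> 0} \<union> {x \<in> carrier G. u x \<noteq> 0}"
    by auto
  then show "finite {x \<in> carrier G. (u (x \<otimes> h) - u x)\<^sup>2 \<noteq> 0}"
    using finite_shift_support[OF assms] assms(1) by (rule finite_subset[OF _ finite_UnI])
qed

lemma energy_nonneg: "0 \<le> energy G u h"
  unfolding energy_def by (intro infsum_nonneg) simp

lemma energy_mult:
  assumes fin: "finite {x \<in> carrier G. u x \<noteq> 0}" and g: "g \<in> carrier G" and h: "h \<in> carrier G"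
  shows "energy G u (g \<otimes> h) \<le> 2 * energy G u g + 2 * energy G u h"
proof -
  let ?D = "\<lambda>k x. (u (x \<otimes> k) - u x)\<^sup>2"
  have s: "?D k summable_on carrier G" if "k \<in> carrier G" for k
    by (rule energy_summable[OF fin that])
  have sg: "(\<lambda>x. ?D h (x \<otimes> g)) summable_on carrier G"
    using s[OF h] summable_on_reindex_bij_betw[OF bij_right_mult[OF g], of "?D h"] by simp
  have "energy G u (g \<otimes> h) \<le> (\<Sum>\<^sub>\<infinity>x\<in>carrier G. 2 * ?D g x + 2 * ?D h (x \<otimes> g))"
    unfolding energy_def
  proof (rule infsum_mono)
    show "?D (g \<otimes> h) summable_on carrier G" using s g h by simp
    show "(\<lambda>x. 2 * ?D g x + 2 * ?D h (x \<otimes> g)) summable_on carrier G"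
      by (intro summable_on_add summable_on_cmult_right s sg g)
    fix x assume x: "x \<in> carrier G"
    have "(a - c)\<^sup>2 \<le> 2 * (b - c)\<^sup>2 + 2 * (a - b)\<^sup>2" for a b c :: real
      using zero_le_power2[of "(b - c) - (a - b)"] by (simp add: power2_eq_square algebra_simps)
    from this[of "u (x \<otimes> (g \<otimes> h))" "u x" "u (x \<otimes> g)"]
    show "?D (g \<otimes> h) x \<le> 2 * ?D g x + 2 * ?D h (x \<otimes> g)" using x g h by (simp add: m_assoc)
  qed
  also have "\<dots> = (\<Sum>\<^sub>\<infinity>x\<in>carrier G. 2 * ?D g x) + (\<Sum>\<^sub>\<infinity>x\<in>carrier G. 2 * ?D h (x \<otimes> g))"
    by (intro infsum_add summable_on_cmult_right s sg g)
  also have "\<dots> = 2 * energy G u g + 2 * (\<Sum>\<^sub>\<infinity>x\<in>carrier G. ?D h (x \<otimes> g))"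
    by (simp add: infsum_cmult_right' energy_def)
  also have "(\<Sum>\<^sub>\<infinity>x\<in>carrier G. ?D h (x \<otimes> g)) = energy G u h"
    unfolding energy_def by (rule infsum_reindex_bij_betw[OF bij_right_mult[OF g], of "?D h"])
  finally show ?thesis .
qed

end

lemma (in finite_walk) energy_eq_killed:
  assumes u: "\<And>x. x \<in> carrier G - F \<Longrightarrow> u x = 0" and a: "a \<in> carrier G"
  shows "energy G u a = 2 * inner_F u u - 2 * (\<Sum>x\<in>F. u x * (if x \<otimes> a \<in> F then u (x \<otimes> a) else 0))"
proof -
  have on_F: "infsum \<phi> (carrier G) = sum \<phi> F" if "\<And>x. x \<in> carrier G - F \<Longrightarrow> \<phi> x = 0" for \<phi> :: "'a \<Rightarrow> real"
  proof -
    have "infsum \<phi> (carrier G) = infsum \<phi> F"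
      using that F by (intro infsum_cong_neutral) auto
    then show ?thesis using F by simp
  qed
  have fin: "finite {x \<in> carrier G. u x \<noteq> 0}"
    by (rule finite_subset[OF _ F(1)]) (use u in auto)
  have s1: "(\<lambda>x. (u x)\<^sup>2) summable_on carrier G"
    using fin by (intro finite_nonzero_values_imp_summable_on) simp
  have s2: "(\<lambda>x. (u (x \<otimes> a))\<^sup>2) summable_on carrier G"
    using finite_shift_support[OF fin a] by (intro finite_nonzero_values_imp_summable_on) simp
  have s3: "(\<lambda>x. u x * u (x \<otimes> a)) summable_on carrier G"
    by (rule finite_nonzero_values_imp_summable_on, rule finite_subset[OF _ fin]) auto
  have "energy G u a = (\<Sum>\<^sub>\<infinity>x\<in>carrier G. ((u (x \<otimes> a))\<^sup>2 + (u x)\<^sup>2) + (- 2) * (u x * u (x \<otimes> a)))"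
    unfolding energy_def by (intro infsum_cong) (simp add: power2_eq_square algebra_simps)
  also have "\<dots> = (\<Sum>\<^sub>\<infinity>x\<in>carrier G. (u (x \<otimes> a))\<^sup>2 + (u x)\<^sup>2) + (\<Sum>\<^sub>\<infinity>x\<in>carrier G. (- 2) * (u x * u (x \<otimes> a)))"
    by (intro infsum_add summable_on_add summable_on_cmult_right s1 s2 s3)
  also have "\<dots> = (\<Sum>\<^sub>\<infinity>x\<in>carrier G. (u (x \<otimes> a))\<^sup>2) + (\<Sum>\<^sub>\<infinity>x\<in>carrier G. (u x)\<^sup>2) + (- 2) * (\<Sum>\<^sub>\<infinity>x\<in>carrier G. u x * u (x \<otimes> a))"
    by (simp only: infsum_add[OF s2 s1] infsum_cmult_right')
  also have "(\<Sum>\<^sub>\<infinity>x\<in>carrier G. (u (x \<otimes> a))\<^sup>2) = (\<Sum>\<^sub>\<infinity>x\<in>carrier G. (u x)\<^sup>2)"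
    by (rule infsum_reindex_bij_betw[OF bij_right_mult[OF a], of "\<lambda>x. (u x)\<^sup>2"])
  also have "(\<Sum>\<^sub>\<infinity>x\<in>carrier G. (u x)\<^sup>2) = inner_F u u"
    using u by (subst on_F) (auto simp: inner_F_def power2_eq_square)
  also have "(\<Sum>\<^sub>\<infinity>x\<in>carrier G. u x * u (x \<otimes> a)) = (\<Sum>x\<in>F. u x * (if x \<otimes> a \<in> F then u (x \<otimes> a) else 0))"
    using u F a by (subst on_F) (auto intro!: sum.cong)
  finally show ?thesis by simp
qed

lemma (in finite_walk) killed_energy:
  assumes u: "\<And>x. x \<in> carrier G - F \<Longrightarrow> u x = 0"
  shows "inner_F u u - inner_F u (Q 0 u) = avg T (energy G u) / 2"
proof -
  have "inner_F u (Q 0 u) = avg T (\<lambda>a. \<Sum>x\<in>F. u x * (if x \<otimes> a \<in> F then u (x \<otimes> a) else 0))"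
    unfolding inner_F_def confined_def avg_cmult[symmetric] avg_sum[symmetric] by (simp cong: if_cong)
  moreover have "avg T (energy G u) = avg T (\<lambda>a. 2 * inner_F u u - 2 * (\<Sum>x\<in>F. u x * (if x \<otimes> a \<in> F then u (x \<otimes> a) else 0)))"
    by (intro avg_cong energy_eq_killed u T_closed)
  ultimately show ?thesis using T_ne by (simp add: avg_diff avg_cmult)
qed

lemma dyadic_between:
  fixes y :: real
  assumes "y \<ge> 1"
  shows "\<exists>j::nat. y \<le> 2 ^ j \<and> 2 ^ j \<le> 2 * y"
proof -
  have ex: "\<exists>j::nat. y \<le> 2 ^ j"
    using real_arch_pow[of 2 y] less_imp_le by auto
  define j where "j = (LEAST j::nat. y \<le> 2 ^ j)"
  have j: "y \<le> 2 ^ j" unfolding j_def using ex by (rule LeastI_ex)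
  have "2 ^ j \<le> 2 * y"
  proof (cases j)
    case (Suc i)
    then have "\<not> y \<le> 2 ^ i" using not_less_Least[of i "\<lambda>j. y \<le> 2 ^ j"] by (simp add: j_def)
    then show ?thesis using Suc by simp
  qed (use assms in simp)
  with j show ?thesis by blast
qed

text \<open>The spectral gap of the walk killed outside a ball of radius \<open>r\<close> is at least of the order of
  \<open>r / n\<close> as soon as return probabilities at time \<open>n\<close> beat the volume \<open>exp (O(r))\<close> of the ball,
  that is, for \<open>n\<close> of the order of \<open>r powr (1 / \<gamma>)\<close>.\<close>

lemma (in word_metric) poincare_le:
  assumes T: "symmetric_steps G T" and ret: "has_return_exponent G T \<gamma>" and \<gamma>: "0 < \<gamma>" "\<gamma> < 1"
  shows "\<exists>C>0. \<forall>r\<ge>1. ball_poincare_const G S r \<le> ereal (C * real r powr ((1 / \<gamma> - 1) / 2))"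
proof -
  have T': "T \<noteq> []" "set T \<subseteq> carrier G" using T by (auto simp: symmetric_steps_def)
  obtain c' where c': "c' > 0" "\<And>n x y. x \<in> carrier G \<Longrightarrow> y \<in> carrier G \<Longrightarrow>
      (step G T ^^ n) (\<lambda>w. of_bool (w = y)) x \<le> exp (- c' * real n powr \<gamma>)"
    using ret by (auto simp: has_return_exponent_def)
  define c where "c = min 1 c'"
  have c: "0 < c" "c \<le> 1" "c \<le> c'" using c' by (auto simp: c_def)
  have "\<forall>a\<in>set T. \<exists>C. \<forall>u. finite {x \<in> carrier G. u x \<noteq> (0::real)} \<longrightarrow> energy G u a \<le> C * (\<Sum>s\<in>S. energy G u s)"
  proof
    fix a assume "a \<in> set T"
    then obtain w where w: "set w \<subseteq> S" "word_prod w = a" using T' word_exists by blast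
    have "energy G u (word_prod w) \<le> 4 ^ length w * (\<Sum>s\<in>S. energy G u s)"
      if fin: "finite {x \<in> carrier G. u x \<noteq> (0::real)}" for u
      using w(1)
    proof (induction w)
      case Nil
      have "(\<Sum>\<^sub>\<infinity>x\<in>carrier G. (u (x \<otimes> \<one>) - u x)\<^sup>2) = (\<Sum>\<^sub>\<infinity>x\<in>carrier G. 0)"
        by (intro infsum_cong) simp
      then have "energy G u \<one> = 0" by (simp add: energy_def)
      then show ?case by (simp add: sum_nonneg energy_nonneg)
    next
      case (Cons s w)
      have X: "0 \<le> (\<Sum>s\<in>S. energy G u s)" by (intro sum_nonneg energy_nonneg)
      have "energy G u (s \<otimes> word_prod w) \<le> 2 * energy G u s + 2 * energy G u (word_prod w)"
        using Cons.prems S_closed word_prod_closed by (intro energy_mult fin) auto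
      also have "\<dots> \<le> 2 * (\<Sum>s\<in>S. energy G u s) + 2 * (4 ^ length w * (\<Sum>s\<in>S. energy G u s))"
        using Cons finite_S by (intro add_mono mult_left_mono member_le_sum energy_nonneg) auto
      also have "\<dots> \<le> 4 ^ length (s # w) * (\<Sum>s\<in>S. energy G u s)"
      proof -
        have "1 * (\<Sum>s\<in>S. energy G u s) \<le> 4 ^ length w * (\<Sum>s\<in>S. energy G u s)"
          using X by (intro mult_right_mono) auto
        moreover have "4 ^ length (s # w) * (\<Sum>s\<in>S. energy G u s) = 4 * (4 ^ length w * (\<Sum>s\<in>S. energy G u s))"
          by simp
        ultimately show ?thesis by linarith
      qed
      finally show ?case by simp
    qed
    then show "\<exists>C. \<forall>u. finite {x \<in> carrier G. u x \<noteq> (0::real)} \<longrightarrow> energy G u a \<le> C * (\<Sum>s\<in>S. energy G u s)"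
      using w(2) by blast
  qed
  then obtain Cs where Cs: "\<And>a u. a \<in> set T \<Longrightarrow> finite {x \<in> carrier G. u x \<noteq> (0::real)} \<Longrightarrow>
      energy G u a \<le> Cs a * (\<Sum>s\<in>S. energy G u s)" by metis
  define CT where "CT = Max (insert 1 (Cs ` set T))"
  have CT: "1 \<le> CT" "\<And>a. a \<in> set T \<Longrightarrow> Cs a \<le> CT" by (auto simp: CT_def)
  define B where "B = max 1 (ln (real (card S + 1)))"
  have B: "1 \<le> B" by (simp add: B_def)
  define C2 where "C2 = 2 * (2 * B / c) powr (1 / \<gamma>) * CT / B"
  have C2: "C2 > 0" using B c CT by (simp add: C2_def)
  have main: "ball_poincare_const G S r \<le> ereal (sqrt C2 * real r powr ((1 / \<gamma> - 1) / 2))" if r: "r \<ge> 1" for r :: nat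
  proof -
    \<comment> \<open>From time \<open>y\<close> on, return probabilities are below the inverse square of the bound \<open>exp A\<close> for the volume.\<close>
    define y where "y = (2 * B * r / c) powr (1 / \<gamma>)"
    have y0: "1 \<le> 2 * B * r / c"
    proof -
      have "1 * 1 \<le> B * r" using B r by (intro mult_mono) auto
      then show ?thesis using c by (simp add: field_simps)
    qed
    then have "1 \<le> y" unfolding y_def using \<gamma> by (intro ge_one_powr_ge_zero) auto
    from dyadic_between[OF this] obtain j :: nat where j: "y \<le> 2 ^ j" "2 ^ j \<le> 2 * y" by blast
    define n where "n = (2::nat) ^ j"
    have n: "y \<le> real n" "real n \<le> 2 * y" "1 \<le> real n" using j by (auto simp: n_def)
    have n\<gamma>: "2 * B * r \<le> c * real n powr \<gamma>"
    proof -
      have "z = (z powr (1 / \<gamma>)) powr \<gamma>" if "z \<ge> 1" for z :: real using that \<gamma> by (simp add: powr_powr)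
      from this[OF y0] have "2 * B * r / c = y powr \<gamma>" by (simp only: y_def)
      also have "\<dots> \<le> real n powr \<gamma>" using n \<gamma> \<open>1 \<le> y\<close> by (intro powr_mono2) auto
      finally show ?thesis using c by (simp add: field_simps)
    qed
    define A where "A = B * r"
    have An: "A \<le> 2 ^ j"
    proof -
      have "A \<le> 2 * B * r" using B r by (simp add: A_def)
      also have "\<dots> \<le> c * real n powr \<gamma>" by (rule n\<gamma>)
      also have "\<dots> \<le> 1 * real n powr 1" using c n \<gamma> by (intro mult_mono powr_mono) auto
      finally show ?thesis by (simp add: n_def)
    qed
    have A0: "0 < A" using B r by (simp add: A_def)
    define F where "F = (\<lambda>x. inv x) ` word_ball G S r"
    have ball: "word_ball G S r \<subseteq> carrier G" by (auto simp: word_ball_def)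
    have F: "finite F" "F \<subseteq> carrier G" using word_ball_bound(1) ball by (auto simp: F_def)
    have "card F \<le> card (word_ball G S r)" unfolding F_def by (intro card_image_le word_ball_bound)
    also have "\<dots> \<le> (card S + 1) ^ r" by (rule word_ball_bound)
    finally have "real (card F) \<le> real ((card S + 1) ^ r)" by (rule of_nat_mono)
    also have "\<dots> = exp (ln (real (card S + 1)) * r)"
      by (simp add: exp_of_nat2_mult add_pos_nonneg)
    also have "\<dots> \<le> exp A" by (auto simp: A_def B_def intro!: mult_right_mono)
    finally have cF: "real (card F) \<le> exp A" .
    interpret W: finite_walk G T F by unfold_locales (use T F in auto)
    have gap: "exp (- c' * real n powr \<gamma>) * card F \<le> exp (- A)"
    proof -
      have "c * real n powr \<gamma> \<le> c' * real n powr \<gamma>" using c by (intro mult_right_mono) auto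
      then have "exp (- c' * real n powr \<gamma>) \<le> exp (- (2 * A))" using n\<gamma> by (simp add: A_def)
      then have "exp (- c' * real n powr \<gamma>) * card F \<le> exp (- (2 * A)) * exp A"
        using cF by (intro mult_mono) auto
      then show ?thesis by (simp flip: exp_add)
    qed
    define J where "J = sqrt C2 * real r powr ((1 / \<gamma> - 1) / 2)"
    have J: "J > 0" using C2 r by (simp add: J_def)
    have J2: "n * CT / A \<le> J\<^sup>2"
    proof -
      have "n * CT / A \<le> 2 * y * CT / A" using n A0 CT by (intro divide_right_mono mult_right_mono) auto
      also have "\<dots> = 2 * ((2 * B / c) powr (1 / \<gamma>) * real r powr (1 / \<gamma>)) * CT / (B * r)"
        using B c r by (simp add: y_def A_def flip: powr_mult)
      also have "\<dots> = C2 * (real r powr (1 / \<gamma>) / real r)" by (simp add: C2_def)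
      also have "real r powr (1 / \<gamma>) / real r = real r powr (1 / \<gamma> - 1)" using r by (simp add: powr_diff)
      also have "C2 * real r powr (1 / \<gamma> - 1) = J\<^sup>2"
      proof -
        have "(real r powr ((1 / \<gamma> - 1) / 2))\<^sup>2 = real r powr (1 / \<gamma> - 1)"
          unfolding power2_eq_square powr_add[symmetric] by simp
        then show ?thesis using C2 by (simp add: J_def power_mult_distrib)
      qed
      finally show ?thesis .
    qed
    have "sqrt (\<Sum>\<^sub>\<infinity>x\<in>carrier G. (f x)\<^sup>2) \<le> J * sqrt (\<Sum>\<^sub>\<infinity>x\<in>carrier G. \<Sum>s\<in>S. \<bar>f (s \<otimes> x) - f x\<bar>\<^sup>2)"
      if f: "\<forall>x\<in>carrier G - word_ball G S r. f x = 0" for f :: "'a \<Rightarrow> real"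
    proof -
      define u where "u = (\<lambda>x. f (inv x))"
      have u: "u x = 0" if "x \<in> carrier G - F" for x
      proof -
        have "inv x \<notin> word_ball G S r"
        proof
          assume "inv x \<in> word_ball G S r"
          then have "inv (inv x) \<in> F" unfolding F_def by (rule imageI)
          then show False using that by simp
        qed
        then show ?thesis using f that by (simp add: u_def)
      qed
      have fin: "finite {x \<in> carrier G. u x \<noteq> 0}" by (rule finite_subset[OF _ F(1)]) (use u in auto)
      have "(\<Sum>\<^sub>\<infinity>x\<in>carrier G. (f x)\<^sup>2) = (\<Sum>\<^sub>\<infinity>x\<in>carrier G. (u x)\<^sup>2)"
        unfolding u_def by (rule infsum_reindex_bij_betw[OF bij_inv, of "\<lambda>x. (f x)\<^sup>2", symmetric])
      also have "\<dots> = infsum (\<lambda>x. (u x)\<^sup>2) F" using u F by (intro infsum_cong_neutral) auto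
      also have "\<dots> = W.inner_F u u" using F by (simp add: W.inner_F_def power2_eq_square)
      finally have l: "(\<Sum>\<^sub>\<infinity>x\<in>carrier G. (f x)\<^sup>2) = W.inner_F u u" .
      define X where "X = (\<Sum>s\<in>S. energy G u s)"
      have rhs: "(\<Sum>\<^sub>\<infinity>x\<in>carrier G. \<Sum>s\<in>S. \<bar>f (s \<otimes> x) - f x\<bar>\<^sup>2) = X"
      proof -
        have "(\<Sum>\<^sub>\<infinity>x\<in>carrier G. \<Sum>s\<in>S. \<bar>f (s \<otimes> x) - f x\<bar>\<^sup>2) =
          (\<Sum>\<^sub>\<infinity>x\<in>carrier G. \<Sum>s\<in>S. \<bar>f (s \<otimes> inv x) - f (inv x)\<bar>\<^sup>2)"
          by (rule infsum_reindex_bij_betw[OF bij_inv, of "\<lambda>x. \<Sum>s\<in>S. \<bar>f (s \<otimes> x) - f x\<bar>\<^sup>2", symmetric])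
        also have "\<dots> = (\<Sum>\<^sub>\<infinity>x\<in>carrier G. \<Sum>s\<in>S. (u (x \<otimes> inv s) - u x)\<^sup>2)"
          using S_closed by (intro infsum_cong sum.cong) (auto simp: u_def inv_mult_group)
        also have "\<dots> = (\<Sum>s\<in>S. energy G u (inv s))"
          unfolding energy_def using energy_summable[OF fin] S_closed by (intro infsum_finite_sum finite_S) auto
        also have "\<dots> = X"
          unfolding X_def
          by (rule sum.reindex_bij_witness[of _ "\<lambda>s. inv s" "\<lambda>s. inv s"]) (use S_closed S_inv in auto)
        finally show ?thesis .
      qed
      have X: "0 \<le> X" unfolding X_def by (intro sum_nonneg energy_nonneg)
      have "A / (2 * 2 ^ j) * W.inner_F u u \<le> W.inner_F u u - W.inner_F u (W.Q 0 u)"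
      proof (rule W.killed_gap)
        show "exp (- c' * real n powr \<gamma>) * real (card F) \<le> exp (- A)" by (rule gap)
        show "(step G T ^^ (2 ^ j)) (\<lambda>w. of_bool (w = y)) x \<le> exp (- c' * real n powr \<gamma>)"
          if "x \<in> F" "y \<in> F" for x y
          using c'(2)[of x y n] that F by (auto simp: n_def)
      qed (use u A0 An in auto)
      also have "\<dots> = avg T (energy G u) / 2" by (rule W.killed_energy[OF u])
      also have "\<dots> \<le> CT * X / 2"
      proof (intro divide_right_mono avg_le[OF T'(1)])
        fix a assume a: "a \<in> set T"
        have "energy G u a \<le> Cs a * X" unfolding X_def by (rule Cs[OF a fin])
        also have "\<dots> \<le> CT * X" using CT(2)[OF a] X by (rule mult_right_mono)
        finally show "energy G u a \<le> CT * X" .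
      qed simp
      finally have "A / (2 * n) * W.inner_F u u \<le> CT * X / 2" by (simp add: n_def)
      then have "W.inner_F u u \<le> n * CT / A * X" using A0 n by (simp add: field_simps)
      also have "\<dots> \<le> J\<^sup>2 * X" using J2 X by (rule mult_right_mono)
      finally have "sqrt (W.inner_F u u) \<le> sqrt (J\<^sup>2 * X)" by (rule real_sqrt_le_mono)
      then show ?thesis unfolding l rhs using J by (simp add: real_sqrt_mult)
    qed
    then show ?thesis
      unfolding ball_poincare_const_def J_def[symmetric] using J by (intro Inf_lower) blast
  qed
  then show ?thesis using C2 by (intro exI[of _ "sqrt C2"]) auto
qed

lemma (in word_metric) poincare_growth_le:
  assumes "symmetric_steps G T" "has_return_exponent G T \<gamma>" "0 < \<gamma>" "\<gamma> < 1"
  shows "poincare_growth_exponent G S \<le> ereal ((1 / \<gamma> - 1) / 2)"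
  unfolding poincare_growth_exponent_def
proof (rule Sup_least)
  obtain C where C: "C > 0" "\<And>r. r \<ge> 1 \<Longrightarrow> ball_poincare_const G S r \<le> ereal (C * real r powr ((1 / \<gamma> - 1) / 2))"
    using poincare_le[OF assms] by blast
  fix z assume "z \<in> {ereal a |a. 0 \<le> a \<and> (\<exists>c>0. \<forall>r. ereal (c * real r powr a) \<le> ball_poincare_const G S r)}"
  then obtain a c where a: "z = ereal a" "c > 0" "\<And>r. ereal (c * real r powr a) \<le> ball_poincare_const G S r"
    by blast
  define e where "e = (1 / \<gamma> - 1) / 2"
  have "(2 ^ j) powr (a - e + 1) \<le> C / c * 2 ^ j" for j :: nat
  proof -
    have "ereal (c * real (2 ^ j) powr a) \<le> ereal (C * real (2 ^ j) powr e)"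
      using a(3)[of "2 ^ j"] C(2)[of "2 ^ j"] unfolding e_def by (rule order_trans) simp
    then have "c * (2 ^ j) powr a \<le> C * (2 ^ j) powr e" by simp
    then have "(2 ^ j) powr a / (2 ^ j) powr e \<le> C / c" using a(2) by (simp add: field_simps)
    then have "(2 ^ j) powr (a - e) \<le> C / c" by (simp add: powr_diff)
    from mult_right_mono[OF this, of "2 ^ j"] show ?thesis by (simp add: powr_add)
  qed
  from exponent_le_1_if_dyadic_bound[OF _ this] have "a \<le> e" using C a(2) by simp
  then show "z \<le> ereal ((1 / \<gamma> - 1) / 2)" by (simp add: a(1) e_def)
qed


section \<open>The iterated wreath products\<close>

lemma embeds_mono:
  fixes G :: "iter_elem monoid"
  assumes "group G" "embeds G \<rho> \<alpha> \<theta>" "dominates G \<rho>" "\<alpha>' \<le> \<alpha>"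
  shows "embeds G \<rho> \<alpha>' \<theta>"
proof -
  interpret group G by fact
  obtain c where c: "c > 0" "\<And>x y. x \<in> carrier G \<Longrightarrow> y \<in> carrier G \<Longrightarrow> x \<noteq> y \<Longrightarrow>
      c * \<rho> (inv\<^bsub>G\<^esub> x \<otimes>\<^bsub>G\<^esub> y) powr (2 * \<alpha>) \<le> sqdist (\<theta> x) (\<theta> y)"
    using assms(2) by (auto simp: embeds_def)
  have "c * \<rho> (inv\<^bsub>G\<^esub> x \<otimes>\<^bsub>G\<^esub> y) powr (2 * \<alpha>') \<le> sqdist (\<theta> x) (\<theta> y)"
    if xy: "x \<in> carrier G" "y \<in> carrier G" "x \<noteq> y" for x y
  proof -
    have "inv\<^bsub>G\<^esub> x \<otimes>\<^bsub>G\<^esub> y \<noteq> \<one>\<^bsub>G\<^esub>" using xy by (metis inv_closed inv_equality inv_inv)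
    then have "1 \<le> \<rho> (inv\<^bsub>G\<^esub> x \<otimes>\<^bsub>G\<^esub> y)" using assms(3) xy by (simp add: dominates_def)
    then have "c * \<rho> (inv\<^bsub>G\<^esub> x \<otimes>\<^bsub>G\<^esub> y) powr (2 * \<alpha>') \<le> c * \<rho> (inv\<^bsub>G\<^esub> x \<otimes>\<^bsub>G\<^esub> y) powr (2 * \<alpha>)"
      using c(1) assms(4) by (intro mult_left_mono powr_mono) auto
    with c(2)[OF xy] show ?thesis by linarith
  qed
  with assms(2) c(1) show ?thesis unfolding embeds_def by blast
qed

text \<open>Each of the three recursions \<open>\<beta> \<mapsto> (1 + \<beta>) / 2\<close>, \<open>\<gamma> \<mapsto> (1 + \<gamma>) / (3 - \<gamma>)\<close> and
  \<open>\<alpha> \<mapsto> 2 * \<alpha> / (2 * \<alpha> + 1)\<close> is solved explicitly, starting with \<open>\<beta> = 1 / 2\<close>, \<open>\<gamma> = 0\<close>, \<open>\<alpha> = 1\<close>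
  for the integers. Embeddings lose an arbitrarily small amount of the exponent at each level.\<close>

lemma iter_wreath_exponents:
  assumes "k \<ge> 1"
  shows "\<exists>T N \<rho>. symmetric_steps (iter_wreath k) T \<and> folner (iter_wreath k) \<and> group_length (iter_wreath k) N \<and>
    has_speed (iter_wreath k) T N (1 - (1 / 2) ^ k) \<and>
    has_return_exponent (iter_wreath k) T ((real k - 1) / (real k + 1)) \<and>
    dominates (iter_wreath k) \<rho> \<and>
    (\<forall>\<alpha>. 0 \<le> \<alpha> \<longrightarrow> \<alpha> < 1 / (2 * (1 - (1 / 2) ^ k)) \<longrightarrow> (\<exists>\<theta>. embeds (iter_wreath k) \<rho> \<alpha> \<theta>))"
  using assms
proof (induction k rule: dec_induct)
  case base
  obtain \<theta> where "embeds int_copy int_abs 1 \<theta>" using embeds_int by blast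
  then have "embeds int_copy int_abs \<alpha> \<theta>" if "\<alpha> \<le> 1" for \<alpha>
    using embeds_mono[OF group_int_copy _ dominates_int that] by blast
  then have "\<forall>\<alpha>. 0 \<le> \<alpha> \<longrightarrow> \<alpha> < 1 / (2 * (1 - (1 / 2) ^ Suc 0)) \<longrightarrow> (\<exists>\<theta>. embeds int_copy int_abs \<alpha> \<theta>)"
    by (auto intro: less_imp_le)
  then show ?case
    using symmetric_steps_int folner_int subadditive_int_abs has_speed_int has_return_exponent_int dominates_int
    by (intro exI[of _ "[Base 1, Base (- 1)]"] exI[of _ int_abs]) (simp add: iter_wreath_1)
next
  case (step k)
  interpret iter_group "iter_wreath k" using step.hyps by (intro iter_group_iter_wreath)
  obtain T N \<rho> where T: "symmetric_steps (iter_wreath k) T" and fol: "folner (iter_wreath k)"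
    and N: "group_length (iter_wreath k) N"
    and speed: "has_speed (iter_wreath k) T N (1 - (1 / 2) ^ k)"
    and ret: "has_return_exponent (iter_wreath k) T ((real k - 1) / (real k + 1))"
    and dom: "dominates (iter_wreath k) \<rho>"
    and emb: "\<And>\<alpha>. 0 \<le> \<alpha> \<Longrightarrow> \<alpha> < 1 / (2 * (1 - (1 / 2) ^ k)) \<Longrightarrow> \<exists>\<theta>. embeds (iter_wreath k) \<rho> \<alpha> \<theta>"
    using step.IH by blast
  define \<beta> where "\<beta> = 1 - (1 / 2 :: real) ^ k"
  have "(1 / 2 :: real) ^ k \<le> (1 / 2) ^ 1" using step.hyps by (intro power_decreasing) auto
  then have \<beta>: "1 / 2 \<le> \<beta>" "\<beta> < 1" by (auto simp: \<beta>_def)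
  have \<beta>': "1 - (1 / 2) ^ Suc k = (1 + \<beta>) / 2" by (simp add: \<beta>_def)
  have "has_speed (wr (iter_wreath k)) (walk_steps (iter_wreath k) T) (lamp_sum (iter_wreath k) N) (1 - (1 / 2) ^ Suc k)"
    unfolding \<beta>' using speed \<beta> by (intro has_speed_walk T N) (auto simp: \<beta>_def)
  moreover have "has_return_exponent (wr (iter_wreath k)) (walk_steps (iter_wreath k) T) ((real (Suc k) - 1) / (real (Suc k) + 1))"
  proof -
    have "(real (Suc k) - 1) / (real (Suc k) + 1) = (1 + (real k - 1) / (real k + 1)) / (3 - (real k - 1) / (real k + 1))"
    proof -
      have e: "1 + (real k - 1) / (real k + 1) = 2 * real k / (real k + 1)"
        "3 - (real k - 1) / (real k + 1) = 2 * (real k + 2) / (real k + 1)"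
        by (simp_all add: field_simps)
      have "2 * real k / (real k + 1) / (2 * (real k + 2) / (real k + 1)) = real k / (real k + 2)"
        using step.hyps by (simp add: divide_simps)
      then show ?thesis unfolding e by simp
    qed
    then show ?thesis using has_return_exponent_walk[OF T ret] step.hyps by simp
  qed
  moreover have "\<exists>\<theta>. embeds (wr (iter_wreath k)) (tour (iter_wreath k) \<rho>) \<alpha>' \<theta>"
    if \<alpha>': "0 \<le> \<alpha>'" "\<alpha>' < 1 / (2 * (1 - (1 / 2) ^ Suc k))" for \<alpha>'
  proof -
    have "2 * (1 - (1 / 2) ^ Suc k) = 1 + \<beta>" by (simp add: \<beta>_def)
    then have less: "\<alpha>' < 1 / (1 + \<beta>)" using \<alpha>'(2) by (simp only:)
    \<comment> \<open>With \<open>\<alpha> = 1 / (2 * b)\<close>, the exponent gained in the wreath product is \<open>1 / (1 + b)\<close>.\<close>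
    obtain b where b: "\<beta> < b" "b \<le> 1" "\<alpha>' < 1 / (1 + b)"
    proof (cases "\<alpha>' < 1 / 2")
      case True
      then show ?thesis using that[of 1] \<beta> by simp
    next
      case False
      have "\<alpha>' * (1 + \<beta>) < 1" using less \<beta> by (simp add: field_simps)
      then have 1: "\<beta> < 1 / \<alpha>' - 1" using False by (simp add: field_simps)
      have 2: "1 / \<alpha>' - 1 \<le> 1" using False by (simp add: field_simps)
      define b where "b = (\<beta> + (1 / \<alpha>' - 1)) / 2"
      have "b < 1 / \<alpha>' - 1" "\<beta> < b" using 1 by (auto simp: b_def)
      moreover from this have "1 + b < 1 / \<alpha>'" by simp
      then have "\<alpha>' < 1 / (1 + b)" using False \<open>\<beta> < b\<close> \<beta> by (simp add: field_simps)
      ultimately show ?thesis using that[of b] 2 by simp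
    qed
    define \<alpha> where "\<alpha> = 1 / (2 * b)"
    have b0: "b > 0" using b \<beta> by simp
    have \<alpha>: "1 / 2 \<le> \<alpha>" "\<alpha> < 1 / (2 * \<beta>)" using b \<beta> b0 by (auto simp: \<alpha>_def field_simps)
    have "2 * \<alpha> / (2 * \<alpha> + 1) = 1 / (1 + b)" using b0 by (simp add: \<alpha>_def field_simps)
    then have step_exp: "\<alpha>' < 2 * \<alpha> / (2 * \<alpha> + 1)" using b by simp
    obtain \<theta> where "embeds (iter_wreath k) \<rho> \<alpha> \<theta>" using emb[of \<alpha>] \<alpha> by (auto simp: \<beta>_def)
    from embeds_wr[OF this _ _ \<alpha>(1) \<alpha>'(1) step_exp] dom show ?thesis by (auto simp: dominates_def)
  qed
  moreover have "symmetric_steps (wr (iter_wreath k)) (walk_steps (iter_wreath k) T)"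
    "folner (wr (iter_wreath k))" "group_length (wr (iter_wreath k)) (lamp_sum (iter_wreath k) N)"
    "dominates (wr (iter_wreath k)) (tour (iter_wreath k) \<rho>)"
    using symmetric_walk_steps[OF T] folner_wr[OF fol] subadditive_lamp_sum[OF N] dominates_tour[OF dom] by auto
  ultimately show ?case
    unfolding iter_wreath_Suc[OF step.hyps(1)] by blast
qed

theorem mainTheorem4:
  fixes k :: nat and S :: "iter_elem set"
  assumes "k \<ge> 2"
    and "finite S"
    and "symmetric_generating_set (iter_wreath k) S"
  shows "hilbert_compression_exponent (iter_wreath k) S = ereal (1 / (2 - 2 powr (1 - real k)))
    \<and> poincare_growth_exponent (iter_wreath k) S \<le> ereal (1 / (real k - 1))"
proof
  let ?G = "iter_wreath k"
  interpret iter_group ?G using assms(1) by (intro iter_group_iter_wreath) simp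
  interpret word_metric ?G S using assms by unfold_locales
  obtain T N \<rho> where T: "symmetric_steps ?G T" and fol: "folner ?G" and N: "group_length ?G N"
    and speed: "has_speed ?G T N (1 - (1 / 2) ^ k)"
    and ret: "has_return_exponent ?G T ((real k - 1) / (real k + 1))"
    and dom: "dominates ?G \<rho>"
    and emb: "\<And>\<alpha>. 0 \<le> \<alpha> \<Longrightarrow> \<alpha> < 1 / (2 * (1 - (1 / 2) ^ k)) \<Longrightarrow> \<exists>\<theta>. embeds ?G \<rho> \<alpha> \<theta>"
    using iter_wreath_exponents[of k] assms(1) by auto
  define \<beta> where "\<beta> = 1 - (1 / 2 :: real) ^ k"
  have "(1 / 2 :: real) ^ k \<le> (1 / 2) ^ 1" using assms(1) by (intro power_decreasing) auto
  then have \<beta>: "0 < \<beta>" "\<beta> \<le> 1" by (auto simp: \<beta>_def)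
  have "2 powr (1 - real k) = 2 * (1 / 2 :: real) ^ k"
    by (simp add: powr_diff powr_realpow power_one_over)
  then have eq: "1 / (2 - 2 powr (1 - real k)) = 1 / (2 * \<beta>)" by (simp add: \<beta>_def right_diff_distrib)
  have "hilbert_compression_exponent ?G S \<le> ereal (1 / (2 * \<beta>))"
    unfolding hilbert_compression_exponent_def
  proof (rule Sup_least)
    fix z
    assume "z \<in> {ereal \<alpha> |\<alpha>. 0 \<le> \<alpha> \<and> (\<exists>f c. lipschitz_into_L2 ?G S f \<and> c > 0 \<and>
        (\<forall>x\<in>carrier ?G. \<forall>y\<in>carrier ?G. x \<noteq> y \<longrightarrow>
          L2_norm (\<lambda>t. f x t - f y t) \<ge> c * real (word_dist ?G S x y) powr \<alpha>))}"
    then obtain \<alpha> f c where z: "z = ereal \<alpha>" and lip: "lipschitz_into_L2 ?G S f" and c: "c > 0"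
      and low: "\<And>x y. x \<in> carrier ?G \<Longrightarrow> y \<in> carrier ?G \<Longrightarrow> x \<noteq> y \<Longrightarrow>
        c * real (word_dist ?G S x y) powr \<alpha> \<le> L2_norm (\<lambda>t. f x t - f y t)"
      by blast
    have "\<alpha> \<le> 1 / (2 * \<beta>)"
      using compression_le[OF T fol N speed[folded \<beta>_def] \<beta> lip c low] .
    then show "z \<le> ereal (1 / (2 * \<beta>))" by (simp add: z)
  qed
  moreover have "ereal (1 / (2 * \<beta>)) \<le> hilbert_compression_exponent ?G S"
  proof (rule dense_le_bounded[of 0])
    show "0 < ereal (1 / (2 * \<beta>))" using \<beta> by simp
    fix w assume w: "0 < w" "w < ereal (1 / (2 * \<beta>))"
    then obtain \<alpha> where \<alpha>: "w = ereal \<alpha>" by (cases w) auto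
    then obtain \<theta> where "embeds ?G \<rho> \<alpha> \<theta>" using emb[of \<alpha>] w by (auto simp: \<beta>_def)
    then show "w \<le> hilbert_compression_exponent ?G S"
      using compression_ge[OF word_metric_axioms _ dom, of \<alpha>] w \<alpha> by auto
  qed
  ultimately show "hilbert_compression_exponent ?G S = ereal (1 / (2 - 2 powr (1 - real k)))"
    unfolding eq by (rule antisym)
  have "0 < (real k - 1) / (real k + 1)" "(real k - 1) / (real k + 1) < 1" using assms(1) by auto
  from poincare_growth_le[OF T ret this]
  have "poincare_growth_exponent ?G S \<le> ereal ((1 / ((real k - 1) / (real k + 1)) - 1) / 2)" .
  also have "(1 / ((real k - 1) / (real k + 1)) - 1) / 2 = 1 / (real k - 1)"
    using assms(1) by (simp add: field_simps)
  finally show "poincare_growth_exponent ?G S \<le> ereal (1 / (real k - 1))" .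
qed

end
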